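(* Let $\mu$ be the nonlinear measure associated to an IFS $\{S_i\}_{i\in\mathcal I}$ on $[0,1]^2$ (of the type described in the context) and a probability vector $\{p_i\}_{i\in\mathcal I}$ with each $p_i\in(0,1)$, and suppose that $\{S_i\}_{i\in\mathcal I}$ satisfies the domination condition. Let $\gamma:[0,\infty)\to\mathbb R$ be the associated moment scaling function. Then: (1) For $q\in[0,1]$, $\overline{\tau}_\mu(q)\le\gamma(q)$. (2) For $q\ge 1$, $\underline{\tau}_\mu(q)\ge\gamma(q)$. (3) If moreover $\{S_i\}_{i\in\mathcal I}$ satisfies the rectangular open set condition, then for all $q\ge 0$ the $L^q$-spectrum $\tau_\mu(q)$ exists and $\tau_\mu(q)=\gamma(q)$.
   Context: **IFS.** $\mathcal I$ is a finite index set with $|\mathcal I|\ge 2$, and $\{S_i\}_{i\in\mathcal I}$ is an iterated function system of contractions $S_i:[0,1]^2\to[0,1]^2$ of the form $S_i(a_1,a_2)=(f_i(a_1),g_i(a_1,a_2))$, where $f_i$ and $g_i$ are $C^{1+\alpha}$ contractions on $[0,1]$ and $[0,1]^2$ respectively, for some $0<\alpha\le1$ (their first derivatives are $\alpha$-Hölder; one-sided derivatives are used on the boundary). We also write $f_i(\mathbf a)=f_i(a_1)$ for $\mathbf a=(a_1,a_2)$; $f_{i,x}$ is the derivative of $f_i$ and $g_{i,x},g_{i,y}$ are the partial derivatives of $g_i$. **Nonlinear attractor and measure.** The nonlinear attractor $F$ is the unique non-empty compact set with $F=\bigcup_{i\in\mathcal I}S_i(F)$. The nonlinear measure $\mu$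 associated to $\{S_i\}$ and $\{p_i\}$ is the unique Borel probability measure supported on $F$ with $\mu=\sum_{i\in\mathcal I}p_i\,\mu\circ S_i^{-1}$. **Domination condition.** There is $d>0$ such that for every $i\in\mathcal I$, $$\inf_{\mathbf a\in[0,1]^2}f_{i,x}(\mathbf a)>\sup_{\mathbf a\in[0,1]^2}g_{i,y}(\mathbf a)\ge\inf_{\mathbf a\in[0,1]^2}g_{i,y}(\mathbf a)\ge d.$$ **Rectangular open set condition (ROSC).** The sets $S_i((0,1)^2)$, $i\in\mathcal I$, are pairwise disjoint subsets of $(0,1)^2$. **$L^q$-spectrum.** For a compactly supported finite Borel measure $\nu$ on $\mathbb R^n$, $\delta>0$ and $q\ge0$, let $\mathcal D_\delta$ be the set of closed cubes of the $\delta$-mesh on $\mathbb R^n$ having positive $\nu$-measure and $\mathcal D_\delta^q(\nu)=\sum_{Q\in\mathcal D_\delta}\nu(Q)^q$. For $\nu$ a probability measure put $$\overline\tau_\nu(q)=\limsup_{\delta\to0}\frac{\log\mathcal D^q_\delta(\nu)}{-\log\delta},\qquad \underline\tau_\nu(q)=\liminf_{\delta\to0}\frac{\log\mathcal D^q_\delta(\nu)}{-\log\delta};$$ if they coincide, the common value is the $L^q$-spectrum $\tau_\nu(q)$. **Projection.** $\pi:\mathbb R^2\to\mathbb R$, $\pi(x,y)=x$, and $\pi(\mu)$ denotes the push-forward of $\mu$ under $\pi$. It is a self-conformal measure on $\mathbb R$, and by a known result of Peres and Solomyak $\beta(q):=\tau_{\pi(\mu)}(q)$ exists for all $q\ge0$.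 **Words.** $\mathcal I^*=\bigcup_{k\ge1}\mathcal I^k$; for $\mathfrak i=(i_1,\dots,i_k)$, $S_{\mathfrak i}=S_{i_1}\circ\cdots\circ S_{i_k}$ and $p(\mathfrak i)=p_{i_1}\cdots p_{i_k}$. $D_{\mathbf a}S_{\mathfrak i}$ is the Jacobian matrix of $S_{\mathfrak i}$ at $\mathbf a$, and $\alpha_1(D_{\mathbf a}S_{\mathfrak i})\ge\alpha_2(D_{\mathbf a}S_{\mathfrak i})$ are its singular values (positive square roots of the eigenvalues of $A^TA$ for $A=D_{\mathbf a}S_{\mathfrak i}$). **Pressure and moment scaling function.** Under the domination condition, for $s\in\mathbb R$, $q\ge0$, $\mathbf a\in[0,1]^2$ set $$\psi^{s,q}_{\mathbf a}(\mathfrak i)=p(\mathfrak i)^q\,\alpha_1(D_{\mathbf a}S_{\mathfrak i})^{\beta(q)}\,\alpha_2(D_{\mathbf a}S_{\mathfrak i})^{s-\beta(q)},\qquad \Psi^{s,q}_{\mathbf a,k}=\sum_{\mathfrak i\in\mathcal I^k}\psi^{s,q}_{\mathbf a}(\mathfrak i),$$ $$P(s,q)=\lim_{k\to\infty}\big(\Psi^{s,q}_{\mathbf a,k}\big)^{1/k}.$$ This limit exists and does not depend on $\mathbf a$. For each $q\ge0$ there is a unique $s\in\mathbb R$ with $P(s,q)=1$, and $\gamma(q)$ is defined to be this $s$; $\gamma:[0,\infty)\to\mathbb R$ is called the moment scaling function. *)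

theory Defs
  imports "HOL-Analysis.Analysis" "HOL-Probability.Probability"
begin

section \<open>\<open>L\<^sup>q\<close>-spectra\<close>

definition mesh_cubes :: "real \<Rightarrow> 'a::euclidean_space set set" where
  "mesh_cubes \<delta> = {cbox (\<delta> *\<^sub>R z) (\<delta> *\<^sub>R (z + One)) | z. \<forall>b\<in>Basis. z \<bullet> b \<in> \<int>}"

text \<open>Only cubes of positive measure are summed, so that for \<open>q = 0\<close> this counts them.
  For a finite compactly supported measure only finitely many cubes have positive measure.\<close>
definition lq_sum :: "'a::euclidean_space measure \<Rightarrow> real \<Rightarrow> real \<Rightarrow> real" where
  "lq_sum \<nu> q \<delta> = (\<Sum>Q\<in>{Q\<in>mesh_cubes \<delta>. measure \<nu> Q > 0}. measure \<nu> Q powr q)"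

definition upper_lq_spectrum :: "'a::euclidean_space measure \<Rightarrow> real \<Rightarrow> ereal" where
  "upper_lq_spectrum \<nu> q = Limsup (at_right 0) (\<lambda>\<delta>. ereal (ln (lq_sum \<nu> q \<delta>) / (- ln \<delta>)))"

definition lower_lq_spectrum :: "'a::euclidean_space measure \<Rightarrow> real \<Rightarrow> ereal" where
  "lower_lq_spectrum \<nu> q = Liminf (at_right 0) (\<lambda>\<delta>. ereal (ln (lq_sum \<nu> q \<delta>) / (- ln \<delta>)))"

definition has_lq_spectrum :: "'a::euclidean_space measure \<Rightarrow> real \<Rightarrow> real \<Rightarrow> bool" where
  "has_lq_spectrum \<nu> q t \<longleftrightarrow> lower_lq_spectrum \<nu> q = ereal t \<and> upper_lq_spectrum \<nu> q = ereal t"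

definition lq_spectrum :: "'a::euclidean_space measure \<Rightarrow> real \<Rightarrow> real" where
  "lq_spectrum \<nu> q = (THE t. has_lq_spectrum \<nu> q t)"

section \<open>Iterated function systems of triangular \<open>C\<^bsup>1+\<alpha>\<^esup>\<close> contractions\<close>

text \<open>Maps on the square are total functions on the plane whose values outside the square are
  irrelevant: everywhere below, derivatives are taken within the square (hence are one-sided on
  its boundary) and preimages are intersected with the square.\<close>
abbreviation unit_square :: "(real ^ 2) set" where
  "unit_square \<equiv> cbox 0 1"

abbreviation open_unit_square :: "(real ^ 2) set" where
  "open_unit_square \<equiv> box 0 1"

definition contraction_on :: "'a::metric_space set \<Rightarrow> ('a \<Rightarrow> 'b::metric_space) \<Rightarrow> bool" where
  "contraction_on X h \<longleftrightarrow> (\<exists>c<1. c-lipschitz_on X h)"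

definition C1_holder_on ::
    "real \<Rightarrow> 'a::real_normed_vector set \<Rightarrow> ('a \<Rightarrow> 'b::real_normed_vector) \<Rightarrow> bool" where
  "C1_holder_on \<alpha> X h \<longleftrightarrow>
     (\<forall>x\<in>X. h differentiable (at x within X)) \<and>
     (\<exists>H. \<forall>x\<in>X. \<forall>y\<in>X.
        onorm (\<lambda>v. frechet_derivative h (at x within X) v - frechet_derivative h (at y within X) v)
          \<le> H * dist x y powr \<alpha>)"

definition ifs_map ::
    "('i \<Rightarrow> real \<Rightarrow> real) \<Rightarrow> ('i \<Rightarrow> real ^ 2 \<Rightarrow> real) \<Rightarrow> 'i \<Rightarrow> real ^ 2 \<Rightarrow> real ^ 2" where
  "ifs_map f g i a = vector [f i (a $ 1), g i a]"

text \<open>If \<open>f i\<close> and \<open>g i\<close> are contractions, the combined map need not be one for the Euclidean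
  metric, so this is required separately.\<close>
definition triangular_ifs ::
    "real \<Rightarrow> 'i set \<Rightarrow> ('i \<Rightarrow> real \<Rightarrow> real) \<Rightarrow> ('i \<Rightarrow> real ^ 2 \<Rightarrow> real) \<Rightarrow> bool" where
  "triangular_ifs \<alpha> I f g \<longleftrightarrow>
     finite I \<and> 2 \<le> card I \<and>
     (\<forall>i\<in>I.
        f i \<in> {0..1} \<rightarrow> {0..1} \<and> contraction_on {0..1} (f i) \<and> C1_holder_on \<alpha> {0..1} (f i) \<and>
        g i \<in> unit_square \<rightarrow> {0..1} \<and> contraction_on unit_square (g i) \<and>
        C1_holder_on \<alpha> unit_square (g i) \<and>
        contraction_on unit_square (ifs_map f g i))"

definition attractor :: "'i set \<Rightarrow> ('i \<Rightarrow> real ^ 2 \<Rightarrow> real ^ 2) \<Rightarrow> (real ^ 2) set \<Rightarrow> bool" where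
  "attractor I S F \<longleftrightarrow>
     F \<noteq> {} \<and> compact F \<and> F \<subseteq> unit_square \<and> F = (\<Union>i\<in>I. S i ` F)"

definition nonlinear_measure ::
    "'i set \<Rightarrow> ('i \<Rightarrow> real ^ 2 \<Rightarrow> real ^ 2) \<Rightarrow> ('i \<Rightarrow> real) \<Rightarrow> (real ^ 2) measure \<Rightarrow> bool" where
  "nonlinear_measure I S p \<mu> \<longleftrightarrow>
     prob_space \<mu> \<and> sets \<mu> = sets borel \<and>
     (\<exists>F. attractor I S F \<and> measure \<mu> F = 1) \<and>
     (\<forall>A\<in>sets borel. measure \<mu> A = (\<Sum>i\<in>I. p i * measure \<mu> {x\<in>unit_square. S i x \<in> A}))"

definition deriv_x :: "(real \<Rightarrow> real) \<Rightarrow> real ^ 2 \<Rightarrow> real" where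
  "deriv_x h a = vector_derivative h (at (a $ 1) within {0..1})"

definition partial_y :: "(real ^ 2 \<Rightarrow> real) \<Rightarrow> real ^ 2 \<Rightarrow> real" where
  "partial_y h a = vector_derivative (\<lambda>t. h (vector [a $ 1, t])) (at (a $ 2) within {0..1})"

definition domination ::
    "'i set \<Rightarrow> ('i \<Rightarrow> real \<Rightarrow> real) \<Rightarrow> ('i \<Rightarrow> real ^ 2 \<Rightarrow> real) \<Rightarrow> bool" where
  "domination I f g \<longleftrightarrow>
     (\<exists>d>0. \<forall>i\<in>I.
        (INF a\<in>unit_square. deriv_x (f i) a) > (SUP a\<in>unit_square. partial_y (g i) a) \<and>
        (SUP a\<in>unit_square. partial_y (g i) a) \<ge> (INF a\<in>unit_square. partial_y (g i) a) \<and>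
        (INF a\<in>unit_square. partial_y (g i) a) \<ge> d)"

definition rosc :: "'i set \<Rightarrow> ('i \<Rightarrow> real ^ 2 \<Rightarrow> real ^ 2) \<Rightarrow> bool" where
  "rosc I S \<longleftrightarrow>
     (\<forall>i\<in>I. S i ` open_unit_square \<subseteq> open_unit_square) \<and>
     disjoint_family_on (\<lambda>i. S i ` open_unit_square) I"

section \<open>Pressure and the moment scaling function\<close>

definition words :: "'i set \<Rightarrow> nat \<Rightarrow> 'i list set" where
  "words I k = {w. length w = k \<and> set w \<subseteq> I}"

definition word_map :: "('i \<Rightarrow> 'a \<Rightarrow> 'a) \<Rightarrow> 'i list \<Rightarrow> 'a \<Rightarrow> 'a" where
  "word_map S w = foldr (\<circ>) (map S w) id"

definition word_weight :: "('i \<Rightarrow> real) \<Rightarrow> 'i list \<Rightarrow> real" where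
  "word_weight p w = prod_list (map p w)"

definition matrix_eigenvalue :: "real ^ 'n ^ 'n \<Rightarrow> real \<Rightarrow> bool" where
  "matrix_eigenvalue A l \<longleftrightarrow> (\<exists>v. v \<noteq> 0 \<and> A *v v = l *\<^sub>R v)"

definition singular_values :: "real ^ 'n ^ 'n \<Rightarrow> real set" where
  "singular_values A = {sqrt l | l. matrix_eigenvalue (transpose A ** A) l}"

text \<open>A \<open>2 \<times> 2\<close> matrix has two singular values counted with multiplicity, so they are the
  largest and the smallest element of the set of singular values.\<close>
definition \<alpha>\<^sub>1 :: "real ^ 2 ^ 2 \<Rightarrow> real" where
  "\<alpha>\<^sub>1 A = Max (singular_values A)"

definition \<alpha>\<^sub>2 :: "real ^ 2 ^ 2 \<Rightarrow> real" where
  "\<alpha>\<^sub>2 A = Min (singular_values A)"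

definition proj_spectrum :: "(real ^ 2) measure \<Rightarrow> real \<Rightarrow> real" where
  "proj_spectrum \<mu> q = lq_spectrum (distr \<mu> borel (\<lambda>x. x $ 1)) q"

definition word_potential ::
    "('i \<Rightarrow> real ^ 2 \<Rightarrow> real ^ 2) \<Rightarrow> ('i \<Rightarrow> real) \<Rightarrow> (real ^ 2) measure \<Rightarrow>
     real \<Rightarrow> real \<Rightarrow> real ^ 2 \<Rightarrow> 'i list \<Rightarrow> real" where
  "word_potential S p \<mu> s q a w =
     (let D = jacobian (word_map S w) (at a within unit_square); \<beta> = proj_spectrum \<mu> q
      in word_weight p w powr q * \<alpha>\<^sub>1 D powr \<beta> * \<alpha>\<^sub>2 D powr (s - \<beta>))"

definition pressure ::
    "'i set \<Rightarrow> ('i \<Rightarrow> real ^ 2 \<Rightarrow> real ^ 2) \<Rightarrow> ('i \<Rightarrow> real) \<Rightarrow> (real ^ 2) measure \<Rightarrow>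
     real \<Rightarrow> real \<Rightarrow> real" where
  "pressure I S p \<mu> s q =
     (THE L. \<forall>a\<in>unit_square.
        (\<lambda>k. root k (\<Sum>w\<in>words I k. word_potential S p \<mu> s q a w)) \<longlonglongrightarrow> L)"

definition moment_scaling ::
    "'i set \<Rightarrow> ('i \<Rightarrow> real ^ 2 \<Rightarrow> real ^ 2) \<Rightarrow> ('i \<Rightarrow> real) \<Rightarrow> (real ^ 2) measure \<Rightarrow>
     real \<Rightarrow> real" where
  "moment_scaling I S p \<mu> q = (THE s. pressure I S p \<mu> s q = 1)"

end

theory Submission
  imports Defs
begin

text \<open>A bounded distortion argument replaces the derivative cocycles of the system by quasi-multiplicative
  functions \<open>F w\<close> and \<open>G w\<close> of words, the width and the height of the image of the square;
  by domination the shear of the image is at most of order \<open>F w\<close>, so \<open>F\<close> and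
  \<open>G\<close> are comparable with the singular values.  Quasi-multiplicativity makes the sum of the
  potential at \<open>s = \<gamma> q\<close> over all words of a given length, and hence over any
  stopping set, bounded above and away from \<open>0\<close>.

  Stop words at height \<open>G w \<approx> \<delta>\<close>.  The part of the measure carried by such a
  word is a strip of height about \<open>\<delta>\<close>, so its moment sum at scale \<open>\<delta>\<close> is
  comparable with that of the projected measure at scale \<open>\<delta> / F w\<close>, which is
  \<open>(F w / \<delta>)\<close> to the power \<open>\<beta> q\<close> up to an error in the exponent; the exponent
  \<open>\<beta> q\<close> exists because the moment sums of the projection are sub- or supermultiplicative in the scale.  Summing over the
  stopping set gives \<open>\<delta>\<close> to the power \<open>- \<gamma> q\<close>.  The moment sum of the whole measure is at most
  the sum over words for \<open>q \<le> 1\<close> and at least that sum for \<open>q \<ge> 1\<close>; under the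
  rectangular open set condition each cube meets boundedly many strips and both bounds hold.\<close>

text \<open>\<open>pressure\<close>, \<open>moment_scaling\<close> and \<open>proj_spectrum\<close>
  are definite descriptions, so the limits and the unique solution behind them have to be
  established first. The hard one is \<open>proj_spectrum\<close>: the intervals of the projected
  system may overlap, even under \<open>rosc\<close>, so the number of words charging a cell is not
  bounded. Jensen's inequality then gives only one of the two multiplicative inequalities, with a
  direction that changes at q = 1. This suffices for Fekete's lemma, but leaves an error in the
  exponent. For sums over words, concatenation gives both inequalities and hence bounds up to
  constants.

  Domination enters in three ways. The height is at most the width, so the rescaled mesh size
  \<open>\<delta> / F w\<close> stays bounded, where the asymptotics of the projection are uniform.
  The strict gap makes the relative shear a convergent geometric series. The lower bound d turns
  Hoelder errors of the derivatives into relative errors, which bounds the distortion. Apart from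
  the power of \<delta>, the exponent error costs only a factor \<open>F w powr \<epsilon>\<close>,
  bounded uniformly in w, so it survives the sum over words.\<close>

section \<open>Powers of sums and growth of sequences\<close>

text \<open>Bernoulli's inequality, read off from Young's inequality with weights \<open>1/q\<close>
  and \<open>1 - 1/q\<close> applied to \<open>t powr q\<close> and 1.\<close>

lemma powr_ge_tangent:
  fixes t q :: real
  assumes "0 \<le> t" "1 \<le> q"
  shows "1 + q * (t - 1) \<le> t powr q"
proof (cases "t = 0")
  case False
  then have "(t powr q) powr (1/q) * 1 powr (1 - 1/q) \<le> (1/q) * t powr q + (1 - 1/q) * 1"
    using assms by (intro Youngs_inequality_0) auto
  then have "t \<le> (1/q) * t powr q + (1 - 1/q)"
    using assms False by (simp add: powr_powr)
  then have "q * t \<le> q * ((1/q) * t powr q + (1 - 1/q))"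
    using assms by (intro mult_left_mono) auto
  also have "\<dots> = t powr q + (q - 1)" using assms by (simp add: distrib_left right_diff_distrib)
  finally show ?thesis by (simp add: algebra_simps)
qed (use assms in simp)

lemma powr_le_tangent:
  fixes t q :: real
  assumes "0 \<le> t" "0 \<le> q" "q \<le> 1"
  shows "t powr q \<le> 1 + q * (t - 1)"
proof (cases "t = 0")
  case False
  then have "t powr q * 1 powr (1 - q) \<le> q * t + (1 - q) * 1"
    using assms by (intro Youngs_inequality_0) auto
  then show ?thesis by (simp add: field_simps)
qed (use assms in simp)

text \<open>Jensen's inequality with weights of arbitrary positive total. The tangent inequality is
  applied at the weighted mean \<open>m\<close>, where the linear terms cancel in the sum.\<close>

lemma weighted_sum_powr_convex:
  fixes c x :: "'a \<Rightarrow> real"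
  assumes "\<And>v. v \<in> V \<Longrightarrow> 0 \<le> c v" "\<And>v. v \<in> V \<Longrightarrow> 0 \<le> x v" "0 < sum c V" "1 \<le> q"
  shows "(\<Sum>v\<in>V. c v * x v) powr q \<le> sum c V powr (q - 1) * (\<Sum>v\<in>V. c v * x v powr q)"
proof (cases "(\<Sum>v\<in>V. c v * x v) = 0")
  case True
  then show ?thesis using assms by (auto intro!: mult_nonneg_nonneg sum_nonneg)
next
  case False
  define P m where "P = sum c V" and "m = (\<Sum>v\<in>V. c v * x v) / P"
  have P: "P > 0" using assms P_def by simp
  have m: "m > 0" using False P assms by (auto simp: m_def less_le intro!: sum_nonneg divide_nonneg_pos)
  have "P = (\<Sum>v\<in>V. c v * (1 + q * (x v / m - 1)))"
  proof -
    have "(\<Sum>v\<in>V. c v * (1 + q * (x v / m - 1))) = P + q * ((\<Sum>v\<in>V. c v * x v) / m - P)"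
      by (simp add: algebra_simps sum.distrib sum_distrib_left sum_subtractf P_def sum_divide_distrib)
    moreover have "(\<Sum>v\<in>V. c v * x v) / m = P" using False P by (simp add: m_def)
    ultimately show ?thesis by simp
  qed
  also have "\<dots> \<le> (\<Sum>v\<in>V. c v * (x v / m) powr q)"
    using assms m by (intro sum_mono mult_left_mono powr_ge_tangent) auto
  also have "\<dots> = (\<Sum>v\<in>V. c v * x v powr q) / m powr q"
    using assms m by (auto simp: powr_divide sum_divide_distrib intro!: sum.cong)
  finally have *: "P * m powr q \<le> (\<Sum>v\<in>V. c v * x v powr q)"
    using m by (simp add: field_simps)
  have "(\<Sum>v\<in>V. c v * x v) = P * m" using P by (simp add: m_def)
  then have "(\<Sum>v\<in>V. c v * x v) powr q = P powr (q - 1) * (P * m powr q)"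
    using P m by (simp add: powr_mult powr_diff)
  also have "\<dots> \<le> P powr (q - 1) * (\<Sum>v\<in>V. c v * x v powr q)"
    using * by (intro mult_left_mono) auto
  finally show ?thesis by (simp add: P_def)
qed

lemma weighted_sum_powr_concave:
  fixes c x :: "'a \<Rightarrow> real"
  assumes "finite V" "\<And>v. v \<in> V \<Longrightarrow> 0 \<le> c v" "\<And>v. v \<in> V \<Longrightarrow> 0 \<le> x v" "0 < sum c V"
    "0 \<le> q" "q \<le> 1"
  shows "sum c V powr (q - 1) * (\<Sum>v\<in>V. c v * x v powr q) \<le> (\<Sum>v\<in>V. c v * x v) powr q"
proof (cases "(\<Sum>v\<in>V. c v * x v) = 0")
  case True
  then have "\<forall>v\<in>V. c v * x v = 0" using assms by (subst (asm) sum_nonneg_eq_0_iff) auto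
  then have "(\<Sum>v\<in>V. c v * x v powr q) = 0" by (intro sum.neutral) auto
  then show ?thesis by simp
next
  case False
  define P m where "P = sum c V" and "m = (\<Sum>v\<in>V. c v * x v) / P"
  have P: "P > 0" using assms P_def by simp
  have m: "m > 0" using False P assms by (auto simp: m_def less_le intro!: sum_nonneg divide_nonneg_pos)
  have "(\<Sum>v\<in>V. c v * x v powr q) / m powr q = (\<Sum>v\<in>V. c v * (x v / m) powr q)"
    using assms m by (auto simp: powr_divide sum_divide_distrib intro!: sum.cong)
  also have "\<dots> \<le> (\<Sum>v\<in>V. c v * (1 + q * (x v / m - 1)))"
    using assms m by (intro sum_mono mult_left_mono powr_le_tangent) auto
  also have "(\<Sum>v\<in>V. c v * (1 + q * (x v / m - 1))) = P"
  proof -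
    have "(\<Sum>v\<in>V. c v * (1 + q * (x v / m - 1))) = P + q * ((\<Sum>v\<in>V. c v * x v) / m - P)"
      by (simp add: algebra_simps sum.distrib sum_distrib_left sum_subtractf P_def sum_divide_distrib)
    moreover have "(\<Sum>v\<in>V. c v * x v) / m = P" using False P by (simp add: m_def)
    ultimately show ?thesis by simp
  qed
  finally have *: "(\<Sum>v\<in>V. c v * x v powr q) \<le> P * m powr q"
    using m by (simp add: field_simps)
  have "(\<Sum>v\<in>V. c v * x v) = P * m" using P by (simp add: m_def)
  then have "(\<Sum>v\<in>V. c v * x v) powr q = P powr (q - 1) * (P * m powr q)"
    using P m by (simp add: powr_mult powr_diff)
  also have "\<dots> \<ge> P powr (q - 1) * (\<Sum>v\<in>V. c v * x v powr q)"
    using * by (intro mult_left_mono) auto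
  finally show ?thesis by (simp add: P_def)
qed

text \<open>Since \<open>0 powr 0 = 0\<close>, for \<open>q = 0\<close> the sums below count the positive terms.\<close>

lemma sum_powr_subadditive:
  fixes x :: "'a \<Rightarrow> real"
  assumes "\<And>v. v \<in> V \<Longrightarrow> 0 \<le> x v" "0 \<le> q" "q \<le> 1"
  shows "(\<Sum>v\<in>V. x v) powr q \<le> (\<Sum>v\<in>V. x v powr q)"
proof (cases "sum x V = 0")
  case True
  then show ?thesis by (auto intro!: sum_nonneg)
next
  case False
  define s where "s = sum x V"
  have fin: "finite V" using False by (rule contrapos_np) simp
  have s: "s > 0" using False assms by (auto simp: s_def less_le intro!: sum_nonneg)
  have "1 = (\<Sum>v\<in>V. x v / s)" using s by (simp add: s_def flip: sum_divide_distrib)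
  also have "\<dots> \<le> (\<Sum>v\<in>V. (x v / s) powr q)"
  proof (rule sum_mono)
    fix v assume v: "v \<in> V"
    have le: "x v / s \<le> 1" using s assms v fin by (auto simp: s_def intro: member_le_sum)
    show "x v / s \<le> (x v / s) powr q"
    proof (cases "x v = 0")
      case False
      then have "x v / s > 0" using s assms v by (simp add: less_le)
      then have "(x v / s) powr 1 \<le> (x v / s) powr q" using le assms by (intro powr_mono') auto
      then show ?thesis using \<open>x v / s > 0\<close> powr_one[of "x v / s"] by linarith
    qed simp
  qed
  also have "\<dots> = (\<Sum>v\<in>V. x v powr q) / s powr q"
    using assms s by (auto simp: powr_divide sum_divide_distrib intro!: sum.cong)
  finally show ?thesis using s by (simp add: field_simps s_def)
qed

text \<open>Subadditivity for the exponent \<open>1/q\<close>, applied to the terms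
  \<open>x v powr q\<close>.\<close>

lemma sum_powr_superadditive:
  fixes x :: "'a \<Rightarrow> real"
  assumes "\<And>v. v \<in> V \<Longrightarrow> 0 \<le> x v" "1 \<le> q"
  shows "(\<Sum>v\<in>V. x v powr q) \<le> (\<Sum>v\<in>V. x v) powr q"
proof -
  have "(\<Sum>v\<in>V. x v) = (\<Sum>v\<in>V. (x v powr q) powr (1/q))"
    using assms by (intro sum.cong) (auto simp: powr_powr)
  moreover have "\<dots> \<ge> (\<Sum>v\<in>V. x v powr q) powr (1/q)"
    using assms by (intro sum_powr_subadditive) auto
  ultimately have "((\<Sum>v\<in>V. x v powr q) powr (1/q)) powr q \<le> (\<Sum>v\<in>V. x v) powr q"
    using assms by (intro powr_mono2) auto
  then show ?thesis using assms by (simp add: powr_powr sum_nonneg)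
qed

text \<open>Comparison with the largest term gives one constant that is valid on both sides of q =
  1.\<close>

lemma powr_sum_le_card:
  fixes x :: "'a \<Rightarrow> real"
  assumes "finite V" "\<And>v. v \<in> V \<Longrightarrow> 0 \<le> x v" "0 \<le> q" "card V \<le> N"
  shows "(\<Sum>v\<in>V. x v) powr q \<le> real N powr q * (\<Sum>v\<in>V. x v powr q)"
proof (cases "V = {}")
  case False
  define m where "m = Max (x ` V)"
  have "m \<in> x ` V" unfolding m_def using assms False by (intro Max_in) auto
  then obtain u where u: "u \<in> V" "m = x u" by auto
  have le: "x v \<le> m" if "v \<in> V" for v using that assms by (auto simp: m_def)
  have "(\<Sum>v\<in>V. x v) \<le> real (card V) * m" using le by (intro sum_bounded_above) auto
  also have "\<dots> \<le> real N * m" using assms u by (intro mult_right_mono) auto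
  finally have "(\<Sum>v\<in>V. x v) powr q \<le> (real N * m) powr q"
    using assms by (intro powr_mono2 sum_nonneg) auto
  also have "\<dots> = real N powr q * x u powr q" using u assms by (simp add: powr_mult)
  also have "\<dots> \<le> real N powr q * (\<Sum>v\<in>V. x v powr q)"
    using assms u by (intro mult_left_mono member_le_sum) auto
  finally show ?thesis .
qed simp

lemma sum_powr_le_card:
  fixes x :: "'a \<Rightarrow> real"
  assumes "finite V" "\<And>v. v \<in> V \<Longrightarrow> 0 \<le> x v" "0 \<le> q" "card V \<le> N"
  shows "(\<Sum>v\<in>V. x v powr q) \<le> real N * (\<Sum>v\<in>V. x v) powr q"
proof -
  have "(\<Sum>v\<in>V. x v powr q) \<le> real (card V) * (\<Sum>v\<in>V. x v) powr q"
    using assms by (intro sum_bounded_above powr_mono2 member_le_sum) auto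
  also have "\<dots> \<le> real N * (\<Sum>v\<in>V. x v) powr q" using assms by (intro mult_right_mono) auto
  finally show ?thesis .
qed

text \<open>The mass of each a is covered by at most N of the b, and each b is used for at most M of
  the a; exchanging the order of summation counts the pairs. \<open>R\<close> will be an incidence
  between cubes of one or two meshes.\<close>

lemma sum_powr_compare:
  fixes x :: "'a \<Rightarrow> real" and y :: "'b \<Rightarrow> real"
  assumes fin: "finite A" "finite B"
    and nonneg: "\<And>a. a \<in> A \<Longrightarrow> 0 \<le> x a" "\<And>b. b \<in> B \<Longrightarrow> 0 \<le> y b" "0 \<le> q"
    and le: "\<And>a. a \<in> A \<Longrightarrow> x a \<le> (\<Sum>b\<in>{b\<in>B. R a b}. y b)"
    and cardB: "\<And>a. a \<in> A \<Longrightarrow> card {b\<in>B. R a b} \<le> N"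
    and cardA: "\<And>b. b \<in> B \<Longrightarrow> card {a\<in>A. R a b} \<le> M"
  shows "(\<Sum>a\<in>A. x a powr q) \<le> real N powr q * (real M * (\<Sum>b\<in>B. y b powr q))"
proof -
  have "(\<Sum>a\<in>A. x a powr q) \<le> (\<Sum>a\<in>A. real N powr q * (\<Sum>b\<in>{b\<in>B. R a b}. y b powr q))"
  proof (rule sum_mono)
    fix a assume a: "a \<in> A"
    have "x a powr q \<le> (\<Sum>b\<in>{b\<in>B. R a b}. y b) powr q"
      using a nonneg le by (intro powr_mono2) auto
    also have "\<dots> \<le> real N powr q * (\<Sum>b\<in>{b\<in>B. R a b}. y b powr q)"
      using a fin nonneg cardB by (intro powr_sum_le_card) auto
    finally show "x a powr q \<le> real N powr q * (\<Sum>b\<in>{b\<in>B. R a b}. y b powr q)" .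
  qed
  also have "\<dots> = real N powr q * (\<Sum>b\<in>B. \<Sum>a\<in>{a\<in>A. R a b}. y b powr q)"
    unfolding sum_distrib_left[symmetric]
    using fin by (subst sum.swap_restrict) auto
  also have "(\<Sum>b\<in>B. \<Sum>a\<in>{a\<in>A. R a b}. y b powr q) \<le> (\<Sum>b\<in>B. real M * y b powr q)"
    using cardA by (intro sum_mono) (auto intro!: mult_right_mono)
  finally show ?thesis by (simp add: sum_distrib_left mult_left_mono)
qed

text \<open>Both \<open>real m * a n\<close> and \<open>real n * a m\<close> approximate
  \<open>a (m * n)\<close>, so every lower slope \<open>(a n - K) / n\<close> is below every upper
  slope \<open>(a m + K) / m\<close>, and the supremum of the lower slopes serves as L. Unlike in
  Fekete's lemma, the error does not grow with n.\<close>

lemma almost_additive_growth: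
  fixes a :: "nat \<Rightarrow> real"
  assumes a: "\<And>m n. \<bar>a (m + n) - a m - a n\<bar> \<le> K"
  shows "\<exists>L. \<forall>n. \<bar>a n - real n * L\<bar> \<le> K"
proof -
  have mult: "\<bar>a (m * n) - real m * a n\<bar> \<le> (real m - 1) * K" if "m \<ge> 1" for m n
    using that
  proof (induction m rule: dec_induct)
    case (step m)
    have "\<bar>a (Suc m * n) - a n - a (m * n)\<bar> \<le> K" using a[of n "m * n"] by (simp add: algebra_simps)
    moreover have "a (Suc m * n) - real (Suc m) * a n =
      (a (Suc m * n) - a n - a (m * n)) + (a (m * n) - real m * a n)" by (simp add: algebra_simps)
    ultimately show ?case using step by (simp add: algebra_simps)
  qed simp
  have cmp: "(a n - K) / real n \<le> (a m + K) / real m" if "m \<ge> 1" "n \<ge> 1" for m n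
  proof -
    have K: "K \<ge> 0" using a[of 0 0] by linarith
    have "real m * a n - (real m - 1) * K \<le> real n * a m + (real n - 1) * K"
      using mult[of m n] mult[of n m] that by (auto simp: mult.commute[of m n])
    then have "real m * (a n - K) \<le> real n * (a m + K)" using K by (simp add: algebra_simps)
    then show ?thesis using that by (simp add: field_simps)
  qed
  define L where "L = (SUP n\<in>{1..}. (a n - K) / real n)"
  have bdd: "bdd_above ((\<lambda>n. (a n - K) / real n) ` {1..})"
    using cmp[of 1] by (intro bdd_aboveI[of _ "a 1 + K"]) auto
  have "\<bar>a n - real n * L\<bar> \<le> K" for n
  proof (cases "n = 0")
    case True
    then show ?thesis using a[of 0 0] by simp
  next
    case False
    have "(a n - K) / real n \<le> L" unfolding L_def using bdd False by (intro cSUP_upper) auto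
    moreover have "L \<le> (a n + K) / real n" unfolding L_def using cmp False by (intro cSUP_least) auto
    ultimately show ?thesis using False by (simp add: field_simps abs_le_iff)
  qed
  then show ?thesis by blast
qed

text \<open>Fekete's lemma; the linear lower bound keeps the infimum of the slopes finite.\<close>

lemma fekete:
  fixes a :: "nat \<Rightarrow> real"
  assumes sub: "\<And>m n. a (m + n) \<le> a m + a n" and low: "\<And>n. - B * real n \<le> a n"
  shows "\<exists>L. (\<lambda>n. a n / real n) \<longlonglongrightarrow> L"
proof -
  define L where "L = (INF n\<in>{1..}. a n / real n)"
  have bdd: "bdd_below ((\<lambda>n. a n / real n) ` {1..})"
  proof (rule bdd_belowI2)
    fix n :: nat assume "n \<in> {1..}"
    then show "- B \<le> a n / real n" using low[of n] by (simp add: field_simps)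
  qed
  have Lle: "L \<le> a n / real n" if "n \<ge> 1" for n
    unfolding L_def using bdd that by (intro cINF_lower) auto
  have "(\<lambda>n. a n / real n) \<longlonglongrightarrow> L"
  proof (rule LIMSEQ_I)
    fix r :: real assume r: "r > 0"
    have "\<exists>x\<in>(\<lambda>n. a n / real n) ` {1..}. x < L + r / 2"
      unfolding L_def using r bdd by (subst cInf_less_iff[symmetric]) (auto simp del: One_nat_def)
    then obtain m where m: "m \<ge> 1" "a m / real m < L + r / 2" by auto
    define C where "C = Max (a ` {..<m}) "
    have C: "a j \<le> C" if "j < m" for j unfolding C_def using that by (intro Max_ge) auto
    have mult: "a (k * m + j) \<le> real k * a m + a j" for k j
    proof (induction k)
      case (Suc k)
      have "a (Suc k * m + j) \<le> a m + a (k * m + j)"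
        using sub[of m "k * m + j"] by (simp add: algebra_simps)
      then show ?case using Suc by (simp add: algebra_simps)
    qed simp
    have bound: "a n / real n \<le> a m / real m + (\<bar>a m\<bar> + \<bar>C\<bar>) / real n" if n: "n \<ge> 1" for n
    proof -
      define k j where "k = n div m" and "j = n mod m"
      have nk: "n = k * m + j" by (simp add: k_def j_def)
      have j: "j < m" using m by (simp add: j_def)
      have "real k * a m = real n * (a m / real m) - real j * (a m / real m)"
        using m by (subst nk) (simp add: field_simps)
      moreover have "- (real j * (a m / real m)) \<le> \<bar>a m\<bar>"
      proof -
        have "\<bar>real j * (a m / real m)\<bar> = (real j / real m) * \<bar>a m\<bar>" by (simp add: abs_mult)
        also have "\<dots> \<le> 1 * \<bar>a m\<bar>" using j m by (intro mult_right_mono) auto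
        finally show ?thesis by linarith
      qed
      ultimately have "a n \<le> real n * (a m / real m) + (\<bar>a m\<bar> + \<bar>C\<bar>)"
        using mult[of k j] nk C[OF j] by simp
      then have "a n / real n \<le> (real n * (a m / real m) + (\<bar>a m\<bar> + \<bar>C\<bar>)) / real n"
        by (intro divide_right_mono) auto
      then show ?thesis using n by (simp add: add_divide_distrib)
    qed
    obtain N where N: "real N > (\<bar>a m\<bar> + \<bar>C\<bar>) * 2 / r" using reals_Archimedean2 by blast
    show "\<exists>N. \<forall>n\<ge>N. norm (a n / real n - L) < r"
    proof (intro exI[of _ "max N 1"] allI impI)
      fix n assume n: "n \<ge> max N 1"
      then have "real n \<ge> real N" by simp
      then have "real n > (\<bar>a m\<bar> + \<bar>C\<bar>) * 2 / r" using N by linarith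
      then have "(\<bar>a m\<bar> + \<bar>C\<bar>) / real n < r / 2" using r n by (simp add: field_simps)
      moreover have "a n / real n \<le> a m / real m + (\<bar>a m\<bar> + \<bar>C\<bar>) / real n" "L \<le> a n / real n"
        using bound[of n] Lle[of n] n by auto
      ultimately show "norm (a n / real n - L) < r" using m(2) r unfolding real_norm_def by linarith
    qed
  qed
  then show ?thesis by blast
qed

section \<open>Upper and lower exponents from power bounds\<close>

lemma tendsto_inverse_neg_ln:
  fixes c :: real
  shows "((\<lambda>\<delta>. c / (- ln \<delta>)) \<longlongrightarrow> 0) (at_right 0)"
proof -
  have "filterlim (\<lambda>\<delta>::real. - ln \<delta>) at_top (at_right 0)"
    using ln_at_0 by (simp add: filterlim_uminus_at_top)
  then show ?thesis by (intro tendsto_divide_0[OF tendsto_const] filterlim_at_top_imp_at_infinity)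
qed

text \<open>The factor C disappears after division by \<open>- ln \<delta>\<close>, which tends to
  infinity. Positivity of \<open>x \<delta>\<close> is part of the bound because the logarithm is
  monotone only on positive numbers; in the lower bound below it follows from the bound
  itself.\<close>

lemma Limsup_log_ratio_le:
  fixes x :: "real \<Rightarrow> real"
  assumes "\<And>\<epsilon>. \<epsilon> > 0 \<Longrightarrow> \<exists>C>0. \<forall>\<delta>. 0 < \<delta> \<and> \<delta> < 1 \<longrightarrow> 0 < x \<delta> \<and> x \<delta> \<le> C * \<delta> powr (- (t + \<epsilon>))"
  shows "Limsup (at_right 0) (\<lambda>\<delta>. ereal (ln (x \<delta>) / (- ln \<delta>))) \<le> ereal t"
proof (rule ereal_le_epsilon2)
  fix \<epsilon> :: real assume "\<epsilon> > 0"
  then obtain C where C: "C > 0"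
    "\<And>\<delta>. 0 < \<delta> \<Longrightarrow> \<delta> < 1 \<Longrightarrow> 0 < x \<delta> \<and> x \<delta> \<le> C * \<delta> powr (- (t + \<epsilon>))" using assms by meson
  have "Limsup (at_right 0) (\<lambda>\<delta>. ereal (ln (x \<delta>) / (- ln \<delta>)))
      \<le> Limsup (at_right 0) (\<lambda>\<delta>. ereal (ln C / (- ln \<delta>) + (t + \<epsilon>)))"
  proof (rule Limsup_mono)
    have "eventually (\<lambda>\<delta>::real. \<delta> \<in> {0<..<1}) (at_right 0)"
      by (rule eventually_at_right_real) simp
    then show "eventually (\<lambda>\<delta>. ereal (ln (x \<delta>) / (- ln \<delta>)) \<le> ereal (ln C / (- ln \<delta>) + (t + \<epsilon>)))
      (at_right 0)"
    proof eventually_elim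
      case (elim \<delta>)
      then have "ln (x \<delta>) \<le> ln (C * \<delta> powr (- (t + \<epsilon>)))" using C(1) C(2)[of \<delta>] by (subst ln_le_cancel_iff) auto
      also have "\<dots> = ln C + (t + \<epsilon>) * (- ln \<delta>)" using C(1) elim by (simp add: ln_mult ln_powr algebra_simps)
      finally have "ln (x \<delta>) / (- ln \<delta>) \<le> (ln C + (t + \<epsilon>) * (- ln \<delta>)) / (- ln \<delta>)"
        using elim by (intro divide_right_mono) auto
      also have "\<dots> = ln C / (- ln \<delta>) + (t + \<epsilon>)" using elim by (simp add: field_simps)
      finally show ?case by simp
    qed
  qed
  also have "\<dots> = ereal (0 + (t + \<epsilon>))"
    by (intro lim_imp_Limsup tendsto_ereal tendsto_add tendsto_inverse_neg_ln tendsto_const) simp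
  finally show "Limsup (at_right 0) (\<lambda>\<delta>. ereal (ln (x \<delta>) / (- ln \<delta>))) \<le> ereal t + ereal \<epsilon>" by simp
qed

lemma Liminf_log_ratio_ge:
  fixes x :: "real \<Rightarrow> real"
  assumes "\<And>\<epsilon>. \<epsilon> > 0 \<Longrightarrow> \<exists>C>0. \<forall>\<delta>. 0 < \<delta> \<and> \<delta> < 1 \<longrightarrow> C * \<delta> powr (- (t - \<epsilon>)) \<le> x \<delta>"
  shows "ereal t \<le> Liminf (at_right 0) (\<lambda>\<delta>. ereal (ln (x \<delta>) / (- ln \<delta>)))"
proof (rule ereal_le_epsilon2)
  fix \<epsilon> :: real assume "\<epsilon> > 0"
  then obtain C where C: "C > 0"
    "\<And>\<delta>. 0 < \<delta> \<Longrightarrow> \<delta> < 1 \<Longrightarrow> C * \<delta> powr (- (t - \<epsilon>)) \<le> x \<delta>" using assms by meson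
  have "ereal (0 + (t - \<epsilon>)) = Liminf (at_right 0) (\<lambda>\<delta>. ereal (ln C / (- ln \<delta>) + (t - \<epsilon>)))"
    by (intro lim_imp_Liminf[symmetric] tendsto_ereal tendsto_add tendsto_inverse_neg_ln tendsto_const) simp
  also have "\<dots> \<le> Liminf (at_right 0) (\<lambda>\<delta>. ereal (ln (x \<delta>) / (- ln \<delta>)))"
  proof (rule Liminf_mono)
    have "eventually (\<lambda>\<delta>::real. \<delta> \<in> {0<..<1}) (at_right 0)"
      by (rule eventually_at_right_real) simp
    then show "eventually (\<lambda>\<delta>. ereal (ln C / (- ln \<delta>) + (t - \<epsilon>)) \<le> ereal (ln (x \<delta>) / (- ln \<delta>)))
      (at_right 0)"
    proof eventually_elim
      case (elim \<delta>)
      have pos: "0 < C * \<delta> powr (- (t - \<epsilon>))" using C(1) elim by simp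
      have "ln C + (t - \<epsilon>) * (- ln \<delta>) = ln (C * \<delta> powr (- (t - \<epsilon>)))"
        using C(1) elim by (simp add: ln_mult ln_powr algebra_simps)
      also have "\<dots> \<le> ln (x \<delta>)" using C(2)[of \<delta>] elim pos by (subst ln_le_cancel_iff) auto
      finally have "(ln C + (t - \<epsilon>) * (- ln \<delta>)) / (- ln \<delta>) \<le> ln (x \<delta>) / (- ln \<delta>)"
        using elim by (intro divide_right_mono) auto
      moreover have "(ln C + (t - \<epsilon>) * (- ln \<delta>)) / (- ln \<delta>) = ln C / (- ln \<delta>) + (t - \<epsilon>)"
        using elim by (simp add: field_simps)
      ultimately show ?case by simp
    qed
  qed
  finally show "ereal t \<le> Liminf (at_right 0) (\<lambda>\<delta>. ereal (ln (x \<delta>) / (- ln \<delta>))) + ereal \<epsilon>"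
    by (cases "Liminf (at_right 0) (\<lambda>\<delta>. ereal (ln (x \<delta>) / (- ln \<delta>)))") auto
qed

section \<open>Mesh cubes and pulled back moment sums\<close>

definition mesh_meeting :: "real \<Rightarrow> 'a::euclidean_space set \<Rightarrow> 'a set set" where
  "mesh_meeting \<delta> X = {Q \<in> mesh_cubes \<delta>. Q \<inter> X \<noteq> {}}"

lemma mesh_cubes_cover:
  fixes x :: "'a::euclidean_space"
  assumes "\<delta> > 0"
  obtains Q where "Q \<in> mesh_cubes \<delta>" "x \<in> Q"
proof -
  define z :: 'a where "z = (\<Sum>b\<in>Basis. of_int \<lfloor>x \<bullet> b / \<delta>\<rfloor> *\<^sub>R b)"
  have z: "z \<bullet> b = of_int \<lfloor>x \<bullet> b / \<delta>\<rfloor>" if "b \<in> Basis" for b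
    using that by (simp add: z_def inner_sum_left inner_Basis if_distrib cong: if_cong)
  have "x \<in> cbox (\<delta> *\<^sub>R z) (\<delta> *\<^sub>R (z + One))"
    unfolding mem_box
  proof (intro ballI conjI)
    fix b :: 'a assume b: "b \<in> Basis"
    define k where "k = \<lfloor>x \<bullet> b / \<delta>\<rfloor>"
    have "of_int k \<le> x \<bullet> b / \<delta>" "x \<bullet> b / \<delta> \<le> of_int k + 1" unfolding k_def by linarith+
    then show "\<delta> *\<^sub>R z \<bullet> b \<le> x \<bullet> b" "x \<bullet> b \<le> \<delta> *\<^sub>R (z + One) \<bullet> b"
      using b assms by (simp_all add: z inner_add_left field_simps flip: k_def)
  qed
  moreover have "cbox (\<delta> *\<^sub>R z) (\<delta> *\<^sub>R (z + One)) \<in> mesh_cubes \<delta>"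
    unfolding mesh_cubes_def using z by auto
  ultimately show ?thesis using that by blast
qed

lemma mesh_cube_dist:
  fixes x :: "'a::euclidean_space"
  assumes "Q \<in> mesh_cubes \<delta>" "x \<in> Q" "y \<in> Q"
  shows "dist x y \<le> real DIM('a) * \<delta>"
proof -
  obtain z where Q: "Q = cbox (\<delta> *\<^sub>R z) (\<delta> *\<^sub>R (z + One))" using assms by (auto simp: mesh_cubes_def)
  have "dist x y \<le> (\<Sum>b\<in>Basis. \<bar>(x - y) \<bullet> b\<bar>)" unfolding dist_norm by (rule norm_le_l1)
  also have "\<dots> \<le> (\<Sum>b\<in>(Basis::'a set). \<delta>)"
  proof (rule sum_mono)
    fix b :: 'a assume b: "b \<in> Basis"
    then have "\<delta> * (z \<bullet> b) \<le> x \<bullet> b" "x \<bullet> b \<le> \<delta> * (z \<bullet> b) + \<delta>"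
        "\<delta> * (z \<bullet> b) \<le> y \<bullet> b" "y \<bullet> b \<le> \<delta> * (z \<bullet> b) + \<delta>"
      using assms(2,3) by (auto simp: Q mem_box inner_add_left algebra_simps)
    then show "\<bar>(x - y) \<bullet> b\<bar> \<le> \<delta>" by (auto simp: inner_diff_left)
  qed
  finally show ?thesis by simp
qed

lemma mesh_cube_closed: "Q \<in> mesh_cubes \<delta> \<Longrightarrow> closed Q"
  by (auto simp: mesh_cubes_def)

text \<open>A cube is determined by its integer corner. If it meets X, each coordinate of the corner
  lies within \<open>R + 1\<close> of that of the rounded point \<open>x0 / \<delta>\<close>: R for
  the distance of two points of X, 1 for the rounding. This leaves \<open>2 * R + 3\<close> integers
  per coordinate.\<close>

lemma mesh_meeting_card:
  fixes X :: "'a::euclidean_space set"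
  assumes \<delta>: "\<delta> > 0" and X: "\<And>x y. x \<in> X \<Longrightarrow> y \<in> X \<Longrightarrow> dist x y \<le> r * \<delta>"
  shows "finite (mesh_meeting \<delta> X)" "card (mesh_meeting \<delta> X) \<le> (2 * nat \<lceil>r\<rceil> + 3) ^ DIM('a)"
proof -
  have "finite (mesh_meeting \<delta> X) \<and> card (mesh_meeting \<delta> X) \<le> (2 * nat \<lceil>r\<rceil> + 3) ^ DIM('a)"
  proof (cases "X = {}")
    case True
    then show ?thesis by (simp add: mesh_meeting_def)
  next
    case False
    then obtain x0 where x0: "x0 \<in> X" by auto
    define R where "R = int (nat \<lceil>r\<rceil>)"
    define A where "A b = {\<lfloor>x0 \<bullet> b / \<delta>\<rfloor> - R - 1 .. \<lfloor>x0 \<bullet> b / \<delta>\<rfloor> + R + 1}" for b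
    define c where "c k = (let z = (\<Sum>b\<in>(Basis::'a set). real_of_int (k b) *\<^sub>R b)
      in cbox (\<delta> *\<^sub>R z) (\<delta> *\<^sub>R (z + One)))" for k
    have "mesh_meeting \<delta> X \<subseteq> c ` (PiE Basis A)"
    proof
      fix Q assume "Q \<in> mesh_meeting \<delta> X"
      then obtain z x where Q: "Q = cbox (\<delta> *\<^sub>R z) (\<delta> *\<^sub>R (z + One))" and z: "\<forall>b\<in>Basis. z \<bullet> b \<in> \<int>"
        and x: "x \<in> Q" "x \<in> X" by (auto simp: mesh_meeting_def mesh_cubes_def)
      define k where "k = (\<lambda>b\<in>Basis. \<lfloor>z \<bullet> b\<rfloor>)"
      have kz: "real_of_int (k b) = z \<bullet> b" if "b \<in> Basis" for b
        using that z by (simp add: k_def)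
      have "z = (\<Sum>b\<in>Basis. real_of_int (k b) *\<^sub>R b)"
        by (subst euclidean_representation[of z, symmetric]) (auto intro!: sum.cong simp: kz)
      then have "Q = c k" by (simp add: c_def Q Let_def)
      moreover have "k b \<in> A b" if b: "b \<in> Basis" for b
      proof -
        have "\<bar>(x - x0) \<bullet> b\<bar> \<le> r * \<delta>"
          using Basis_le_norm[OF b, of "x - x0"] X[OF x(2) x0] by (simp add: dist_norm)
        then have "\<bar>x \<bullet> b - x0 \<bullet> b\<bar> / \<delta> \<le> r" using \<delta> by (simp add: field_simps inner_diff_left)
        then have 1: "\<bar>x \<bullet> b / \<delta> - x0 \<bullet> b / \<delta>\<bar> \<le> r" using \<delta> by (simp flip: diff_divide_distrib)
        have "\<delta> * (z \<bullet> b) \<le> x \<bullet> b" "x \<bullet> b \<le> \<delta> * (z \<bullet> b) + \<delta>"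
          using x(1) b by (auto simp: Q mem_box inner_add_left algebra_simps)
        then have 2: "k b \<le> x \<bullet> b / \<delta>" "x \<bullet> b / \<delta> \<le> k b + 1" using \<delta> by (auto simp: kz[OF b] field_simps)
        have "r \<le> real_of_int R" unfolding R_def by linarith
        then show ?thesis unfolding A_def using 1 2 by simp linarith
      qed
      then have "k \<in> PiE Basis A" by (auto simp: k_def)
      ultimately show "Q \<in> c ` (PiE Basis A)" by blast
    qed
    moreover have fin: "finite (PiE Basis A)" by (intro finite_PiE) (auto simp: A_def)
    moreover have "card (PiE Basis A) = (2 * nat \<lceil>r\<rceil> + 3) ^ DIM('a)"
    proof -
      have "card (A b) = 2 * nat \<lceil>r\<rceil> + 3" for b unfolding A_def R_def card_atLeastAtMost_int by linarith
      then show ?thesis by (simp add: card_PiE)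
    qed
    ultimately show ?thesis
      by (metis card_image_le card_mono finite_imageI finite_subset le_trans)
  qed
  then show "finite (mesh_meeting \<delta> X)" "card (mesh_meeting \<delta> X) \<le> (2 * nat \<lceil>r\<rceil> + 3) ^ DIM('a)" by auto
qed

lemma finite_mesh_meeting:
  fixes X :: "'a::euclidean_space set"
  assumes "\<delta> > 0" "bounded X"
  shows "finite (mesh_meeting \<delta> X)"
proof (rule mesh_meeting_card(1))
  show "dist x y \<le> (diameter X / \<delta>) * \<delta>" if "x \<in> X" "y \<in> X" for x y
    using diameter_bounded_bound[OF assms(2) that] assms(1) by simp
qed (use assms in auto)

text \<open>The moment sum of the image under \<open>h\<close> of \<mu> restricted to
  \<open>X\<close>, formed without a push-forward because word maps are controlled only on the
  square. Null cubes may occur in the sum; they contribute 0, also for q = 0, since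
  \<open>0 powr 0 = 0\<close>.\<close>

definition pullback_sum ::
    "'x measure \<Rightarrow> 'x set \<Rightarrow> real \<Rightarrow> ('x \<Rightarrow> 'a::euclidean_space) \<Rightarrow> real \<Rightarrow> real" where
  "pullback_sum \<mu> X q h \<delta> = (\<Sum>Q\<in>mesh_meeting \<delta> (h ` X). measure \<mu> {x\<in>X. h x \<in> Q} powr q)"

lemma pullback_sum_nonneg: "0 \<le> pullback_sum \<mu> X q h \<delta>"
  unfolding pullback_sum_def by (intro sum_nonneg) auto

lemma pullback_sum_superset:
  assumes "finite \<Q>" "mesh_meeting \<delta> (h ` X) \<subseteq> \<Q>" "\<Q> \<subseteq> mesh_cubes \<delta>"
  shows "pullback_sum \<mu> X q h \<delta> = (\<Sum>Q\<in>\<Q>. measure \<mu> {x\<in>X. h x \<in> Q} powr q)"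
  unfolding pullback_sum_def
proof (rule sum.mono_neutral_left)
  show "\<forall>Q\<in>\<Q> - mesh_meeting \<delta> (h ` X). measure \<mu> {x\<in>X. h x \<in> Q} powr q = 0"
  proof
    fix Q assume "Q \<in> \<Q> - mesh_meeting \<delta> (h ` X)"
    then have "{x\<in>X. h x \<in> Q} = {}" using assms by (auto simp: mesh_meeting_def)
    then show "measure \<mu> {x\<in>X. h x \<in> Q} powr q = 0" by (simp only: measure_empty) simp
  qed
qed (use assms in auto)

lemma continuous_preimage_in_borel:
  fixes h :: "'a::topological_space \<Rightarrow> 'b::topological_space"
  assumes "continuous_on X h" "X \<in> sets borel" "A \<in> sets borel"
  shows "{x\<in>X. h x \<in> A} \<in> sets borel"
proof -
  have "h \<in> borel_measurable (restrict_space borel X)"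
    using assms(1) by (rule borel_measurable_continuous_on_restrict)
  then have "h -` A \<inter> space (restrict_space borel X) \<in> sets (restrict_space borel X)"
    using assms(3) by (rule measurable_sets)
  then have "h -` A \<inter> X \<in> sets borel"
    using assms(2) by (subst (asm) sets_restrict_space_iff) (auto simp: space_restrict_space)
  moreover have "{x\<in>X. h x \<in> A} = h -` A \<inter> X" by auto
  ultimately show ?thesis by simp
qed

lemma closed_preimage_in_sets:
  fixes X :: "'x::t2_space set"
  assumes "sets \<mu> = sets borel" "compact X" "continuous_on X h" "closed Q"
  shows "{x\<in>X. h x \<in> Q} \<in> sets \<mu>"
  using continuous_preimage_in_borel[OF assms(3), of Q] assms(1,2,4)
  by (simp add: borel_compact borel_closed)

text \<open>The two estimates say that \<open>h\<close> and \<open>h'\<close>, measured in units of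
  their mesh sizes, are coarsely equivalent; the summand 1 lets distances below the mesh size be
  ignored. Hence a cube of either mesh shares points with boundedly many cubes of the other. The
  target spaces may differ in dimension, as for a thin strip and its projection.\<close>

lemma pullback_sum_compare:
  fixes h :: "'x::metric_space \<Rightarrow> 'a::euclidean_space" and h' :: "'x \<Rightarrow> 'b::euclidean_space"
  assumes \<mu>: "finite_measure \<mu>" "sets \<mu> = sets borel" and X: "compact X"
    and cont: "continuous_on X h" "continuous_on X h'"
    and pos: "\<delta> > 0" "\<rho> > 0" "0 \<le> q" "0 \<le> L"
    and le: "\<And>x y. x \<in> X \<Longrightarrow> y \<in> X \<Longrightarrow> dist (h x) (h y) \<le> L * \<delta> * (dist (h' x) (h' y) / \<rho> + 1)"
    and le': "\<And>x y. x \<in> X \<Longrightarrow> y \<in> X \<Longrightarrow> dist (h' x) (h' y) \<le> L * \<rho> * (dist (h x) (h y) / \<delta> + 1)"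
  shows "pullback_sum \<mu> X q h \<delta>
    \<le> real ((2 * nat \<lceil>L * (DIM('a) + 1)\<rceil> + 3) ^ DIM('b)) powr q *
      real ((2 * nat \<lceil>L * (DIM('b) + 1)\<rceil> + 3) ^ DIM('a)) * pullback_sum \<mu> X q h' \<rho>"
proof -
  interpret finite_measure \<mu> by (rule \<mu>)
  define R where "R Q Q' \<longleftrightarrow> (\<exists>x\<in>X. h x \<in> Q \<and> h' x \<in> Q')" for Q Q'
  let ?A = "mesh_meeting \<delta> (h ` X)" and ?B = "mesh_meeting \<rho> (h' ` X)"
  have fin: "finite ?A" "finite ?B"
    using cont X pos by (auto intro!: finite_mesh_meeting compact_imp_bounded compact_continuous_image)
  have "(\<Sum>Q\<in>?A. measure \<mu> {x\<in>X. h x \<in> Q} powr q)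
    \<le> real ((2 * nat \<lceil>L * (DIM('a) + 1)\<rceil> + 3) ^ DIM('b)) powr q *
     (real ((2 * nat \<lceil>L * (DIM('b) + 1)\<rceil> + 3) ^ DIM('a)) * (\<Sum>Q'\<in>?B. measure \<mu> {x\<in>X. h' x \<in> Q'} powr q))"
  proof (rule sum_powr_compare[OF fin, where R = R])
    fix Q assume Q: "Q \<in> ?A"
    then have Qm: "Q \<in> mesh_cubes \<delta>" by (simp add: mesh_meeting_def)
    have "{Q'\<in>?B. R Q Q'} \<subseteq> mesh_meeting \<rho> (h' ` {x\<in>X. h x \<in> Q})"
      by (auto simp: mesh_meeting_def R_def)
    moreover have d: "dist y y' \<le> (L * (DIM('a) + 1)) * \<rho>"
      if "y \<in> h' ` {x\<in>X. h x \<in> Q}" "y' \<in> h' ` {x\<in>X. h x \<in> Q}" for y y'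
    proof -
      obtain x x' where x: "x \<in> X" "x' \<in> X" "h x \<in> Q" "h x' \<in> Q" "y = h' x" "y' = h' x'"
        using \<open>y \<in> _\<close> \<open>y' \<in> _\<close> by auto
      have "dist y y' \<le> L * \<rho> * (dist (h x) (h x') / \<delta> + 1)" using le' x by auto
      also have "\<dots> \<le> L * \<rho> * (DIM('a) + 1)"
        using mesh_cube_dist[OF Qm x(3,4)] pos by (intro mult_left_mono) (auto simp: field_simps)
      finally show ?thesis by (simp add: algebra_simps)
    qed
    ultimately have "card {Q'\<in>?B. R Q Q'} \<le> card (mesh_meeting \<rho> (h' ` {x\<in>X. h x \<in> Q}))"
      using mesh_meeting_card(1)[OF pos(2) d] by (intro card_mono) auto
    also have "\<dots> \<le> (2 * nat \<lceil>L * (DIM('a) + 1)\<rceil> + 3) ^ DIM('b)"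
      by (rule mesh_meeting_card(2)[OF pos(2) d])
    finally show "card {Q'\<in>?B. R Q Q'} \<le> (2 * nat \<lceil>L * (DIM('a) + 1)\<rceil> + 3) ^ DIM('b)" .
    have "measure \<mu> {x\<in>X. h x \<in> Q} \<le> measure \<mu> (\<Union>Q'\<in>{Q'\<in>?B. R Q Q'}. {x\<in>X. h' x \<in> Q'})"
    proof (rule finite_measure_mono)
      show "{x\<in>X. h x \<in> Q} \<subseteq> (\<Union>Q'\<in>{Q'\<in>?B. R Q Q'}. {x\<in>X. h' x \<in> Q'})"
      proof
        fix x assume x: "x \<in> {x\<in>X. h x \<in> Q}"
        obtain Q' where "Q' \<in> mesh_cubes \<rho>" "h' x \<in> Q'" using mesh_cubes_cover pos by blast
        then show "x \<in> (\<Union>Q'\<in>{Q'\<in>?B. R Q Q'}. {x\<in>X. h' x \<in> Q'})"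
          using x by (auto simp: mesh_meeting_def R_def)
      qed
      show "(\<Union>Q'\<in>{Q'\<in>?B. R Q Q'}. {x\<in>X. h' x \<in> Q'}) \<in> sets \<mu>"
        using finite_subset[OF _ fin(2), of "{Q'\<in>?B. R Q Q'}"] \<mu> X cont
        by (intro sets.finite_UN) (auto simp: mesh_meeting_def intro!: closed_preimage_in_sets mesh_cube_closed)
    qed
    also have "\<dots> \<le> (\<Sum>Q'\<in>{Q'\<in>?B. R Q Q'}. measure \<mu> {x\<in>X. h' x \<in> Q'})"
      using finite_subset[OF _ fin(2), of "{Q'\<in>?B. R Q Q'}"] \<mu> X cont
      by (intro finite_measure_subadditive_finite)
        (auto simp: mesh_meeting_def intro!: closed_preimage_in_sets mesh_cube_closed)
    finally show "measure \<mu> {x\<in>X. h x \<in> Q} \<le> (\<Sum>Q'\<in>{Q'\<in>?B. R Q Q'}. measure \<mu> {x\<in>X. h' x \<in> Q'})" .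
  next
    fix Q assume Q: "Q \<in> ?B"
    then have Qm: "Q \<in> mesh_cubes \<rho>" by (simp add: mesh_meeting_def)
    have "{Q'\<in>?A. R Q' Q} \<subseteq> mesh_meeting \<delta> (h ` {x\<in>X. h' x \<in> Q})"
      by (auto simp: mesh_meeting_def R_def)
    moreover have d: "dist y y' \<le> (L * (DIM('b) + 1)) * \<delta>"
      if "y \<in> h ` {x\<in>X. h' x \<in> Q}" "y' \<in> h ` {x\<in>X. h' x \<in> Q}" for y y'
    proof -
      obtain x x' where x: "x \<in> X" "x' \<in> X" "h' x \<in> Q" "h' x' \<in> Q" "y = h x" "y' = h x'"
        using \<open>y \<in> _\<close> \<open>y' \<in> _\<close> by auto
      have "dist y y' \<le> L * \<delta> * (dist (h' x) (h' x') / \<rho> + 1)" using le x by auto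
      also have "\<dots> \<le> L * \<delta> * (DIM('b) + 1)"
        using mesh_cube_dist[OF Qm x(3,4)] pos by (intro mult_left_mono) (auto simp: field_simps)
      finally show ?thesis by (simp add: algebra_simps)
    qed
    ultimately have "card {Q'\<in>?A. R Q' Q} \<le> card (mesh_meeting \<delta> (h ` {x\<in>X. h' x \<in> Q}))"
      using mesh_meeting_card(1)[OF pos(1) d] by (intro card_mono) auto
    also have "\<dots> \<le> (2 * nat \<lceil>L * (DIM('b) + 1)\<rceil> + 3) ^ DIM('a)"
      by (rule mesh_meeting_card(2)[OF pos(1) d])
    finally show "card {Q'\<in>?A. R Q' Q} \<le> (2 * nat \<lceil>L * (DIM('b) + 1)\<rceil> + 3) ^ DIM('a)" .
  qed (use pos in auto)
  then show ?thesis by (simp add: pullback_sum_def mult.assoc)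
qed

lemma lq_sum_distr_eq_pullback_sum:
  fixes h :: "'x::metric_space \<Rightarrow> 'a::euclidean_space"
  assumes \<mu>: "prob_space \<mu>" "sets \<mu> = sets borel" and X: "compact X" "measure \<mu> X = 1"
    and h: "h \<in> borel_measurable borel" "continuous_on X h" and \<delta>: "\<delta> > 0"
  shows "lq_sum (distr \<mu> borel h) q \<delta> = pullback_sum \<mu> X q h \<delta>"
proof -
  interpret prob_space \<mu> by (rule \<mu>)
  have hm: "h \<in> measurable \<mu> borel" using h \<mu>(2) by (simp cong: measurable_cong_sets)
  have space: "space \<mu> = UNIV" using sets_eq_imp_space_eq[OF \<mu>(2)] by simp
  have Xs: "X \<in> sets \<mu>" using X \<mu>(2) by (auto intro: borel_compact)
  have m: "measure (distr \<mu> borel h) Q = measure \<mu> {x\<in>X. h x \<in> Q}" if "Q \<in> mesh_cubes \<delta>" for Q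
  proof -
    have Q: "Q \<in> sets borel" using mesh_cube_closed[OF that] by auto
    have "measure (distr \<mu> borel h) Q = measure \<mu> (h -` Q)"
      using hm Q by (simp add: measure_distr space)
    also have "\<dots> = measure \<mu> {x\<in>X. h x \<in> Q}"
      using AE_prob_1[OF X(2)] measurable_sets[OF hm Q] space
        closed_preimage_in_sets[OF \<mu>(2) X(1) h(2) mesh_cube_closed[OF that]]
      by (intro measure_eq_AE) auto
    finally show ?thesis .
  qed
  show ?thesis unfolding lq_sum_def pullback_sum_def
  proof (rule sum.mono_neutral_cong_left)
    show "finite (mesh_meeting \<delta> (h ` X))"
      using h X \<delta> by (intro finite_mesh_meeting compact_imp_bounded compact_continuous_image)
    show "{Q \<in> mesh_cubes \<delta>. 0 < measure (distr \<mu> borel h) Q} \<subseteq> mesh_meeting \<delta> (h ` X)"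
    proof
      fix Q assume Q: "Q \<in> {Q \<in> mesh_cubes \<delta>. 0 < measure (distr \<mu> borel h) Q}"
      then have "measure \<mu> {x\<in>X. h x \<in> Q} > 0" using m by auto
      then have "{x\<in>X. h x \<in> Q} \<noteq> {}" by force
      then show "Q \<in> mesh_meeting \<delta> (h ` X)" using Q by (auto simp: mesh_meeting_def)
    qed
    show "\<forall>Q\<in>mesh_meeting \<delta> (h ` X) - {Q \<in> mesh_cubes \<delta>. 0 < measure (distr \<mu> borel h) Q}.
        measure \<mu> {x\<in>X. h x \<in> Q} powr q = 0"
    proof
      fix Q assume "Q \<in> mesh_meeting \<delta> (h ` X) - {Q \<in> mesh_cubes \<delta>. 0 < measure (distr \<mu> borel h) Q}"
      then have "\<not> 0 < measure \<mu> {x\<in>X. h x \<in> Q}" using m by (auto simp: mesh_meeting_def)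
      then have "measure \<mu> {x\<in>X. h x \<in> Q} = 0" using measure_nonneg[of \<mu> "{x\<in>X. h x \<in> Q}"] by linarith
      then show "measure \<mu> {x\<in>X. h x \<in> Q} powr q = 0" by simp
    qed
  qed (use m in auto)
qed

section \<open>Words, stopping words and quasi-multiplicative functions\<close>

lemma word_map_simps [simp]:
  "word_map S [] = id" "word_map S (i # w) = S i \<circ> word_map S w"
  by (auto simp: word_map_def)

lemma word_map_append: "word_map S (u @ v) = word_map S u \<circ> word_map S v"
  by (induction u) auto

lemma word_weight_append: "word_weight p (u @ v) = word_weight p u * word_weight p v"
  by (simp add: word_weight_def)

lemma word_weight_pos:
  assumes "\<And>i. i \<in> I \<Longrightarrow> 0 < p i" "set w \<subseteq> I"
  shows "0 < word_weight p w"
  using assms(2) by (induction w) (auto simp: word_weight_def assms(1))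

lemma words_0 [simp]: "words I 0 = {[]}"
  by (auto simp: words_def)

lemma finite_words: "finite I \<Longrightarrow> finite (words I n)"
  using finite_lists_length_eq[of I n] by (simp add: words_def conj_commute)

lemma words_nonempty:
  assumes "i \<in> I" shows "words I n \<noteq> {}"
proof -
  have "replicate n i \<in> words I n" using assms by (auto simp: words_def)
  then show ?thesis by blast
qed

lemma sum_words_add:
  "(\<Sum>w\<in>words I (m + n). h w) = (\<Sum>u\<in>words I m. \<Sum>v\<in>words I n. h (u @ v))"
proof -
  have eq: "words I (m + n) = (\<lambda>(u, v). u @ v) ` (words I m \<times> words I n)"
  proof (intro equalityI subsetI)
    fix w assume "w \<in> words I (m + n)"
    then have "(take m w, drop m w) \<in> words I m \<times> words I n" "w = take m w @ drop m w"
      by (auto simp: words_def dest: in_set_takeD in_set_dropD)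
    then show "w \<in> (\<lambda>(u, v). u @ v) ` (words I m \<times> words I n)" by (metis case_prod_conv image_eqI)
  qed (auto simp: words_def)
  have inj: "inj_on (\<lambda>(u, v). u @ v) (words I m \<times> words I n)"
    by (auto simp: inj_on_def words_def)
  show ?thesis unfolding eq by (subst sum.reindex[OF inj]) (simp add: sum.cartesian_product case_prod_unfold)
qed

lemma words_1: "words I 1 = (\<lambda>i. [i]) ` I"
  by (auto simp: words_def length_Suc_conv)

lemma sum_words_1: "(\<Sum>w\<in>words I 1. h w) = (\<Sum>i\<in>I. h [i])"
  unfolding words_1 by (subst sum.reindex) (auto simp: inj_on_def)

text \<open>The size of a word need not decrease along its prefixes, so the first prefix at which
  \<open>H\<close> drops to \<delta> is singled out by a condition on all proper prefixes. The empty
  word is allowed and stops at once if \<open>H [] \<le> \<delta>\<close>.\<close>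

definition stopping_words :: "'i set \<Rightarrow> ('i list \<Rightarrow> real) \<Rightarrow> real \<Rightarrow> 'i list set" where
  "stopping_words I H \<delta> = {w. set w \<subseteq> I \<and> H w \<le> \<delta> \<and> (\<forall>k<length w. \<delta> < H (take k w))}"

lemma stopping_words_length_le:
  assumes "\<And>w. w \<in> words I N \<Longrightarrow> H w \<le> \<delta>" "w \<in> stopping_words I H \<delta>"
  shows "length w \<le> N"
proof (rule ccontr)
  assume "\<not> length w \<le> N"
  then have "take N w \<in> words I N" "\<delta> < H (take N w)"
    using assms(2) by (auto simp: words_def stopping_words_def dest: in_set_takeD)
  then show False using assms(1) by force
qed

lemma finite_stopping_words:
  assumes "finite I" "\<And>w. w \<in> words I N \<Longrightarrow> H w \<le> \<delta>"
  shows "finite (stopping_words I H \<delta>)"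
proof (rule finite_subset)
  show "stopping_words I H \<delta> \<subseteq> (\<Union>n\<in>{..N}. words I n)"
  proof
    fix w assume w: "w \<in> stopping_words I H \<delta>"
    have "length w \<le> N" using stopping_words_length_le[of I N H \<delta> w] assms(2) w by blast
    then show "w \<in> (\<Union>n\<in>{..N}. words I n)" using w by (auto simp: words_def stopping_words_def)
  qed
qed (use assms finite_words in auto)

lemma stopping_words_prefix:
  assumes "w \<in> stopping_words I H \<delta>" "w' \<in> stopping_words I H \<delta>" "w @ v = w' @ v'"
  shows "w = w'"
proof -
  have *: "w = w'" if "w \<in> stopping_words I H \<delta>" "w' \<in> stopping_words I H \<delta>" "w @ v = w' @ v'"
    "length w \<le> length w'" for w w' v v'
  proof -
    have "take (length w) (w @ v) = take (length w) (w' @ v')" by (simp only: that(3))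
    then have w: "take (length w) w' = w" using that(4) by simp
    have "\<not> length w < length w'"
    proof
      assume "length w < length w'"
      then have "\<delta> < H (take (length w) w')" using that(2) by (auto simp: stopping_words_def)
      then show False using that(1) unfolding w by (simp add: stopping_words_def)
    qed
    then have "length w' = length w" using that(4) by linarith
    then have "take (length w) w' = w'" by (metis take_all order_refl)
    then show ?thesis using w by metis
  qed
  show ?thesis using *[OF assms] *[OF assms(2,1) assms(3)[symmetric]] nat_le_linear by blast
qed

text \<open>Every word of length N has exactly one prefix in the stopping set: existence by
  minimality of the stopping time, uniqueness because no stopping word is a proper prefix of
  another.\<close>

lemma sum_words_stopping:
  assumes fin: "finite I" and N: "\<And>w. w \<in> words I N \<Longrightarrow> H w \<le> \<delta>"
  shows "(\<Sum>u\<in>words I N. h u) =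
    (\<Sum>w\<in>stopping_words I H \<delta>. \<Sum>v\<in>words I (N - length w). h (w @ v))"
proof -
  let ?W = "stopping_words I H \<delta>"
  have eq: "words I N = (\<Union>w\<in>?W. (\<lambda>v. w @ v) ` words I (N - length w))"
  proof (intro equalityI subsetI)
    fix u assume u: "u \<in> words I N"
    define n where "n = (LEAST n. H (take n u) \<le> \<delta>)"
    have ex: "H (take N u) \<le> \<delta>" using N[OF u] u by (simp add: words_def)
    have n: "H (take n u) \<le> \<delta>" "n \<le> N" unfolding n_def
      using LeastI[of "\<lambda>n. H (take n u) \<le> \<delta>", OF ex] Least_le[of "\<lambda>n. H (take n u) \<le> \<delta>", OF ex] by auto
    have "\<delta> < H (take k u)" if "k < n" for k using not_less_Least[of k "\<lambda>n. H (take n u) \<le> \<delta>"] that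
      by (auto simp: n_def)
    then have "take n u \<in> ?W" using n u by (auto simp: stopping_words_def words_def dest: in_set_takeD)
    moreover have "drop n u \<in> words I (N - length (take n u))"
      using u n by (auto simp: words_def dest: in_set_dropD)
    ultimately show "u \<in> (\<Union>w\<in>?W. (\<lambda>v. w @ v) ` words I (N - length w))"
      by (intro UN_I[of "take n u"] image_eqI[of _ _ "drop n u"]) auto
  next
    fix u assume "u \<in> (\<Union>w\<in>?W. (\<lambda>v. w @ v) ` words I (N - length w))"
    then obtain w v where wv: "w \<in> ?W" "v \<in> words I (N - length w)" "u = w @ v" by auto
    then show "u \<in> words I N"
      using stopping_words_length_le[OF N wv(1)] by (auto simp: words_def stopping_words_def)
  qed
  have "(\<Sum>u\<in>words I N. h u) = (\<Sum>w\<in>?W. \<Sum>u\<in>(\<lambda>v. w @ v) ` words I (N - length w). h u)"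
  proof (subst eq, rule sum.UNION_disjoint)
    show "finite ?W" using finite_stopping_words[OF fin N] .
    show "\<forall>w\<in>?W. finite ((\<lambda>v. w @ v) ` words I (N - length w))" using fin by (auto intro: finite_words)
    show "\<forall>w\<in>?W. \<forall>w'\<in>?W. w \<noteq> w' \<longrightarrow>
      (\<lambda>v. w @ v) ` words I (N - length w) \<inter> (\<lambda>v. w' @ v) ` words I (N - length w') = {}"
    proof (intro ballI impI)
      fix w w' assume "w \<in> ?W" "w' \<in> ?W" "w \<noteq> w'"
      then show "(\<lambda>v. w @ v) ` words I (N - length w) \<inter> (\<lambda>v. w' @ v) ` words I (N - length w') = {}"
        using stopping_words_prefix[of w I H \<delta> w'] by blast
    qed
  qed
  also have "\<dots> = (\<Sum>w\<in>?W. \<Sum>v\<in>words I (N - length w). h (w @ v))"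
    by (rule sum.cong[OF refl], subst sum.reindex) (auto simp: inj_on_def)
  finally show ?thesis .
qed

text \<open>Bounded distortion of a derivative in the form used for counting. The value at the empty
  word is not normalised to 1.\<close>

definition quasi_multiplicative :: "'i set \<Rightarrow> real \<Rightarrow> ('i list \<Rightarrow> real) \<Rightarrow> bool" where
  "quasi_multiplicative I K H \<longleftrightarrow> 1 \<le> K \<and> (\<forall>w. set w \<subseteq> I \<longrightarrow> 0 < H w) \<and>
    (\<forall>u v. set u \<subseteq> I \<longrightarrow> set v \<subseteq> I \<longrightarrow> H (u @ v) \<le> K * H u * H v \<and> H u * H v \<le> K * H (u @ v))"

lemma quasi_multiplicativeD:
  assumes "quasi_multiplicative I K H"
  shows "1 \<le> K" "set w \<subseteq> I \<Longrightarrow> 0 < H w"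
    "set u \<subseteq> I \<Longrightarrow> set v \<subseteq> I \<Longrightarrow> H (u @ v) \<le> K * H u * H v"
    "set u \<subseteq> I \<Longrightarrow> set v \<subseteq> I \<Longrightarrow> H u * H v \<le> K * H (u @ v)"
  using assms by (auto simp: quasi_multiplicative_def)

lemma quasi_multiplicative_Nil:
  assumes "quasi_multiplicative I K H"
  shows "1 / K \<le> H []" "H [] \<le> K"
proof -
  note q = quasi_multiplicativeD[OF assms]
  have "0 < H []" "H [] \<le> K * H [] * H []" "H [] * H [] \<le> K * H []"
    using q(2)[of "[]"] q(3,4)[of "[]" "[]"] by auto
  then show "1 / K \<le> H []" "H [] \<le> K" using q(1) by (auto simp: field_simps)
qed

lemma quasi_multiplicative_mono:
  assumes "quasi_multiplicative I K H" "K \<le> K'"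
  shows "quasi_multiplicative I K' H"
  unfolding quasi_multiplicative_def
proof (intro conjI allI impI)
  note h = quasi_multiplicativeD[OF assms(1)]
  show "1 \<le> K'" using h(1) assms(2) by linarith
  show "0 < H w" if "set w \<subseteq> I" for w using h(2)[OF that] .
  fix u v assume uv: "set u \<subseteq> I" "set v \<subseteq> I"
  have pos: "0 < H u" "0 < H v" "0 < H (u @ v)" using h(2) uv by auto
  have "K * H u * H v \<le> K' * H u * H v" "K * H (u @ v) \<le> K' * H (u @ v)"
    using pos assms(2) by (auto intro!: mult_right_mono)
  then show "H (u @ v) \<le> K' * H u * H v" "H u * H v \<le> K' * H (u @ v)"
    using h(3,4)[OF uv] by linarith+
qed

lemma quasi_multiplicative_mult:
  assumes "quasi_multiplicative I K H" "quasi_multiplicative I K' H'"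
  shows "quasi_multiplicative I (K * K') (\<lambda>w. H w * H' w)"
proof -
  note h = quasi_multiplicativeD[OF assms(1)] and h' = quasi_multiplicativeD[OF assms(2)]
  have "1 * 1 \<le> K * K'" using h(1) h'(1) by (intro mult_mono) auto
  moreover have "H (u @ v) * H' (u @ v) \<le> (K * K') * (H u * H' u) * (H v * H' v)"
    "(H u * H' u) * (H v * H' v) \<le> (K * K') * (H (u @ v) * H' (u @ v))"
    if "set u \<subseteq> I" "set v \<subseteq> I" for u v
  proof -
    have pos: "0 < H u" "0 < H v" "0 < H' u" "0 < H' v" "0 < H (u @ v)" "0 < H' (u @ v)"
      using that h(2) h'(2) by auto
    have "H (u @ v) * H' (u @ v) \<le> (K * H u * H v) * (K' * H' u * H' v)"
      using h(1,3) h'(1,3) that pos by (intro mult_mono mult_nonneg_nonneg) (auto simp: less_imp_le)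
    then show "H (u @ v) * H' (u @ v) \<le> (K * K') * (H u * H' u) * (H v * H' v)" by (simp add: ac_simps)
    have "(H u * H v) * (H' u * H' v) \<le> (K * H (u @ v)) * (K' * H' (u @ v))"
      using h(1) h(4)[OF that] h'(4)[OF that] pos by (intro mult_mono[of "H u * H v"]) (auto simp: less_imp_le)
    then show "(H u * H' u) * (H v * H' v) \<le> (K * K') * (H (u @ v) * H' (u @ v))" by (simp add: ac_simps)
  qed
  ultimately show ?thesis using h(2) h'(2) by (auto simp: quasi_multiplicative_def)
qed

text \<open>On the logarithmic scale the assumption reads
  \<open>\<bar>ln x - ln y\<bar> \<le> ln K\<close>, which is symmetric, so negative exponents are
  covered with \<open>\<bar>t\<bar>\<close> in the constant.\<close>

lemma powr_between:
  fixes x y K t :: real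
  assumes "0 < x" "0 < y" "1 \<le> K" "x \<le> K * y" "y \<le> K * x"
  shows "x powr t \<le> K powr \<bar>t\<bar> * y powr t"
proof -
  have "\<bar>ln x - ln y\<bar> \<le> ln K"
  proof -
    have "ln x \<le> ln (K * y)" "ln y \<le> ln (K * x)" using assms by auto
    then show ?thesis using assms by (simp add: ln_mult)
  qed
  then have "t * (ln x - ln y) \<le> \<bar>t\<bar> * ln K"
    by (metis abs_ge_self abs_ge_zero abs_mult mult_left_mono order_trans)
  then have "exp (t * ln x) \<le> exp (\<bar>t\<bar> * ln K + t * ln y)" by (simp add: algebra_simps)
  then show ?thesis using assms by (simp add: powr_def exp_add)
qed

lemma quasi_multiplicative_powr:
  assumes "quasi_multiplicative I K H"
  shows "quasi_multiplicative I (K powr \<bar>t\<bar>) (\<lambda>w. H w powr t)"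
proof -
  note h = quasi_multiplicativeD[OF assms]
  have "H (u @ v) powr t \<le> K powr \<bar>t\<bar> * H u powr t * H v powr t"
    "H u powr t * H v powr t \<le> K powr \<bar>t\<bar> * H (u @ v) powr t"
    if "set u \<subseteq> I" "set v \<subseteq> I" for u v
  proof -
    have pos: "0 < H u" "0 < H v" "0 < H (u @ v)" using that h(2) by auto
    show "H (u @ v) powr t \<le> K powr \<bar>t\<bar> * H u powr t * H v powr t"
      using powr_between[of "H (u @ v)" "H u * H v" K t] h that pos by (auto simp: powr_mult mult.assoc)
    show "H u powr t * H v powr t \<le> K powr \<bar>t\<bar> * H (u @ v) powr t"
      using powr_between[of "H u * H v" "H (u @ v)" K t] h that pos by (auto simp: powr_mult mult.assoc)
  qed
  moreover have "1 \<le> K powr \<bar>t\<bar>" using h(1) by (intro ge_one_powr_ge_zero) auto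
  ultimately show ?thesis using h(2) by (force simp: quasi_multiplicative_def)
qed

lemma quasi_multiplicative_weight:
  assumes "\<And>i. i \<in> I \<Longrightarrow> 0 < p i"
  shows "quasi_multiplicative I 1 (word_weight p)"
  unfolding quasi_multiplicative_def using word_weight_pos[of I p, OF assms] by (auto simp: word_weight_append)

text \<open>Splitting words of length \<open>m + n\<close> shows that the logarithm of the sum is
  almost additive. The sum is therefore known up to the factor K, not only up to its exponential
  rate.\<close>

lemma quasi_multiplicative_sum_words:
  assumes q: "quasi_multiplicative I K H" and I: "finite I" "I \<noteq> {}"
  shows "\<exists>L. \<forall>n. exp (real n * L) / K \<le> (\<Sum>w\<in>words I n. H w) \<and> (\<Sum>w\<in>words I n. H w) \<le> K * exp (real n * L)"
proof -
  note h = quasi_multiplicativeD[OF q]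
  define M where "M n = (\<Sum>w\<in>words I n. H w)" for n
  have pos: "0 < M n" for n
    unfolding M_def
  proof (rule sum_pos)
    show "finite (words I n)" using I by (simp add: finite_words)
    obtain i where "i \<in> I" using I by auto
    then show "words I n \<noteq> {}" by (rule words_nonempty)
  qed (auto simp: words_def h(2))
  have 1: "M (m + n) \<le> K * (M m * M n)" "M m * M n \<le> K * M (m + n)" for m n
  proof -
    have e: "M m * M n = (\<Sum>u\<in>words I m. \<Sum>v\<in>words I n. H u * H v)"
      unfolding M_def by (simp add: sum_product)
    show "M (m + n) \<le> K * (M m * M n)" 
      unfolding e unfolding sum_distrib_left unfolding M_def sum_words_add
    proof (intro sum_mono)
      fix u v assume "u \<in> words I m" "v \<in> words I n"
      then show "H (u @ v) \<le> K * (H u * H v)" using h(3)[of u v] by (simp add: words_def mult.assoc)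
    qed
    show "M m * M n \<le> K * M (m + n)" 
      unfolding e unfolding M_def sum_words_add unfolding sum_distrib_left
    proof (intro sum_mono)
      fix u v assume "u \<in> words I m" "v \<in> words I n"
      then show "H u * H v \<le> K * H (u @ v)" using h(4)[of u v] by (simp add: words_def)
    qed
  qed
  have "\<bar>ln (M (m + n)) - ln (M m) - ln (M n)\<bar> \<le> ln K" for m n
  proof -
    have "ln (M (m + n)) \<le> ln (K * (M m * M n))" "ln (M m * M n) \<le> ln (K * M (m + n))"
      using 1[of m n] pos[of "m + n"] pos[of m] pos[of n] h(1) by auto
    then show ?thesis using pos[of "m + n"] pos[of m] pos[of n] h(1) by (simp add: ln_mult)
  qed
  from almost_additive_growth[of "\<lambda>n. ln (M n)", OF this] obtain L
    where L: "\<And>n. \<bar>ln (M n) - real n * L\<bar> \<le> ln K" by blast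
  have "exp (real n * L) / K \<le> M n \<and> M n \<le> K * exp (real n * L)" for n
  proof -
    have "exp (ln (M n)) \<le> exp (ln K + real n * L)" "exp (real n * L) \<le> exp (ln K + ln (M n))"
      using L[of n] by auto
    then have "M n \<le> K * exp (real n * L)" "exp (real n * L) \<le> K * M n"
      using pos[of n] h(1) by (simp_all add: exp_add)
    then show ?thesis using h(1) by (simp add: field_simps)
  qed
  then show ?thesis unfolding M_def by blast
qed

text \<open>The words of length N are grouped by their stopping prefix. One factor K comes from
  splitting off the prefix, one from the sum over the tails and one from the sum over all words of
  length N.\<close>

lemma quasi_multiplicative_sum_stopping:
  assumes q: "quasi_multiplicative I K H" and I: "finite I"
    and M: "\<And>n. 1 / K \<le> (\<Sum>w\<in>words I n. H w) \<and> (\<Sum>w\<in>words I n. H w) \<le> K"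
    and N: "\<And>w. w \<in> words I N \<Longrightarrow> G w \<le> \<delta>"
  shows "1 / K ^ 3 \<le> (\<Sum>w\<in>stopping_words I G \<delta>. H w)" "(\<Sum>w\<in>stopping_words I G \<delta>. H w) \<le> K ^ 3"
proof -
  note h = quasi_multiplicativeD[OF q]
  let ?W = "stopping_words I G \<delta>" and ?S = "\<Sum>w\<in>stopping_words I G \<delta>. H w"
  have W: "set w \<subseteq> I" if "w \<in> ?W" for w using that by (auto simp: stopping_words_def)
  have eq: "(\<Sum>u\<in>words I N. H u) = (\<Sum>w\<in>?W. \<Sum>v\<in>words I (N - length w). H (w @ v))"
    by (rule sum_words_stopping[OF I N])
  have "(\<Sum>u\<in>words I N. H u) \<le> (\<Sum>w\<in>?W. K * H w * K)"
    unfolding eq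
  proof (rule sum_mono)
    fix w assume w: "w \<in> ?W"
    have "(\<Sum>v\<in>words I (N - length w). H (w @ v)) \<le> (\<Sum>v\<in>words I (N - length w). K * H w * H v)"
      using h(3) W[OF w] by (intro sum_mono) (auto simp: words_def)
    also have "\<dots> \<le> K * H w * K"
      using M[of "N - length w"] h(1) h(2)[OF W[OF w]] by (auto simp flip: sum_distrib_left)
    finally show "(\<Sum>v\<in>words I (N - length w). H (w @ v)) \<le> K * H w * K" .
  qed
  also have "\<dots> = K * K * ?S" by (simp add: sum_distrib_left algebra_simps)
  finally have "1 / K \<le> K * K * ?S" using M[of N] by linarith
  then show "1 / K ^ 3 \<le> ?S" using h(1) by (simp add: field_simps power3_eq_cube)
  have "(\<Sum>w\<in>?W. H w / K / K) \<le> (\<Sum>u\<in>words I N. H u)"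
    unfolding eq
  proof (rule sum_mono)
    fix w assume w: "w \<in> ?W"
    have "H w / K / K = H w / K * (1 / K)" by simp
    also have "\<dots> \<le> H w / K * (\<Sum>v\<in>words I (N - length w). H v)"
      using M[of "N - length w"] h(1) h(2)[OF W[OF w]] by (intro mult_left_mono) auto
    also have "\<dots> = (\<Sum>v\<in>words I (N - length w). H w / K * H v)" by (simp add: sum_distrib_left)
    also have "\<dots> \<le> (\<Sum>v\<in>words I (N - length w). H (w @ v))"
    proof (rule sum_mono)
      fix v assume "v \<in> words I (N - length w)"
      then have "H w * H v \<le> K * H (w @ v)" using h(4)[of w v] W[OF w] by (auto simp: words_def)
      then show "H w / K * H v \<le> H (w @ v)" using h(1) by (simp add: field_simps)
    qed
    finally show "H w / K / K \<le> (\<Sum>v\<in>words I (N - length w). H (w @ v))" .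
  qed
  then have "?S / K / K \<le> K" using M[of N] by (simp flip: sum_divide_distrib)
  then show "?S \<le> K ^ 3" using h(1) by (simp add: field_simps power3_eq_cube)
qed

text \<open>Dropping the last letter brings \<open>H\<close> above \<delta>, and the letter i lowers
  \<open>H\<close> by a factor of at most \<open>K / H [i]\<close>. The sum over I bounds these
  factors at once; the summand K and the restriction \<open>\<delta> \<le> 1\<close> deal with the
  empty word.\<close>

lemma stopping_words_comparable:
  assumes q: "quasi_multiplicative I K H" and I: "finite I"
  shows "\<exists>\<kappa>\<ge>1. \<forall>\<delta>\<le>1. \<forall>w\<in>stopping_words I H \<delta>. \<delta> \<le> \<kappa> * H w"
proof -
  note h = quasi_multiplicativeD[OF q]
  define \<kappa> where "\<kappa> = K + (\<Sum>i\<in>I. K / H [i])"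
  have pos: "0 \<le> K / H [i]" if "i \<in> I" for i using h(1) h(2)[of "[i]"] that by auto
  have \<kappa>: "\<kappa> \<ge> K" unfolding \<kappa>_def using pos by (simp add: sum_nonneg)
  have "\<delta> \<le> \<kappa> * H w" if \<delta>: "\<delta> \<le> 1" and w: "w \<in> stopping_words I H \<delta>" for \<delta> w
  proof (cases w rule: rev_cases)
    case Nil
    have "1 \<le> K * H w" using quasi_multiplicative_Nil(1)[OF q] h(1) unfolding Nil by (simp add: field_simps)
    also have "\<dots> \<le> \<kappa> * H w" using \<kappa> h(2)[of w] Nil by (intro mult_right_mono) simp_all
    finally show ?thesis using \<delta> by simp
  next
    case (snoc u i)
    have "length u < length w" using snoc by simp
    then have "\<delta> < H (take (length u) w)" using w unfolding stopping_words_def by blast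
    then have "\<delta> < H u" using snoc by simp
    moreover have "set u \<subseteq> I" "i \<in> I" using w snoc by (simp_all add: stopping_words_def)
    ultimately have ui: "set u \<subseteq> I" "i \<in> I" "\<delta> < H u" by simp_all
    have "H u * H [i] \<le> K * H w" using h(4)[of u "[i]"] ui(1,2) unfolding snoc by simp
    then have "H u \<le> K / H [i] * H w" using h(2)[of "[i]"] ui by (simp add: field_simps)
    also have "\<dots> \<le> \<kappa> * H w"
    proof (rule mult_right_mono)
      have "K / H [i] \<le> (\<Sum>i\<in>I. K / H [i])" using pos ui I by (intro member_le_sum) auto
      then show "K / H [i] \<le> \<kappa>" using h(1) by (simp add: \<kappa>_def)
      show "0 \<le> H w" using h(2)[of w] w by (auto simp: stopping_words_def)
    qed
    finally show ?thesis using ui by simp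
  qed
  moreover have "1 \<le> \<kappa>" using \<kappa> h(1) by linarith
  ultimately show ?thesis by blast
qed

section \<open>Measures of an iterated function system with controlled geometry\<close>

definition scale_comparable ::
    "'x set \<Rightarrow> real \<Rightarrow> ('x \<Rightarrow> 'a::metric_space) \<Rightarrow> real \<Rightarrow> ('x \<Rightarrow> 'b::metric_space) \<Rightarrow> real \<Rightarrow> bool" where
  "scale_comparable X L h \<delta> h' \<rho> \<longleftrightarrow> (\<forall>x\<in>X. \<forall>y\<in>X.
     dist (h x) (h y) \<le> L * \<delta> * (dist (h' x) (h' y) / \<rho> + 1) \<and>
     dist (h' x) (h' y) \<le> L * \<rho> * (dist (h x) (h y) / \<delta> + 1))"

text \<open>What the counting arguments use of the system; smoothness is hidden in \<open>F\<close>
  and \<open>G\<close>. By \<open>dist_upper\<close> the image of the square is a strip of height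
  about \<open>G w\<close> and width about \<open>F w\<close>, and \<open>x_lower\<close> keeps it
  from folding over itself in the horizontal direction. Vertical lower bounds appear only in the
  treatment of \<open>rosc\<close>.\<close>

locale ifs_geometry =
  fixes I :: "'i set" and S :: "'i \<Rightarrow> real ^ 2 \<Rightarrow> real ^ 2" and p :: "'i \<Rightarrow> real"
    and \<mu> :: "(real ^ 2) measure" and F G :: "'i list \<Rightarrow> real" and K c :: real
  assumes finite_I: "finite I" and I_nonempty: "I \<noteq> {}"
    and p_pos: "\<And>i. i \<in> I \<Longrightarrow> 0 < p i" and p_sum: "(\<Sum>i\<in>I. p i) = 1"
    and prob_\<mu>: "prob_space \<mu>" and sets_\<mu>: "sets \<mu> = sets borel" and \<mu>_square: "measure \<mu> unit_square = 1"
    and S_square: "\<And>i a. i \<in> I \<Longrightarrow> a \<in> unit_square \<Longrightarrow> S i a \<in> unit_square"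
    and S_cont: "\<And>i. i \<in> I \<Longrightarrow> continuous_on unit_square (S i)"
    and self_similar: "\<And>A. A \<in> sets borel \<Longrightarrow>
      measure \<mu> A = (\<Sum>i\<in>I. p i * measure \<mu> {x\<in>unit_square. S i x \<in> A})"
    and F_qm: "quasi_multiplicative I K F" and G_qm: "quasi_multiplicative I K G"
    and c: "0 < c" "c < 1"
    and F_le: "\<And>w. set w \<subseteq> I \<Longrightarrow> F w \<le> K * c ^ length w"
    and G_le_F: "\<And>w. set w \<subseteq> I \<Longrightarrow> G w \<le> F w"
    and x_lower: "\<And>w a b. set w \<subseteq> I \<Longrightarrow> a \<in> unit_square \<Longrightarrow> b \<in> unit_square \<Longrightarrow>
      F w * \<bar>a $ 1 - b $ 1\<bar> \<le> K * \<bar>word_map S w a $ 1 - word_map S w b $ 1\<bar>"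
    and x_upper: "\<And>w a b. set w \<subseteq> I \<Longrightarrow> a \<in> unit_square \<Longrightarrow> b \<in> unit_square \<Longrightarrow>
      \<bar>word_map S w a $ 1 - word_map S w b $ 1\<bar> \<le> K * (F w * \<bar>a $ 1 - b $ 1\<bar>)"
    and dist_upper: "\<And>w a b. set w \<subseteq> I \<Longrightarrow> a \<in> unit_square \<Longrightarrow> b \<in> unit_square \<Longrightarrow>
      dist (word_map S w a) (word_map S w b) \<le> K * (F w * \<bar>a $ 1 - b $ 1\<bar> + G w)"
begin

sublocale prob_space \<mu> by (rule prob_\<mu>)

abbreviation hits :: "'i list \<Rightarrow> (real ^ 2) set \<Rightarrow> (real ^ 2) set" where
  "hits w A \<equiv> {x\<in>unit_square. word_map S w x \<in> A}"

abbreviation xhits :: "'i list \<Rightarrow> real set \<Rightarrow> (real ^ 2) set" where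
  "xhits w J \<equiv> {x\<in>unit_square. word_map S w x $ 1 \<in> J}"

lemma K_ge_1: "1 \<le> K" using F_qm by (rule quasi_multiplicativeD)
lemma F_pos: "set w \<subseteq> I \<Longrightarrow> 0 < F w" using F_qm by (rule quasi_multiplicativeD)
lemma G_pos: "set w \<subseteq> I \<Longrightarrow> 0 < G w" using G_qm by (rule quasi_multiplicativeD)
lemma weight_pos: "set w \<subseteq> I \<Longrightarrow> 0 < word_weight p w" using p_pos by (rule word_weight_pos)

lemma word_square: "set w \<subseteq> I \<Longrightarrow> a \<in> unit_square \<Longrightarrow> word_map S w a \<in> unit_square"
  by (induction w) (auto simp del: mem_box intro: S_square)

lemma word_cont: "set w \<subseteq> I \<Longrightarrow> continuous_on unit_square (word_map S w)"
proof (induction w)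
  case (Cons i w)
  then have "continuous_on (word_map S w ` unit_square) (S i)"
    using word_square[of w] by (intro continuous_on_subset[OF S_cont]) auto
  with Cons show ?case by (auto simp del: o_apply intro: continuous_on_compose)
qed (simp add: id_def)

lemma xword_cont: "set w \<subseteq> I \<Longrightarrow> continuous_on unit_square (\<lambda>x. word_map S w x $ 1)"
  using word_cont by (intro continuous_intros)

lemma hits_borel: "set w \<subseteq> I \<Longrightarrow> A \<in> sets borel \<Longrightarrow> hits w A \<in> sets borel"
  by (intro continuous_preimage_in_borel word_cont) auto

lemma xhits_borel: "set w \<subseteq> I \<Longrightarrow> J \<in> sets borel \<Longrightarrow> xhits w J \<in> sets borel"
  by (intro continuous_preimage_in_borel xword_cont) auto

lemma self_similar_words:
  "A \<in> sets borel \<Longrightarrow> measure \<mu> A = (\<Sum>w\<in>words I n. word_weight p w * measure \<mu> (hits w A))"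
proof (induction n arbitrary: A)
  case 0
  have "measure \<mu> A = measure \<mu> {x\<in>unit_square. x \<in> A}"
    using AE_prob_1[OF \<mu>_square] 0 sets_\<mu>
    by (intro measure_eq_AE) (auto intro: continuous_preimage_in_borel[of _ "\<lambda>x. x", simplified])
  then show ?case by (simp add: word_weight_def)
next
  case (Suc n)
  have "measure \<mu> A = (\<Sum>i\<in>I. p i * measure \<mu> (hits [i] A))"
    using self_similar[OF Suc.prems] by simp
  also have "\<dots> = (\<Sum>i\<in>I. \<Sum>w\<in>words I n. word_weight p ([i] @ w) * measure \<mu> (hits ([i] @ w) A))"
  proof (rule sum.cong[OF refl])
    fix i assume i: "i \<in> I"
    have "measure \<mu> (hits [i] A) = (\<Sum>w\<in>words I n. word_weight p w * measure \<mu> (hits w (hits [i] A)))"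
      using i Suc.prems by (intro Suc.IH hits_borel) auto
    also have "\<dots> = (\<Sum>w\<in>words I n. word_weight p w * measure \<mu> (hits ([i] @ w) A))"
    proof (rule sum.cong[OF refl])
      fix w assume "w \<in> words I n"
      then have "hits w (hits [i] A) = hits ([i] @ w) A"
        using word_square[of w] by (auto simp: words_def simp del: mem_box)
      then show "word_weight p w * measure \<mu> (hits w (hits [i] A)) = word_weight p w * measure \<mu> (hits ([i] @ w) A)"
        by simp
    qed
    finally show "p i * measure \<mu> (hits [i] A) =
        (\<Sum>w\<in>words I n. word_weight p ([i] @ w) * measure \<mu> (hits ([i] @ w) A))"
      by (simp add: sum_distrib_left word_weight_def mult.assoc)
  qed
  also have "\<dots> = (\<Sum>w\<in>words I (1 + n). word_weight p w * measure \<mu> (hits w A))"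
    unfolding sum_words_add sum_words_1 ..
  finally show ?case by simp
qed

text \<open>At level N the tails behind a fixed stopping prefix w are summed up again by
  self-similarity, applied to the preimage \<open>hits w A\<close>.\<close>

lemma self_similar_stopping:
  assumes N: "\<And>w. w \<in> words I N \<Longrightarrow> H w \<le> \<delta>" and A: "A \<in> sets borel"
  shows "measure \<mu> A = (\<Sum>w\<in>stopping_words I H \<delta>. word_weight p w * measure \<mu> (hits w A))"
proof -
  have "measure \<mu> A = (\<Sum>w\<in>words I N. word_weight p w * measure \<mu> (hits w A))"
    using A by (rule self_similar_words)
  also have "\<dots> = (\<Sum>w\<in>stopping_words I H \<delta>. \<Sum>v\<in>words I (N - length w).
      word_weight p (w @ v) * measure \<mu> (hits (w @ v) A))"
    using N by (rule sum_words_stopping[OF finite_I])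
  also have "\<dots> = (\<Sum>w\<in>stopping_words I H \<delta>. word_weight p w * measure \<mu> (hits w A))"
  proof (rule sum.cong[OF refl])
    fix w assume "w \<in> stopping_words I H \<delta>"
    then have w: "set w \<subseteq> I" by (simp add: stopping_words_def)
    have "(\<Sum>v\<in>words I (N - length w). word_weight p (w @ v) * measure \<mu> (hits (w @ v) A)) =
      (\<Sum>v\<in>words I (N - length w). word_weight p w * (word_weight p v * measure \<mu> (hits v (hits w A))))"
    proof (rule sum.cong[OF refl])
      fix v assume "v \<in> words I (N - length w)"
      then have "hits v (hits w A) = hits (w @ v) A"
        using word_square[of v] by (auto simp: words_def word_map_append simp del: mem_box)
      then show "word_weight p (w @ v) * measure \<mu> (hits (w @ v) A) =
          word_weight p w * (word_weight p v * measure \<mu> (hits v (hits w A)))"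
        by (simp add: word_weight_append)
    qed
    also have "\<dots> = word_weight p w * measure \<mu> (hits w A)"
      using self_similar_words[OF hits_borel[OF w A]] by (simp flip: sum_distrib_left)
    finally show "(\<Sum>v\<in>words I (N - length w). word_weight p (w @ v) * measure \<mu> (hits (w @ v) A)) =
      word_weight p w * measure \<mu> (hits w A)" .
  qed
  finally show ?thesis .
qed

lemma F_small: 
  assumes "\<delta> > 0"
  obtains N where "\<And>w. w \<in> words I N \<Longrightarrow> F w \<le> \<delta>" "\<And>w. w \<in> words I N \<Longrightarrow> G w \<le> \<delta>"
proof -
  have "\<delta> / K > 0" using assms K_ge_1 by simp
  then obtain N where "c ^ N < \<delta> / K" using real_arch_pow_inv c by blast
  then have N: "K * c ^ N \<le> \<delta>" using K_ge_1 by (simp add: field_simps)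
  have "F w \<le> \<delta>" "G w \<le> \<delta>" if "w \<in> words I N" for w
    using F_le[of w] G_le_F[of w] that N by (auto simp: words_def)
  then show ?thesis using that by blast
qed

abbreviation xsum :: "real \<Rightarrow> real \<Rightarrow> real" where
  "xsum q \<delta> \<equiv> pullback_sum \<mu> unit_square q (\<lambda>x. x $ 1) \<delta>"

text \<open>The order of the quantifiers is the point: one constant for all words and scales with
  the same L, in both directions.\<close>

lemma compare_const:
  assumes "0 \<le> q" "0 \<le> L"
  shows "\<exists>C>0. \<forall>(h :: real ^ 2 \<Rightarrow> 'a::euclidean_space) (h' :: real ^ 2 \<Rightarrow> 'b::euclidean_space) \<delta> \<rho>.
      continuous_on unit_square h \<and> continuous_on unit_square h' \<and> 0 < \<delta> \<and> 0 < \<rho> \<and>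
      scale_comparable unit_square L h \<delta> h' \<rho> \<longrightarrow>
      pullback_sum \<mu> unit_square q h \<delta> \<le> C * pullback_sum \<mu> unit_square q h' \<rho> \<and>
      pullback_sum \<mu> unit_square q h' \<rho> \<le> C * pullback_sum \<mu> unit_square q h \<delta>"
proof -
  define C1 where "C1 = real ((2 * nat \<lceil>L * real (DIM('a) + 1)\<rceil> + 3) ^ DIM('b)) powr q *
      real ((2 * nat \<lceil>L * real (DIM('b) + 1)\<rceil> + 3) ^ DIM('a))"
  define C2 where "C2 = real ((2 * nat \<lceil>L * real (DIM('b) + 1)\<rceil> + 3) ^ DIM('a)) powr q *
      real ((2 * nat \<lceil>L * real (DIM('a) + 1)\<rceil> + 3) ^ DIM('b))"
  have pos: "C1 > 0" "C2 > 0" unfolding C1_def C2_def by (auto simp: add_pos_nonneg intro!: mult_pos_pos)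
  show ?thesis
  proof (rule exI[of _ "C1 + C2"], intro conjI allI impI)
    show "0 < C1 + C2" using pos by simp
    fix h :: "real ^ 2 \<Rightarrow> 'a" and h' :: "real ^ 2 \<Rightarrow> 'b" and \<delta> \<rho>
    assume asm: "continuous_on unit_square h \<and> continuous_on unit_square h' \<and> 0 < \<delta> \<and> 0 < \<rho> \<and>
      scale_comparable unit_square L h \<delta> h' \<rho>"
    then have *: "continuous_on unit_square h" "continuous_on unit_square h'" "0 < \<delta>" "0 < \<rho>"
      "\<And>x y. x \<in> unit_square \<Longrightarrow> y \<in> unit_square \<Longrightarrow>
        dist (h x) (h y) \<le> L * \<delta> * (dist (h' x) (h' y) / \<rho> + 1)"
      "\<And>x y. x \<in> unit_square \<Longrightarrow> y \<in> unit_square \<Longrightarrow>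
        dist (h' x) (h' y) \<le> L * \<rho> * (dist (h x) (h y) / \<delta> + 1)"
      unfolding scale_comparable_def by blast+
    have "pullback_sum \<mu> unit_square q h \<delta> \<le> C1 * pullback_sum \<mu> unit_square q h' \<rho>"
      unfolding C1_def
      by (rule pullback_sum_compare[OF finite_measure_axioms sets_\<mu> compact_cbox *(1,2,3,4) assms *(5,6)])
    moreover have "pullback_sum \<mu> unit_square q h' \<rho> \<le> C2 * pullback_sum \<mu> unit_square q h \<delta>"
      unfolding C2_def
      by (rule pullback_sum_compare[OF finite_measure_axioms sets_\<mu> compact_cbox *(2,1,4,3) assms *(6,5)])
    moreover have "C1 * pullback_sum \<mu> unit_square q h' \<rho> \<le> (C1 + C2) * pullback_sum \<mu> unit_square q h' \<rho>"
      "C2 * pullback_sum \<mu> unit_square q h \<delta> \<le> (C1 + C2) * pullback_sum \<mu> unit_square q h \<delta>"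
      using pos by (auto intro!: mult_right_mono pullback_sum_nonneg)
    ultimately show "pullback_sum \<mu> unit_square q h \<delta> \<le> (C1 + C2) * pullback_sum \<mu> unit_square q h' \<rho>"
      "pullback_sum \<mu> unit_square q h' \<rho> \<le> (C1 + C2) * pullback_sum \<mu> unit_square q h \<delta>" by linarith+
  qed
qed

lemma x_distance_bounds:
  assumes w: "set w \<subseteq> I" and pos: "0 < \<delta>" "0 < \<rho>" and \<kappa>: "\<delta> \<le> \<kappa> * (\<rho> * F w)" "\<rho> * F w \<le> \<kappa> * \<delta>"
    and ab: "a \<in> unit_square" "b \<in> unit_square"
  shows "F w * \<bar>a $ 1 - b $ 1\<bar> \<le> \<kappa> * \<delta> * (\<bar>a $ 1 - b $ 1\<bar> / \<rho>)"
    "\<bar>a $ 1 - b $ 1\<bar> \<le> K * \<kappa> * \<rho> * (\<bar>word_map S w a $ 1 - word_map S w b $ 1\<bar> / \<delta>)"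
proof -
  have "F w \<le> \<kappa> * \<delta> / \<rho>" using \<kappa> pos by (simp add: field_simps)
  then have "F w * \<bar>a $ 1 - b $ 1\<bar> \<le> \<kappa> * \<delta> / \<rho> * \<bar>a $ 1 - b $ 1\<bar>" by (rule mult_right_mono) simp
  then show "F w * \<bar>a $ 1 - b $ 1\<bar> \<le> \<kappa> * \<delta> * (\<bar>a $ 1 - b $ 1\<bar> / \<rho>)" by simp
  have "\<delta> * \<bar>a $ 1 - b $ 1\<bar> \<le> \<kappa> * (\<rho> * F w) * \<bar>a $ 1 - b $ 1\<bar>" using \<kappa> by (intro mult_right_mono) auto
  also have "\<dots> = \<kappa> * \<rho> * (F w * \<bar>a $ 1 - b $ 1\<bar>)" by simp
  also have "\<dots> \<le> \<kappa> * \<rho> * (K * \<bar>word_map S w a $ 1 - word_map S w b $ 1\<bar>)"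
  proof (intro mult_left_mono x_lower w ab)
    have "0 < \<kappa> * (\<rho> * F w)" using \<kappa> pos by linarith
    then have "0 < \<kappa>" using F_pos[OF w] pos by (metis mult_pos_pos zero_less_mult_pos2)
    then show "0 \<le> \<kappa> * \<rho>" using pos by simp
  qed
  finally show "\<bar>a $ 1 - b $ 1\<bar> \<le> K * \<kappa> * \<rho> * (\<bar>word_map S w a $ 1 - word_map S w b $ 1\<bar> / \<delta>)"
    using pos by (simp add: field_simps)
qed

text \<open>On first coordinates a word acts like a scaling by \<open>F w\<close> up to bounded
  factors, so its image at mesh size \<delta> looks like the whole projection at a mesh size \<rho>
  of about \<open>\<delta> / F w\<close>.\<close>

lemma xword_sum_compare:
  assumes "0 \<le> q" "1 \<le> \<kappa>"
  obtains C where "C > 0" "\<And>w \<delta> \<rho>. set w \<subseteq> I \<Longrightarrow> 0 < \<delta> \<Longrightarrow> 0 < \<rho> \<Longrightarrow>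
      \<delta> \<le> \<kappa> * (\<rho> * F w) \<Longrightarrow> \<rho> * F w \<le> \<kappa> * \<delta> \<Longrightarrow>
      pullback_sum \<mu> unit_square q (\<lambda>x. word_map S w x $ 1) \<delta> \<le> C * xsum q \<rho> \<and>
      xsum q \<rho> \<le> C * pullback_sum \<mu> unit_square q (\<lambda>x. word_map S w x $ 1) \<delta>"
proof -
  have L: "0 \<le> K * \<kappa>" using K_ge_1 assms by simp
  from compare_const[where 'a = "real" and 'b = real, OF assms(1) L] obtain C where C: "C > 0"
    and cmp: "\<And>(h :: real ^ 2 \<Rightarrow> real) (h' :: real ^ 2 \<Rightarrow> real) \<delta> \<rho>.
      continuous_on unit_square h \<and> continuous_on unit_square h' \<and> 0 < \<delta> \<and> 0 < \<rho> \<and>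
      scale_comparable unit_square (K * \<kappa>) h \<delta> h' \<rho> \<Longrightarrow>
      pullback_sum \<mu> unit_square q h \<delta> \<le> C * pullback_sum \<mu> unit_square q h' \<rho> \<and>
      pullback_sum \<mu> unit_square q h' \<rho> \<le> C * pullback_sum \<mu> unit_square q h \<delta>"
    by blast
  show ?thesis
  proof (rule that[OF C], rule cmp, unfold scale_comparable_def, intro conjI ballI)
    fix w \<delta> \<rho> and x y :: "real ^ 2"
    assume w: "set w \<subseteq> I" and pos: "0 < \<delta>" "0 < \<rho>" and \<kappa>: "\<delta> \<le> \<kappa> * (\<rho> * F w)" "\<rho> * F w \<le> \<kappa> * \<delta>"
    show "continuous_on unit_square (\<lambda>x. word_map S w x $ 1)" using w by (rule xword_cont)
    assume xy: "x \<in> unit_square" "y \<in> unit_square"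
    note b = x_distance_bounds[OF w pos \<kappa> xy]
    have "\<bar>word_map S w x $ 1 - word_map S w y $ 1\<bar> \<le> K * (\<kappa> * \<delta> * (\<bar>x $ 1 - y $ 1\<bar> / \<rho>))"
      using x_upper[OF w xy] b(1) K_ge_1 by (meson mult_left_mono order_trans zero_le_one)
    then show "dist (word_map S w x $ 1) (word_map S w y $ 1) \<le> K * \<kappa> * \<delta> * (dist (x $ 1) (y $ 1) / \<rho> + 1)"
      using mult_nonneg_nonneg[OF L less_imp_le[OF pos(1)]] by (simp add: dist_real_def algebra_simps)
    show "dist (x $ 1) (y $ 1) \<le> K * \<kappa> * \<rho> * (dist (word_map S w x $ 1) (word_map S w y $ 1) / \<delta> + 1)"
      using b(2) mult_nonneg_nonneg[OF L less_imp_le[OF pos(2)]] by (simp add: dist_real_def algebra_simps)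
  qed (auto intro!: continuous_intros)
qed

text \<open>Since \<open>G w\<close> is at most of the order of the mesh size, the strip looks
  one-dimensional: its height is absorbed by the additive unit in
  \<open>scale_comparable\<close>.\<close>

lemma word_sum_compare:
  assumes "0 \<le> q" "1 \<le> \<kappa>"
  obtains C where "C > 0" "\<And>w \<delta> \<rho>. set w \<subseteq> I \<Longrightarrow> 0 < \<delta> \<Longrightarrow> 0 < \<rho> \<Longrightarrow>
      \<delta> \<le> \<kappa> * (\<rho> * F w) \<Longrightarrow> \<rho> * F w \<le> \<kappa> * \<delta> \<Longrightarrow> G w \<le> \<kappa> * \<delta> \<Longrightarrow>
      pullback_sum \<mu> unit_square q (word_map S w) \<delta> \<le> C * xsum q \<rho> \<and>
      xsum q \<rho> \<le> C * pullback_sum \<mu> unit_square q (word_map S w) \<delta>"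
proof -
  have L: "0 \<le> K * \<kappa>" using K_ge_1 assms by simp
  from compare_const[where 'a = "real ^ 2" and 'b = real, OF assms(1) L] obtain C where C: "C > 0"
    and cmp: "\<And>(h :: real ^ 2 \<Rightarrow> real ^ 2) (h' :: real ^ 2 \<Rightarrow> real) \<delta> \<rho>.
      continuous_on unit_square h \<and> continuous_on unit_square h' \<and> 0 < \<delta> \<and> 0 < \<rho> \<and>
      scale_comparable unit_square (K * \<kappa>) h \<delta> h' \<rho> \<Longrightarrow>
      pullback_sum \<mu> unit_square q h \<delta> \<le> C * pullback_sum \<mu> unit_square q h' \<rho> \<and>
      pullback_sum \<mu> unit_square q h' \<rho> \<le> C * pullback_sum \<mu> unit_square q h \<delta>"
    by blast
  show ?thesis
  proof (rule that[OF C], rule cmp, unfold scale_comparable_def, intro conjI ballI)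
    fix w \<delta> \<rho> and x y :: "real ^ 2"
    assume w: "set w \<subseteq> I" and pos: "0 < \<delta>" "0 < \<rho>" and \<kappa>: "\<delta> \<le> \<kappa> * (\<rho> * F w)" "\<rho> * F w \<le> \<kappa> * \<delta>"
      and G: "G w \<le> \<kappa> * \<delta>"
    show "continuous_on unit_square (word_map S w)" using w by (rule word_cont)
    assume xy: "x \<in> unit_square" "y \<in> unit_square"
    note b = x_distance_bounds[OF w pos \<kappa> xy]
    have "dist (word_map S w x) (word_map S w y) \<le> K * (F w * \<bar>x $ 1 - y $ 1\<bar> + G w)"
      using w xy by (rule dist_upper)
    also have "\<dots> \<le> K * (\<kappa> * \<delta> * (\<bar>x $ 1 - y $ 1\<bar> / \<rho>) + \<kappa> * \<delta>)"
      using b(1) G K_ge_1 by (intro mult_left_mono add_mono) auto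
    finally show "dist (word_map S w x) (word_map S w y) \<le> K * \<kappa> * \<delta> * (dist (x $ 1) (y $ 1) / \<rho> + 1)"
      by (simp add: dist_real_def algebra_simps)
    have "\<bar>x $ 1 - y $ 1\<bar> \<le> K * \<kappa> * \<rho> * (\<bar>(word_map S w x - word_map S w y) $ 1\<bar> / \<delta>)"
      using b(2) by simp
    also have "\<dots> \<le> K * \<kappa> * \<rho> * (dist (word_map S w x) (word_map S w y) / \<delta> + 1)"
    proof (intro mult_left_mono)
      have "\<bar>(word_map S w x - word_map S w y) $ 1\<bar> / \<delta> \<le> dist (word_map S w x) (word_map S w y) / \<delta>"
        unfolding dist_norm using pos by (intro divide_right_mono component_le_norm_cart) auto
      then show "\<bar>(word_map S w x - word_map S w y) $ 1\<bar> / \<delta> \<le> dist (word_map S w x) (word_map S w y) / \<delta> + 1"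
        by linarith
    qed (use L pos in auto)
    finally show "dist (x $ 1) (y $ 1) \<le> K * \<kappa> * \<rho> * (dist (word_map S w x) (word_map S w y) / \<delta> + 1)"
      by (simp add: dist_real_def)
  qed (auto intro!: continuous_intros)
qed

text \<open>The case of the empty word, for which \<open>F []\<close> lies between
  \<open>1 / K\<close> and K; hence the enlarged ratio \<open>\<kappa> * K\<close>.\<close>

lemma xsum_compare:
  assumes "0 \<le> q" "1 \<le> \<kappa>"
  obtains C where "C > 0" "\<And>\<delta> \<rho>. 0 < \<delta> \<Longrightarrow> 0 < \<rho> \<Longrightarrow> \<delta> \<le> \<kappa> * \<rho> \<Longrightarrow> \<rho> \<le> \<kappa> * \<delta> \<Longrightarrow>
      xsum q \<delta> \<le> C * xsum q \<rho>"
proof -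
  have \<kappa>: "1 \<le> \<kappa> * K" using mult_mono[OF assms(2) K_ge_1] assms by simp
  from xword_sum_compare[OF assms(1) \<kappa>] obtain C where C: "C > 0"
    and cmp: "\<And>w \<delta> \<rho>. set w \<subseteq> I \<Longrightarrow> 0 < \<delta> \<Longrightarrow> 0 < \<rho> \<Longrightarrow>
      \<delta> \<le> \<kappa> * K * (\<rho> * F w) \<Longrightarrow> \<rho> * F w \<le> \<kappa> * K * \<delta> \<Longrightarrow>
      pullback_sum \<mu> unit_square q (\<lambda>x. word_map S w x $ 1) \<delta> \<le> C * xsum q \<rho> \<and>
      xsum q \<rho> \<le> C * pullback_sum \<mu> unit_square q (\<lambda>x. word_map S w x $ 1) \<delta>" by blast
  show ?thesis
  proof (rule that[OF C])
    fix \<delta> \<rho> :: real assume *: "0 < \<delta>" "0 < \<rho>" "\<delta> \<le> \<kappa> * \<rho>" "\<rho> \<le> \<kappa> * \<delta>"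
    have F: "1 \<le> K * F []" "F [] \<le> K"
      using quasi_multiplicative_Nil[OF F_qm] K_ge_1 by (auto simp: field_simps)
    have "\<kappa> * \<rho> * 1 \<le> \<kappa> * \<rho> * (K * F [])" using F * assms by (intro mult_left_mono) auto
    then have 1: "\<delta> \<le> \<kappa> * K * (\<rho> * F [])" using * by (simp add: ac_simps)
    have "\<rho> * F [] \<le> (\<kappa> * \<delta>) * K" using F * F_pos[of "[]"] by (intro mult_mono) auto
    then show "xsum q \<delta> \<le> C * xsum q \<rho>" using cmp[of "[]" \<delta> \<rho>] 1 * by (simp add: ac_simps)
  qed
qed

end

section \<open>The spectrum of the projection\<close>

context ifs_geometry
begin

abbreviation xcells :: "real \<Rightarrow> real set set" where
  "xcells \<delta> \<equiv> mesh_meeting \<delta> {0..1}"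

lemma x_image: "(\<lambda>x. x $ 1) ` unit_square = {0..1 :: real}"
proof (intro equalityI subsetI)
  fix t :: real assume "t \<in> {0..1}"
  then have "(\<chi> i. t) \<in> unit_square" "t = (\<chi> i. t) $ (1::2)" by (auto simp: mem_box_cart)
  then show "t \<in> (\<lambda>x. x $ 1) ` unit_square" by (rule rev_image_eqI)
qed (auto simp: mem_box_cart)

lemma x_in_unit: "a \<in> unit_square \<Longrightarrow> a $ 1 \<in> {0..1 :: real}"
  using x_image by (metis imageI)

lemma xcells_finite: "\<delta> > 0 \<Longrightarrow> finite (xcells \<delta>)"
  by (intro finite_mesh_meeting) auto

lemma xcell_cover:
  assumes "\<delta> > 0" "set w \<subseteq> I" "a \<in> unit_square"
  obtains J where "J \<in> xcells \<delta>" "word_map S w a $ 1 \<in> J"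
proof -
  obtain J where J: "J \<in> mesh_cubes \<delta>" "word_map S w a $ 1 \<in> J" using mesh_cubes_cover assms(1) by blast
  then have "J \<in> xcells \<delta>"
    unfolding mesh_meeting_def using x_in_unit[OF word_square[OF assms(2,3)]] by blast
  then show ?thesis using that J(2) by blast
qed

lemma xsum_eq: "xsum q \<delta> = (\<Sum>J\<in>xcells \<delta>. measure \<mu> (xhits [] J) powr q)"
  unfolding pullback_sum_def x_image by simp

lemma xcell_borel: "J \<in> xcells \<delta> \<Longrightarrow> J \<in> sets borel"
  by (auto simp: mesh_meeting_def dest!: mesh_cube_closed)

lemma xword_sum_eq:
  assumes w: "set w \<subseteq> I" and \<delta>: "\<delta> > 0"
  shows "pullback_sum \<mu> unit_square q (\<lambda>x. word_map S w x $ 1) \<delta> =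
    (\<Sum>J\<in>xcells \<delta>. measure \<mu> (xhits w J) powr q)"
proof (rule pullback_sum_superset)
  show "mesh_meeting \<delta> ((\<lambda>x. word_map S w x $ 1) ` unit_square) \<subseteq> xcells \<delta>"
    unfolding mesh_meeting_def using x_in_unit[OF word_square[OF w]] by blast
qed (use xcells_finite \<delta> in \<open>auto simp: mesh_meeting_def\<close>)

text \<open>Only an inequality, since the closed cells share end points and mass there is counted
  twice.\<close>

lemma one_le_sum_xhits:
  assumes w: "set w \<subseteq> I" and \<delta>: "\<delta> > 0"
  shows "1 \<le> (\<Sum>J\<in>xcells \<delta>. measure \<mu> (xhits w J))"
proof -
  have "1 = measure \<mu> unit_square" by (simp only: \<mu>_square)
  also have "\<dots> \<le> measure \<mu> (\<Union>J\<in>xcells \<delta>. xhits w J)"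
  proof (rule finite_measure_mono)
    show "unit_square \<subseteq> (\<Union>J\<in>xcells \<delta>. xhits w J)"
    proof
      fix a :: "real ^ 2" assume a: "a \<in> unit_square"
      obtain J where "J \<in> xcells \<delta>" "word_map S w a $ 1 \<in> J" using xcell_cover[OF \<delta> w a] .
      then show "a \<in> (\<Union>J\<in>xcells \<delta>. xhits w J)" using a by blast
    qed
    show "(\<Union>J\<in>xcells \<delta>. xhits w J) \<in> sets \<mu>"
      unfolding sets_\<mu> using xcells_finite[OF \<delta>] xhits_borel[OF w] xcell_borel by (intro sets.finite_UN) auto
  qed
  also have "\<dots> \<le> (\<Sum>J\<in>xcells \<delta>. measure \<mu> (xhits w J))"
  proof (rule finite_measure_subadditive_finite)
    show "(\<lambda>J. xhits w J) ` xcells \<delta> \<subseteq> sets \<mu>" unfolding sets_\<mu> using xhits_borel[OF w] xcell_borel by blast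
  qed (use xcells_finite \<delta> in auto)
  finally show ?thesis .
qed

lemma card_xcells:
  assumes "0 < \<delta>" "\<delta> \<le> 1"
  shows "real (card (xcells \<delta>)) \<le> 7 / \<delta>"
proof -
  have "card (xcells \<delta>) \<le> (2 * nat \<lceil>1 / \<delta>\<rceil> + 3) ^ DIM(real)"
    using assms by (intro mesh_meeting_card) (auto simp: dist_real_def)
  then have "real (card (xcells \<delta>)) \<le> 2 * real (nat \<lceil>1 / \<delta>\<rceil>) + 3" by simp
  also have "real (nat \<lceil>1 / \<delta>\<rceil>) \<le> 1 / \<delta> + 1" using assms using of_int_ceiling_le_add_one[of "1 / \<delta>"] by simp
  \<comment> \<open>The constant 5 is at most \<open>5 / \<delta>\<close>, as
    \<open>\<delta> \<le> 1\<close>.\<close>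
  also have "2 * (1 / \<delta> + 1) + 3 \<le> 7 / \<delta>" using assms by (simp add: field_simps)
  finally show ?thesis by simp
qed

text \<open>Mass at least 1 is spread over at most \<open>7 / \<delta>\<close> cells. This and the
  next bound, polynomial in \<delta>, become the linear bounds that Fekete's lemma asks for.\<close>

lemma xsum_lower:
  assumes "0 \<le> q" "0 < \<delta>" "\<delta> \<le> 1"
  shows "1 \<le> (7 / \<delta>) powr q * xsum q \<delta>"
proof -
  have "1 \<le> (\<Sum>J\<in>xcells \<delta>. measure \<mu> (xhits [] J)) powr q"
    using one_le_sum_xhits[of "[]" \<delta>] assms by (intro ge_one_powr_ge_zero) auto
  also have "\<dots> \<le> real (card (xcells \<delta>)) powr q * xsum q \<delta>"
    unfolding xsum_eq using assms xcells_finite by (intro powr_sum_le_card) auto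
  also have "\<dots> \<le> (7 / \<delta>) powr q * xsum q \<delta>"
    using assms card_xcells by (intro mult_right_mono powr_mono2 pullback_sum_nonneg) auto
  finally show ?thesis .
qed

lemma xsum_upper:
  assumes "0 \<le> q" "0 < \<delta>" "\<delta> \<le> 1"
  shows "xsum q \<delta> \<le> 7 / \<delta>"
proof -
  have "xsum q \<delta> \<le> real (card (xcells \<delta>)) * 1"
    unfolding xsum_eq using assms powr_le1[OF assms(1)] by (intro sum_bounded_above) auto
  then show ?thesis using card_xcells[OF assms(2,3)] by linarith
qed

lemma xsum_pos: "0 \<le> q \<Longrightarrow> 0 < \<delta> \<Longrightarrow> \<delta> \<le> 1 \<Longrightarrow> 0 < xsum q \<delta>"
  using xsum_lower[of q \<delta>] pullback_sum_nonneg[of \<mu> unit_square q "\<lambda>x. x $ 1" \<delta>] by (cases "xsum q \<delta> = 0") auto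

section \<open>Words of width about \<delta> and the cells they meet\<close>

definition meets :: "'i list \<Rightarrow> real set \<Rightarrow> bool" where
  "meets w J \<longleftrightarrow> xhits w J \<noteq> {}"

text \<open>A stopping word may straddle several cells of mesh \<delta>, so the mass on a fine cell
  cannot be assigned to a single coarse cell. Being joined by a stopping word replaces containment,
  and \<open>card_linked\<close> bounds the ambiguity.\<close>

definition linked :: "real \<Rightarrow> real set \<Rightarrow> real set \<Rightarrow> bool" where
  "linked \<delta> J R \<longleftrightarrow> (\<exists>w\<in>stopping_words I F \<delta>. meets w J \<and> meets w R)"

lemma measure_xhits_not_meets: "\<not> meets w J \<Longrightarrow> measure \<mu> (xhits w J) = 0"
  unfolding meets_def by (simp only: not_not measure_empty)

text \<open>A stopping word has width at most \<open>K * \<delta>\<close>. All words meeting R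
  therefore stay within \<open>K * \<delta>\<close> of the small cell R, in a set of diameter at
  most \<open>(2 * K + 1) * \<delta>\<close>.\<close>

lemma card_linked:
  assumes "R \<in> mesh_cubes r" "0 < r" "r \<le> \<delta>"
  shows "card {J\<in>xcells \<delta>. linked \<delta> J R} \<le> 2 * nat \<lceil>2 * K + 1\<rceil> + 3"
proof -
  define X where "X = {word_map S w a $ 1 | w a. w \<in> stopping_words I F \<delta> \<and> meets w R \<and> a \<in> unit_square}"
  have \<delta>: "\<delta> > 0" using assms by linarith
  have close: "\<exists>y\<in>R. dist x y \<le> K * \<delta>" if "x \<in> X" for x
  proof -
    obtain w a b where w: "w \<in> stopping_words I F \<delta>" "x = word_map S w a $ 1"
      "a \<in> unit_square" "b \<in> unit_square" "word_map S w b $ 1 \<in> R"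
      using \<open>x \<in> X\<close> unfolding X_def meets_def by blast
    then have wI: "set w \<subseteq> I" "F w \<le> \<delta>" by (auto simp: stopping_words_def)
    have ab: "\<bar>a $ 1 - b $ 1\<bar> \<le> 1" using x_in_unit[OF w(3)] x_in_unit[OF w(4)] by auto
    have "dist x (word_map S w b $ 1) \<le> K * (F w * \<bar>a $ 1 - b $ 1\<bar>)"
      using x_upper[OF wI(1) w(3,4)] by (simp add: w(2) dist_real_def)
    also have "\<dots> \<le> K * (\<delta> * 1)"
      using wI ab K_ge_1 \<delta> F_pos[OF wI(1)] by (intro mult_left_mono mult_mono) auto
    finally show ?thesis using w(5) by auto
  qed
  have d: "dist x y \<le> (2 * K + 1) * \<delta>" if "x \<in> X" "y \<in> X" for x y
  proof -
    obtain x' y' where "x' \<in> R" "y' \<in> R" "dist x x' \<le> K * \<delta>" "dist y y' \<le> K * \<delta>"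
      using close[OF \<open>x \<in> X\<close>] close[OF \<open>y \<in> X\<close>] by blast
    moreover have "dist x' y' \<le> r" using mesh_cube_dist[OF assms(1) \<open>x' \<in> R\<close> \<open>y' \<in> R\<close>] by simp
    ultimately have "dist x y \<le> K * \<delta> + r + K * \<delta>"
      using dist_triangle[of x y x'] dist_triangle[of x' y y'] by (simp add: dist_commute)
    then show ?thesis using assms by (simp add: algebra_simps)
  qed
  have "{J\<in>xcells \<delta>. linked \<delta> J R} \<subseteq> mesh_meeting \<delta> X"
    unfolding linked_def meets_def mesh_meeting_def X_def by blast
  then have "card {J\<in>xcells \<delta>. linked \<delta> J R} \<le> card (mesh_meeting \<delta> X)"
    using mesh_meeting_card(1)[OF \<delta> d] by (intro card_mono) auto
  also have "\<dots> \<le> 2 * nat \<lceil>2 * K + 1\<rceil> + 3" using mesh_meeting_card(2)[OF \<delta> d] by simp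
  finally show ?thesis .
qed

text \<open>A substitute for the mass of J that is a plain sum of weights, as Jensen's inequality
  wants it. It dominates the mass of J and is dominated by the total mass of the cells linked to
  J.\<close>

definition meeting_weight :: "real \<Rightarrow> real set \<Rightarrow> real" where
  "meeting_weight \<delta> J = (\<Sum>w\<in>{w\<in>stopping_words I F \<delta>. meets w J}. word_weight p w)"

lemma finite_stopping_F: "\<delta> > 0 \<Longrightarrow> finite (stopping_words I F \<delta>)"
  using F_small[of \<delta>] finite_stopping_words[OF finite_I] by metis

lemma finite_stopping_G: "\<delta> > 0 \<Longrightarrow> finite (stopping_words I G \<delta>)"
  using F_small[of \<delta>] finite_stopping_words[OF finite_I] by metis

lemma stopping_subset: "w \<in> stopping_words I H \<delta> \<Longrightarrow> set w \<subseteq> I"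
  by (simp add: stopping_words_def)

lemma measure_xhits_stopping:
  assumes "\<delta> > 0" "J \<in> sets borel"
  shows "measure \<mu> (xhits [] J) = (\<Sum>w\<in>stopping_words I F \<delta>. word_weight p w * measure \<mu> (xhits w J))"
proof -
  obtain N where N: "\<And>w. w \<in> words I N \<Longrightarrow> F w \<le> \<delta>" using F_small assms(1) by blast
  have b: "xhits [] J \<in> sets borel" using assms(2) by (intro xhits_borel) auto
  have "hits w (xhits [] J) = xhits w J" if "w \<in> stopping_words I F \<delta>" for w
    using word_square[OF stopping_subset[OF that]] by (auto simp del: mem_box)
  then show ?thesis using self_similar_stopping[OF N b] by simp
qed

lemma meeting_weight_nonneg: "0 \<le> meeting_weight \<delta> J"
  unfolding meeting_weight_def using weight_pos stopping_subset by (intro sum_nonneg) (auto intro: less_imp_le)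

lemma measure_le_meeting_weight:
  assumes "\<delta> > 0" "J \<in> sets borel"
  shows "measure \<mu> (xhits [] J) \<le> meeting_weight \<delta> J"
proof -
  have "measure \<mu> (xhits [] J) = (\<Sum>w\<in>stopping_words I F \<delta>. word_weight p w * measure \<mu> (xhits w J))"
    by (rule measure_xhits_stopping[OF assms])
  also have "\<dots> = (\<Sum>w\<in>{w\<in>stopping_words I F \<delta>. meets w J}. word_weight p w * measure \<mu> (xhits w J))"
    using finite_stopping_F[OF assms(1)] measure_xhits_not_meets by (intro sum.mono_neutral_right) auto
  also have "\<dots> \<le> (\<Sum>w\<in>{w\<in>stopping_words I F \<delta>. meets w J}. word_weight p w * 1)"
    using weight_pos stopping_subset by (intro sum_mono mult_left_mono) (auto intro: less_imp_le)
  finally show ?thesis by (simp add: meeting_weight_def)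
qed

text \<open>A word meeting J has all its mass in cells that it meets, and these are linked to J by
  that same word.\<close>

lemma meeting_weight_le:
  assumes \<delta>: "\<delta> > 0"
  shows "meeting_weight \<delta> J \<le> (\<Sum>R\<in>{R\<in>xcells \<delta>. linked \<delta> J R}. measure \<mu> (xhits [] R))"
proof -
  let ?V = "stopping_words I F \<delta>" and ?B = "{R\<in>xcells \<delta>. linked \<delta> J R}"
  have fin: "finite ?V" "finite (xcells \<delta>)" using finite_stopping_F xcells_finite \<delta> by auto
  have "meeting_weight \<delta> J \<le> (\<Sum>w\<in>{w\<in>?V. meets w J}. \<Sum>R\<in>?B. word_weight p w * measure \<mu> (xhits w R))"
    unfolding meeting_weight_def
  proof (rule sum_mono)
    fix w assume w: "w \<in> {w\<in>?V. meets w J}"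
    then have wI: "set w \<subseteq> I" using stopping_subset by auto
    have "(\<Sum>R\<in>xcells \<delta>. measure \<mu> (xhits w R)) = (\<Sum>R\<in>?B. measure \<mu> (xhits w R))"
    proof (rule sum.mono_neutral_right)
      show "\<forall>R\<in>xcells \<delta> - ?B. measure \<mu> (xhits w R) = 0"
      proof
        fix R assume "R \<in> xcells \<delta> - ?B"
        then have "\<not> meets w R" using w by (auto simp: linked_def)
        then show "measure \<mu> (xhits w R) = 0" by (rule measure_xhits_not_meets)
      qed
    qed (use fin in auto)
    then have "1 \<le> (\<Sum>R\<in>?B. measure \<mu> (xhits w R))" using one_le_sum_xhits[OF wI \<delta>] by simp
    then have "word_weight p w * 1 \<le> word_weight p w * (\<Sum>R\<in>?B. measure \<mu> (xhits w R))"
      using weight_pos[OF wI] by (intro mult_left_mono) auto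
    then show "word_weight p w \<le> (\<Sum>R\<in>?B. word_weight p w * measure \<mu> (xhits w R))"
      by (simp add: sum_distrib_left)
  qed
  also have "\<dots> \<le> (\<Sum>w\<in>?V. \<Sum>R\<in>?B. word_weight p w * measure \<mu> (xhits w R))"
    using fin weight_pos[OF stopping_subset]
    by (intro sum_mono2) (auto intro!: sum_nonneg mult_nonneg_nonneg intro: less_imp_le)
  also have "\<dots> = (\<Sum>R\<in>?B. \<Sum>w\<in>?V. word_weight p w * measure \<mu> (xhits w R))" by (rule sum.swap)
  also have "\<dots> = (\<Sum>R\<in>?B. measure \<mu> (xhits [] R))"
    using measure_xhits_stopping[OF \<delta>] xcell_borel by (intro sum.cong) auto
  finally show ?thesis .
qed

lemma linked_sym: "linked \<delta> J R \<longleftrightarrow> linked \<delta> R J"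
  by (auto simp: linked_def)

lemma sum_meeting_weight:
  assumes q: "0 \<le> q"
  obtains C where "C > 0" "\<And>\<delta>. \<delta> > 0 \<Longrightarrow> (\<Sum>J\<in>xcells \<delta>. meeting_weight \<delta> J powr q) \<le> C * xsum q \<delta>"
proof -
  let ?N = "2 * nat \<lceil>2 * K + 1\<rceil> + 3"
  have "(\<Sum>J\<in>xcells \<delta>. meeting_weight \<delta> J powr q) \<le> (real ?N powr q * real ?N) * xsum q \<delta>" if \<delta>: "\<delta> > 0" for \<delta>
  proof -
    have "(\<Sum>J\<in>xcells \<delta>. meeting_weight \<delta> J powr q)
      \<le> real ?N powr q * (real ?N * (\<Sum>R\<in>xcells \<delta>. measure \<mu> (xhits [] R) powr q))"
    proof (rule sum_powr_compare[where R = "linked \<delta>"])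
      show "card {R \<in> xcells \<delta>. linked \<delta> J R} \<le> ?N" if "J \<in> xcells \<delta>" for J
        using card_linked[of J \<delta> \<delta>] that \<delta> by (simp add: linked_sym[of \<delta> J] mesh_meeting_def)
      show "card {J \<in> xcells \<delta>. linked \<delta> J R} \<le> ?N" if "R \<in> xcells \<delta>" for R
        using card_linked[of R \<delta> \<delta>] that \<delta> by (simp add: mesh_meeting_def)
    qed (use \<delta> q xcells_finite meeting_weight_nonneg meeting_weight_le in auto)
    then show ?thesis by (simp add: xsum_eq mult.assoc)
  qed
  then show ?thesis using that[of "real ?N powr q * real ?N"] by simp
qed

text \<open>The part of the mass of R carried by words meeting J. Parts for different J overlap,
  since a word may meet several J; each is at most the mass of R, and together they cover
  it.\<close>

definition meeting_sum :: "real \<Rightarrow> real set \<Rightarrow> real set \<Rightarrow> real" where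
  "meeting_sum \<delta> J R = (\<Sum>w\<in>{w\<in>stopping_words I F \<delta>. meets w J}. word_weight p w * measure \<mu> (xhits w R))"

lemma weight_measure_nonneg:
  "w \<in> stopping_words I H \<delta> \<Longrightarrow> 0 \<le> word_weight p w * measure \<mu> A"
  using weight_pos[OF stopping_subset] by (simp add: less_imp_le)

lemma meeting_sum_nonneg: "0 \<le> meeting_sum \<delta> J R"
  unfolding meeting_sum_def by (intro sum_nonneg weight_measure_nonneg) auto

lemma meeting_sum_le:
  assumes "\<delta> > 0" "R \<in> sets borel"
  shows "meeting_sum \<delta> J R \<le> measure \<mu> (xhits [] R)"
  unfolding meeting_sum_def measure_xhits_stopping[OF assms]
  using finite_stopping_F[OF assms(1)] by (intro sum_mono2 weight_measure_nonneg) auto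

lemma meeting_sum_unlinked:
  assumes "\<not> linked \<delta> J R"
  shows "meeting_sum \<delta> J R = 0"
  unfolding meeting_sum_def
proof (rule sum.neutral, rule ballI)
  fix w assume "w \<in> {w\<in>stopping_words I F \<delta>. meets w J}"
  then have "\<not> meets w R" using assms by (auto simp: linked_def)
  then show "word_weight p w * measure \<mu> (xhits w R) = 0" using measure_xhits_not_meets by simp
qed

lemma measure_le_meeting_sums:
  assumes \<delta>: "\<delta> > 0" and R: "R \<in> sets borel"
  shows "measure \<mu> (xhits [] R) \<le> (\<Sum>J\<in>{J\<in>xcells \<delta>. linked \<delta> J R}. meeting_sum \<delta> J R)"
proof -
  let ?V = "stopping_words I F \<delta>" and ?B = "{J\<in>xcells \<delta>. linked \<delta> J R}"
  let ?y = "\<lambda>w. word_weight p w * measure \<mu> (xhits w R)"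
  have fin: "finite ?V" "finite ?B" using finite_stopping_F xcells_finite \<delta> by auto
  have "measure \<mu> (xhits [] R) = (\<Sum>w\<in>?V. ?y w)" by (rule measure_xhits_stopping[OF assms])
  also have "\<dots> \<le> (\<Sum>w\<in>?V. \<Sum>J\<in>{J\<in>?B. meets w J}. ?y w)"
  proof (rule sum_mono)
    fix w assume w: "w \<in> ?V"
    show "?y w \<le> (\<Sum>J\<in>{J\<in>?B. meets w J}. ?y w)"
    proof (cases "meets w R")
      case True
      then obtain a where a: "a \<in> unit_square" unfolding meets_def by blast
      obtain J where J: "J \<in> xcells \<delta>" "word_map S w a $ 1 \<in> J"
        using xcell_cover[OF \<delta> stopping_subset[OF w] a] .
      then have "meets w J" using a unfolding meets_def by blast
      then have "J \<in> {J\<in>?B. meets w J}" using J w True by (auto simp: linked_def)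
      then show ?thesis
        using finite_subset[OF _ fin(2), of "{J\<in>?B. meets w J}"] weight_measure_nonneg[OF w]
        by (intro member_le_sum) auto
    qed (simp add: measure_xhits_not_meets)
  qed
  also have "\<dots> = (\<Sum>J\<in>?B. \<Sum>w\<in>{w\<in>?V. meets w J}. ?y w)"
    using fin by (rule sum.swap_restrict)
  finally show ?thesis by (simp only: meeting_sum_def)
qed

lemma meeting_sum_convex:
  assumes \<delta>: "\<delta> > 0" and q: "1 \<le> q"
  shows "meeting_sum \<delta> J R powr q \<le> meeting_weight \<delta> J powr (q - 1) *
    (\<Sum>w\<in>{w\<in>stopping_words I F \<delta>. meets w J}. word_weight p w * measure \<mu> (xhits w R) powr q)"
proof (cases "{w\<in>stopping_words I F \<delta>. meets w J} = {}")
  case True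
  then show ?thesis by (simp only: meeting_sum_def) simp
next
  case False
  have "0 < (\<Sum>w\<in>{w\<in>stopping_words I F \<delta>. meets w J}. word_weight p w)"
    using False finite_stopping_F[OF \<delta>] weight_pos[OF stopping_subset] by (intro sum_pos) auto
  then show ?thesis unfolding meeting_sum_def meeting_weight_def
    using weight_pos[OF stopping_subset] q
    by (intro weighted_sum_powr_convex) (auto intro: less_imp_le)
qed

lemma meeting_sum_concave:
  assumes \<delta>: "\<delta> > 0" and q: "0 \<le> q" "q \<le> 1"
  shows "meeting_weight \<delta> J powr (q - 1) *
    (\<Sum>w\<in>{w\<in>stopping_words I F \<delta>. meets w J}. word_weight p w * measure \<mu> (xhits w R) powr q)
     \<le> meeting_sum \<delta> J R powr q"
proof (cases "{w\<in>stopping_words I F \<delta>. meets w J} = {}")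
  case True
  then show ?thesis by (simp only: meeting_sum_def) simp
next
  case False
  have "0 < (\<Sum>w\<in>{w\<in>stopping_words I F \<delta>. meets w J}. word_weight p w)"
    using False finite_stopping_F[OF \<delta>] weight_pos[OF stopping_subset] by (intro sum_pos) auto
  then show ?thesis unfolding meeting_sum_def meeting_weight_def
    using weight_pos[OF stopping_subset] q finite_stopping_F[OF \<delta>]
    by (intro weighted_sum_powr_concave) (auto intro: less_imp_le)
qed

text \<open>Peres and Solomyak: the cells of the fine mesh are regrouped by the cells of the coarse mesh
  whose words they share, and Jensen's inequality is applied to the weights of these words.\<close>

lemma xsum_multiplicative:
  assumes q: "0 \<le> q"
  obtains C where "C > 0"
    "\<And>\<delta> \<rho>. 0 < \<delta> \<Longrightarrow> \<delta> \<le> 1 \<Longrightarrow> 0 < \<rho> \<Longrightarrow> \<rho> \<le> 1 \<Longrightarrow> 1 \<le> q \<Longrightarrow> xsum q (\<delta> * \<rho>) \<le> C * (xsum q \<delta> * xsum q \<rho>)"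
    "\<And>\<delta> \<rho>. 0 < \<delta> \<Longrightarrow> \<delta> \<le> 1 \<Longrightarrow> 0 < \<rho> \<Longrightarrow> \<rho> \<le> 1 \<Longrightarrow> q \<le> 1 \<Longrightarrow> xsum q \<delta> * xsum q \<rho> \<le> C * xsum q (\<delta> * \<rho>)"
proof -
  obtain \<kappa> where \<kappa>: "\<kappa> \<ge> 1" "\<And>\<delta> w. \<delta> \<le> 1 \<Longrightarrow> w \<in> stopping_words I F \<delta> \<Longrightarrow> \<delta> \<le> \<kappa> * F w"
    using stopping_words_comparable[OF F_qm finite_I] by blast
  obtain C1 where C1: "C1 > 0" "\<And>\<delta>. \<delta> > 0 \<Longrightarrow> (\<Sum>J\<in>xcells \<delta>. meeting_weight \<delta> J powr q) \<le> C1 * xsum q \<delta>"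
    using sum_meeting_weight[OF q] by blast
  obtain C2 where C2: "C2 > 0" and cmp: "\<And>w \<delta> \<rho>. set w \<subseteq> I \<Longrightarrow> 0 < \<delta> \<Longrightarrow> 0 < \<rho> \<Longrightarrow>
      \<delta> \<le> \<kappa> * (\<rho> * F w) \<Longrightarrow> \<rho> * F w \<le> \<kappa> * \<delta> \<Longrightarrow>
      pullback_sum \<mu> unit_square q (\<lambda>x. word_map S w x $ 1) \<delta> \<le> C2 * xsum q \<rho> \<and>
      xsum q \<rho> \<le> C2 * pullback_sum \<mu> unit_square q (\<lambda>x. word_map S w x $ 1) \<delta>"
    using xword_sum_compare[OF q \<kappa>(1)] by blast
  define N where "N = 2 * nat \<lceil>2 * K + 1\<rceil> + 3"
  have main: "(1 \<le> q \<longrightarrow> xsum q (\<delta> * \<rho>) \<le> real N powr q * C2 * C1 * (xsum q \<delta> * xsum q \<rho>)) \<and>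
      (q \<le> 1 \<longrightarrow> xsum q \<delta> * xsum q \<rho> \<le> C2 * real N * xsum q (\<delta> * \<rho>))"
    if \<delta>: "0 < \<delta>" "\<delta> \<le> 1" and \<rho>: "0 < \<rho>" "\<rho> \<le> 1" for \<delta> \<rho>
  proof -
    let ?V = "stopping_words I F \<delta>" and ?P = "meeting_weight \<delta>" and ?z = "meeting_sum \<delta>"
    have \<eta>: "0 < \<delta> * \<rho>" using \<delta> \<rho> by simp
    have card: "card {J\<in>xcells \<delta>. linked \<delta> J R} \<le> N" if "R \<in> xcells (\<delta> * \<rho>)" for R
      unfolding N_def using that \<delta> \<rho> by (intro card_linked[of R "\<delta> * \<rho>"]) (auto simp: mesh_meeting_def mult_left_le)
    have fin: "finite ?V" "finite (xcells \<delta>)" "finite (xcells (\<delta> * \<rho>))"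
      using finite_stopping_F xcells_finite \<delta> \<eta> by auto
    \<comment> \<open>A stopping word has width about \<delta>, so on its image the mesh size
      \<open>\<delta> * \<rho>\<close> amounts to the mesh size \<rho> on the whole
      projection.\<close>
    have word: "(\<Sum>R\<in>xcells (\<delta> * \<rho>). measure \<mu> (xhits w R) powr q) \<le> C2 * xsum q \<rho>"
      "xsum q \<rho> \<le> C2 * (\<Sum>R\<in>xcells (\<delta> * \<rho>). measure \<mu> (xhits w R) powr q)" if w: "w \<in> ?V" for w
    proof -
      have F: "F w \<le> \<delta>" "\<delta> \<le> \<kappa> * F w" using w \<kappa>(2) \<delta> by (auto simp: stopping_words_def)
      have "\<delta> * \<rho> \<le> \<kappa> * F w * \<rho>" using F \<rho> by (intro mult_right_mono) auto
      then have 1: "\<delta> * \<rho> \<le> \<kappa> * (\<rho> * F w)" by (simp add: ac_simps)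
      have "\<rho> * F w \<le> 1 * (\<delta> * \<rho>)" using F \<rho> by simp
      also have "\<dots> \<le> \<kappa> * (\<delta> * \<rho>)" using \<kappa>(1) \<eta> by (intro mult_right_mono) auto
      finally show "(\<Sum>R\<in>xcells (\<delta> * \<rho>). measure \<mu> (xhits w R) powr q) \<le> C2 * xsum q \<rho>"
        "xsum q \<rho> \<le> C2 * (\<Sum>R\<in>xcells (\<delta> * \<rho>). measure \<mu> (xhits w R) powr q)"
        using cmp[OF stopping_subset[OF w] \<eta> \<rho>(1) 1] xword_sum_eq[OF stopping_subset[OF w] \<eta>] by auto
    qed
    have swap: "(\<Sum>R\<in>xcells (\<delta> * \<rho>). ?P J powr (q - 1) *
        (\<Sum>w\<in>{w\<in>?V. meets w J}. word_weight p w * measure \<mu> (xhits w R) powr q)) =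
      ?P J powr (q - 1) * (\<Sum>w\<in>{w\<in>?V. meets w J}. word_weight p w *
        (\<Sum>R\<in>xcells (\<delta> * \<rho>). measure \<mu> (xhits w R) powr q))" for J
      unfolding sum_distrib_left by (subst sum.swap) simp
    \<comment> \<open>If the weight is 0, both sides vanish because
      \<open>0 powr q = 0\<close>.\<close>
    have P_powr: "?P J powr (q - 1) * (?P J * x) = ?P J powr q * x" for J x
    proof (cases "?P J = 0")
      case False
      then have "?P J > 0" using meeting_weight_nonneg[of \<delta> J] by simp
      then show ?thesis by (simp add: powr_diff)
    qed simp
    have T\<rho>: "0 \<le> xsum q \<rho>" by (rule pullback_sum_nonneg)
    show ?thesis
    proof (intro conjI impI)
      assume q1: "1 \<le> q"
      have "xsum q (\<delta> * \<rho>) \<le> (\<Sum>R\<in>xcells (\<delta> * \<rho>). real N powr q * (\<Sum>J\<in>xcells \<delta>. ?z J R powr q))"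
        unfolding xsum_eq[of q "\<delta> * \<rho>"]
      proof (rule sum_mono)
        fix R assume R: "R \<in> xcells (\<delta> * \<rho>)"
        have "measure \<mu> (xhits [] R) powr q \<le> (\<Sum>J\<in>{J\<in>xcells \<delta>. linked \<delta> J R}. ?z J R) powr q"
          using measure_le_meeting_sums[OF \<delta>(1) xcell_borel[OF R]] q by (intro powr_mono2) auto
        also have "\<dots> \<le> real N powr q * (\<Sum>J\<in>{J\<in>xcells \<delta>. linked \<delta> J R}. ?z J R powr q)"
          using fin card[OF R] q meeting_sum_nonneg by (intro powr_sum_le_card) auto
        also have "\<dots> \<le> real N powr q * (\<Sum>J\<in>xcells \<delta>. ?z J R powr q)"
          using fin by (intro mult_left_mono sum_mono2) auto
        finally show "measure \<mu> (xhits [] R) powr q \<le> real N powr q * (\<Sum>J\<in>xcells \<delta>. ?z J R powr q)" .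
      qed
      also have "\<dots> = real N powr q * (\<Sum>J\<in>xcells \<delta>. \<Sum>R\<in>xcells (\<delta> * \<rho>). ?z J R powr q)"
        unfolding sum_distrib_left[symmetric] by (subst sum.swap) simp
      \<comment> \<open>For fixed J, Jensen's inequality moves the power inside the sum over words.
        Every word then contributes the same multiple of \<open>xsum q \<rho>\<close>, and the
        remaining weights recombine to \<open>?P J powr q\<close>.\<close>
      also have "\<dots> \<le> real N powr q * (\<Sum>J\<in>xcells \<delta>. C2 * xsum q \<rho> * ?P J powr q)"
      proof (intro mult_left_mono sum_mono)
        fix J assume "J \<in> xcells \<delta>"
        have "(\<Sum>R\<in>xcells (\<delta> * \<rho>). ?z J R powr q) \<le> (\<Sum>R\<in>xcells (\<delta> * \<rho>). ?P J powr (q - 1) *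
          (\<Sum>w\<in>{w\<in>?V. meets w J}. word_weight p w * measure \<mu> (xhits w R) powr q))"
          by (intro sum_mono meeting_sum_convex \<delta> q1)
        also have "\<dots> \<le> ?P J powr (q - 1) * (\<Sum>w\<in>{w\<in>?V. meets w J}. word_weight p w * (C2 * xsum q \<rho>))"
          unfolding swap using word(1) weight_pos[OF stopping_subset]
          by (intro mult_left_mono sum_mono) (auto intro: less_imp_le)
        also have "\<dots> = ?P J powr (q - 1) * (?P J * (C2 * xsum q \<rho>))"
          by (simp only: meeting_weight_def sum_distrib_right)
        also have "\<dots> = C2 * xsum q \<rho> * ?P J powr q" unfolding P_powr by simp
        finally show "(\<Sum>R\<in>xcells (\<delta> * \<rho>). ?z J R powr q) \<le> C2 * xsum q \<rho> * ?P J powr q" .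
      qed simp
      also have "\<dots> = real N powr q * C2 * xsum q \<rho> * (\<Sum>J\<in>xcells \<delta>. ?P J powr q)"
        by (simp add: sum_distrib_left mult.assoc)
      also have "\<dots> \<le> real N powr q * C2 * xsum q \<rho> * (C1 * xsum q \<delta>)"
        using C1(2)[OF \<delta>(1)] C2 T\<rho> by (intro mult_left_mono) auto
      finally show "xsum q (\<delta> * \<rho>) \<le> real N powr q * C2 * C1 * (xsum q \<delta> * xsum q \<rho>)" by (simp add: ac_simps)
    next
      assume q1: "q \<le> 1"
      \<comment> \<open>For \<open>q \<le> 1\<close> the chain runs in the opposite direction: the
        coarse masses are first bounded by weights, and then the concave form of Jensen's inequality
        applies.\<close>
      have "xsum q \<delta> * xsum q \<rho> \<le> (\<Sum>J\<in>xcells \<delta>. ?P J powr q) * xsum q \<rho>"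
        unfolding xsum_eq[of q \<delta>] using measure_le_meeting_weight[OF \<delta>(1)] xcell_borel q T\<rho>
        by (intro mult_right_mono sum_mono powr_mono2) auto
      also have "\<dots> = (\<Sum>J\<in>xcells \<delta>. ?P J powr (q - 1) *
          (\<Sum>w\<in>{w\<in>?V. meets w J}. word_weight p w * xsum q \<rho>))"
        unfolding sum_distrib_right[symmetric] meeting_weight_def[symmetric] P_powr ..
      also have "\<dots> \<le> (\<Sum>J\<in>xcells \<delta>. ?P J powr (q - 1) * (\<Sum>w\<in>{w\<in>?V. meets w J}. word_weight p w *
        (C2 * (\<Sum>R\<in>xcells (\<delta> * \<rho>). measure \<mu> (xhits w R) powr q))))"
        using word(2) weight_pos[OF stopping_subset]
        by (intro sum_mono mult_left_mono) (auto intro: less_imp_le)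
      also have "\<dots> = (\<Sum>J\<in>xcells \<delta>. C2 * (?P J powr (q - 1) * (\<Sum>w\<in>{w\<in>?V. meets w J}. word_weight p w *
        (\<Sum>R\<in>xcells (\<delta> * \<rho>). measure \<mu> (xhits w R) powr q))))"
        by (simp add: sum_distrib_left ac_simps)
      also have "\<dots> = C2 * (\<Sum>J\<in>xcells \<delta>. \<Sum>R\<in>xcells (\<delta> * \<rho>). ?P J powr (q - 1) *
        (\<Sum>w\<in>{w\<in>?V. meets w J}. word_weight p w * measure \<mu> (xhits w R) powr q))"
        unfolding swap by (rule sum_distrib_left[symmetric])
      also have "\<dots> \<le> C2 * (\<Sum>J\<in>xcells \<delta>. \<Sum>R\<in>xcells (\<delta> * \<rho>). ?z J R powr q)"
        using C2 by (intro mult_left_mono sum_mono meeting_sum_concave \<delta> q q1) auto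
      also have "\<dots> = C2 * (\<Sum>R\<in>xcells (\<delta> * \<rho>). \<Sum>J\<in>xcells \<delta>. ?z J R powr q)"
        by (subst sum.swap) simp
      \<comment> \<open>Each part \<open>?z J R\<close> is at most the mass of R and vanishes unless
        J is one of the at most N cells linked to R.\<close>
      also have "\<dots> \<le> C2 * (\<Sum>R\<in>xcells (\<delta> * \<rho>). real N * measure \<mu> (xhits [] R) powr q)"
      proof (intro mult_left_mono sum_mono)
        fix R assume R: "R \<in> xcells (\<delta> * \<rho>)"
        have "(\<Sum>J\<in>xcells \<delta>. ?z J R powr q) = (\<Sum>J\<in>{J\<in>xcells \<delta>. linked \<delta> J R}. ?z J R powr q)"
          using fin by (intro sum.mono_neutral_right) (auto simp: meeting_sum_unlinked)
        also have "\<dots> \<le> real (card {J\<in>xcells \<delta>. linked \<delta> J R}) * measure \<mu> (xhits [] R) powr q"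
          using meeting_sum_le[OF \<delta>(1) xcell_borel[OF R]] q meeting_sum_nonneg
          by (intro sum_bounded_above powr_mono2) auto
        also have "\<dots> \<le> real N * measure \<mu> (xhits [] R) powr q"
          using card[OF R] by (intro mult_right_mono) auto
        finally show "(\<Sum>J\<in>xcells \<delta>. ?z J R powr q) \<le> real N * measure \<mu> (xhits [] R) powr q" .
      qed (use C2 in simp)
      finally show "xsum q \<delta> * xsum q \<rho> \<le> C2 * real N * xsum q (\<delta> * \<rho>)"
        unfolding xsum_eq[of q "\<delta> * \<rho>"] by (simp add: sum_distrib_left mult.assoc)
    qed
  qed
  define C where "C = real N powr q * C2 * C1 + C2 * real N"
  have N: "real N > 0" by (simp add: N_def)
  have C: "C > 0" unfolding C_def using C1(1) C2 N by (intro add_pos_pos mult_pos_pos) auto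
  show ?thesis
  proof (rule that[OF C])
    fix \<delta> \<rho> :: real assume *: "0 < \<delta>" "\<delta> \<le> 1" "0 < \<rho>" "\<rho> \<le> 1"
    note nn = pullback_sum_nonneg[of \<mu> unit_square q "\<lambda>x. x $ 1"]
    show "xsum q (\<delta> * \<rho>) \<le> C * (xsum q \<delta> * xsum q \<rho>)" if "1 \<le> q"
    proof -
      have "xsum q (\<delta> * \<rho>) \<le> real N powr q * C2 * C1 * (xsum q \<delta> * xsum q \<rho>)" using main[OF *] that by blast
      also have "\<dots> \<le> C * (xsum q \<delta> * xsum q \<rho>)"
        unfolding C_def using C2 N nn by (intro mult_right_mono) auto
      finally show ?thesis .
    qed
    show "xsum q \<delta> * xsum q \<rho> \<le> C * xsum q (\<delta> * \<rho>)" if "q \<le> 1"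
    proof -
      have "xsum q \<delta> * xsum q \<rho> \<le> C2 * real N * xsum q (\<delta> * \<rho>)" using main[OF *] that by blast
      also have "\<dots> \<le> C * xsum q (\<delta> * \<rho>)"
        unfolding C_def using C1 C2 N nn by (intro mult_right_mono) auto
      finally show ?thesis .
    qed
  qed
qed

end

section \<open>The exponent of the projected measure\<close>

lemma linear_growth_bound:
  fixes x :: "nat \<Rightarrow> real"
  assumes "(\<lambda>n. x n / real n) \<longlonglongrightarrow> \<beta>" "\<epsilon> > 0"
  shows "\<exists>D. \<forall>n. \<bar>x n - real n * \<beta>\<bar> \<le> \<epsilon> * real n + D"
proof -
  obtain N where N: "\<And>n. n \<ge> N \<Longrightarrow> \<bar>x n / real n - \<beta>\<bar> < \<epsilon>"
    using LIMSEQ_D[OF assms] by auto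
  define D where "D = (\<Sum>n\<in>{..N}. \<bar>x n - real n * \<beta>\<bar>)"
  have D: "0 \<le> D" unfolding D_def by (intro sum_nonneg) auto
  have "\<bar>x n - real n * \<beta>\<bar> \<le> \<epsilon> * real n + D" for n
  proof (cases "n \<le> N")
    case True
    then have "\<bar>x n - real n * \<beta>\<bar> \<le> D" unfolding D_def by (intro member_le_sum) auto
    moreover have "0 \<le> \<epsilon> * real n" using assms by simp
    ultimately show ?thesis by linarith
  next
    case False
    then have n: "real n > 0" by simp
    have "\<bar>x n - real n * \<beta>\<bar> = real n * \<bar>x n / real n - \<beta>\<bar>"
      using n by (simp add: abs_mult_pos' right_diff_distrib)
    also have "\<dots> \<le> real n * \<epsilon>" using N[of n] False n by (intro mult_left_mono) auto
    finally show ?thesis using D by (simp add: mult.commute)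
  qed
  then show ?thesis by blast
qed

lemma has_lq_spectrum_unique:
  assumes "has_lq_spectrum \<nu> q t"
  shows "lq_spectrum \<nu> q = t"
  using assms unfolding lq_spectrum_def by (intro the_equality) (auto simp: has_lq_spectrum_def)

lemma Liminf_le_Limsup_at_right:
  fixes x :: "real \<Rightarrow> ereal"
  shows "Liminf (at_right 0) x \<le> Limsup (at_right 0) x"
  by (rule Liminf_le_Limsup) simp

context ifs_geometry
begin

text \<open>Along the scales \<open>exp (- n)\<close> products of scales become sums of indices. For
  \<open>q \<ge> 1\<close> the logarithm of the moment sum, and for \<open>q < 1\<close> its
  negative, is subadditive after adding \<open>ln C\<close>.\<close>

lemma xsum_log_limit:
  assumes q: "0 \<le> q"
  shows "\<exists>\<beta>. (\<lambda>n. ln (xsum q (exp (- real n))) / real n) \<longlonglongrightarrow> \<beta>"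
proof -
  define T where "T n = xsum q (exp (- real n))" for n
  obtain C where C: "C > 0"
    "\<And>\<delta> \<rho>. 0 < \<delta> \<Longrightarrow> \<delta> \<le> 1 \<Longrightarrow> 0 < \<rho> \<Longrightarrow> \<rho> \<le> 1 \<Longrightarrow> 1 \<le> q \<Longrightarrow> xsum q (\<delta> * \<rho>) \<le> C * (xsum q \<delta> * xsum q \<rho>)"
    "\<And>\<delta> \<rho>. 0 < \<delta> \<Longrightarrow> \<delta> \<le> 1 \<Longrightarrow> 0 < \<rho> \<Longrightarrow> \<rho> \<le> 1 \<Longrightarrow> q \<le> 1 \<Longrightarrow> xsum q \<delta> * xsum q \<rho> \<le> C * xsum q (\<delta> * \<rho>)"
    using xsum_multiplicative[OF q] by blast
  have T: "0 < T n" "T n \<le> 7 * exp (real n)" "1 \<le> (7 * exp (real n)) powr q * T n" for n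
    using xsum_pos[OF q, of "exp (- real n)"] xsum_upper[OF q, of "exp (- real n)"]
      xsum_lower[OF q, of "exp (- real n)"] by (auto simp: T_def exp_minus field_simps)
  have e: "exp (- real (m + n)) = exp (- real m) * exp (- real n)" for m n :: nat
    by (simp flip: exp_add)
  have const: "(\<lambda>n. ln C / real n) \<longlonglongrightarrow> 0" by (rule lim_const_over_n)
  show ?thesis
  proof (cases "1 \<le> q")
    case True
    define a where "a n = ln (T n) + ln C" for n
    have sub: "a (m + n) \<le> a m + a n" for m n
    proof -
      have "T (m + n) \<le> C * (T m * T n)" unfolding T_def e using C(2) True by simp
      then have "ln (T (m + n)) \<le> ln (C * (T m * T n))" using T C(1) by simp
      also have "\<dots> = ln C + (ln (T m) + ln (T n))" using T[of m] T[of n] C(1) by (simp add: ln_mult)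
      finally show ?thesis by (simp add: a_def)
    qed
    have low: "- (q * ln 7 + q + \<bar>ln C\<bar>) * real n \<le> a n" for n
    proof (cases "n = 0")
      case True
      then show ?thesis using sub[of 0 0] by simp
    next
      case False
      have "0 \<le> ln ((7 * exp (real n)) powr q * T n)" using T(3)[of n] by simp
      also have "\<dots> = q * (ln 7 + real n) + ln (T n)" using T(1)[of n] by (simp add: ln_mult ln_powr)
      finally have 1: "- (q * ln 7) - q * real n - \<bar>ln C\<bar> \<le> a n" by (simp add: a_def algebra_simps)
      have "(q * ln 7 + \<bar>ln C\<bar>) * 1 \<le> (q * ln 7 + \<bar>ln C\<bar>) * real n"
        using False q by (intro mult_left_mono add_nonneg_nonneg) auto
      then show ?thesis using 1 by (simp add: algebra_simps)
    qed
    obtain L where L: "(\<lambda>n. a n / real n) \<longlonglongrightarrow> L" using fekete[OF sub low] by blast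
    have "(\<lambda>n. a n / real n - ln C / real n) \<longlonglongrightarrow> L - 0" by (intro tendsto_diff L const)
    then show ?thesis by (auto simp: a_def T_def add_divide_distrib)
  next
    case False
    define a where "a n = ln C - ln (T n)" for n
    have sub: "a (m + n) \<le> a m + a n" for m n
    proof -
      have "T m * T n \<le> C * T (m + n)" unfolding T_def e using C(3) False by simp
      then have "ln (T m * T n) \<le> ln (C * T (m + n))" using T C(1) by simp
      then have "ln (T m) + ln (T n) \<le> ln C + ln (T (m + n))"
        using T[of m] T[of n] T[of "m + n"] C(1) by (simp add: ln_mult)
      then show ?thesis by (simp add: a_def)
    qed
    have low: "- (ln 7 + 1 + \<bar>ln C\<bar>) * real n \<le> a n" for n
    proof (cases "n = 0")
      case True
      then show ?thesis using sub[of 0 0] by simp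
    next
      case False
      have "ln (T n) \<le> ln (7 * exp (real n))" using T(1,2)[of n] by (subst ln_le_cancel_iff) auto
      also have "\<dots> = ln 7 + real n" by (simp add: ln_mult)
      finally have 1: "- ln 7 - real n - \<bar>ln C\<bar> \<le> a n" by (simp add: a_def)
      have "(ln 7 + \<bar>ln C\<bar>) * 1 \<le> (ln 7 + \<bar>ln C\<bar>) * real n"
        using False by (intro mult_left_mono add_nonneg_nonneg) auto
      then show ?thesis using 1 by (simp add: algebra_simps)
    qed
    obtain L where L: "(\<lambda>n. a n / real n) \<longlonglongrightarrow> L" using fekete[OF sub low] by blast
    have "(\<lambda>n. ln C / real n - a n / real n) \<longlonglongrightarrow> 0 - L" by (intro tendsto_diff L const)
    then show ?thesis by (auto simp: a_def T_def diff_divide_distrib)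
  qed
qed

text \<open>The bounds are extended from geometric scales to all \<rho> up to \<kappa>, not only up
  to 1, because the rescaled mesh sizes \<open>\<delta> / F w\<close> may exceed 1.\<close>

lemma xsum_growth:
  assumes q: "0 \<le> q"
  shows "\<exists>\<beta>. \<forall>\<epsilon>>0. \<forall>\<kappa>\<ge>1. \<exists>C>0. \<forall>\<rho>. 0 < \<rho> \<and> \<rho> \<le> \<kappa> \<longrightarrow>
    xsum q \<rho> \<le> C * \<rho> powr (- (\<beta> + \<epsilon>)) \<and> \<rho> powr (- (\<beta> - \<epsilon>)) \<le> C * xsum q \<rho>"
proof -
  obtain \<beta> where \<beta>: "(\<lambda>n. ln (xsum q (exp (- real n))) / real n) \<longlonglongrightarrow> \<beta>"
    using xsum_log_limit[OF q] by blast
  show ?thesis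
  proof (rule exI[of _ \<beta>], intro allI impI)
    fix \<epsilon> \<kappa> :: real assume \<epsilon>: "\<epsilon> > 0" and \<kappa>: "1 \<le> \<kappa>"
    obtain D where D: "\<And>n. \<bar>ln (xsum q (exp (- real n))) - real n * \<beta>\<bar> \<le> \<epsilon> * real n + D"
      using linear_growth_bound[OF \<beta> \<epsilon>] by blast
    \<comment> \<open>The factor \<open>exp 1\<close> covers rounding to a geometric scale when
      \<open>\<rho> \<le> 1\<close>. The factor \<kappa> covers \<open>1 < \<rho>\<close>, where
      \<open>nat\<close> cuts off a negative value and \<open>n = 0\<close>.\<close>
    define k where "k = exp 1 * \<kappa>"
    have "1 * 1 \<le> exp 1 * \<kappa>" using \<kappa> by (intro mult_mono) auto
    then have k: "1 \<le> k" by (simp add: k_def)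
    obtain C1 where C1: "C1 > 0" "\<And>\<delta> \<rho>. 0 < \<delta> \<Longrightarrow> 0 < \<rho> \<Longrightarrow> \<delta> \<le> k * \<rho> \<Longrightarrow> \<rho> \<le> k * \<delta> \<Longrightarrow>
      xsum q \<delta> \<le> C1 * xsum q \<rho>" using xsum_compare[OF q k] by blast
    define C2 where "C2 = k powr \<bar>\<beta> + \<epsilon>\<bar> + k powr \<bar>\<beta> - \<epsilon>\<bar>"
    have C2: "k powr \<bar>- (\<beta> + \<epsilon>)\<bar> \<le> C2" "k powr \<bar>- (\<beta> - \<epsilon>)\<bar> \<le> C2" "0 < C2"
      unfolding abs_minus_cancel using k by (auto simp: C2_def add_pos_pos)
    define C where "C = C1 * exp D * C2"
    have "xsum q \<rho> \<le> C * \<rho> powr (- (\<beta> + \<epsilon>)) \<and> \<rho> powr (- (\<beta> - \<epsilon>)) \<le> C * xsum q \<rho>"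
      if \<rho>: "0 < \<rho>" "\<rho> \<le> \<kappa>" for \<rho>
    proof -
      define n where "n = nat \<lfloor>- ln \<rho>\<rfloor>"
      define r where "r = exp (- real n)"
      have r: "0 < r" "r \<le> 1" "ln r = - real n" by (auto simp: r_def)
      have \<rho>r: "\<rho> \<le> k * r" "r \<le> k * \<rho>"
      proof -
        have e: "ln (k * r) = 1 + ln \<kappa> - real n" "ln (k * \<rho>) = 1 + ln \<kappa> + ln \<rho>"
          using \<rho> \<kappa> r by (simp_all add: k_def ln_mult)
        have "ln \<rho> \<le> ln (k * r) \<and> ln r \<le> ln (k * \<rho>)"
        proof (cases "\<rho> \<le> 1")
          case True
          then have "0 \<le> - ln \<rho>" using \<rho> by simp
          then have "real n \<le> - ln \<rho>" "- ln \<rho> \<le> real n + 1" unfolding n_def by linarith+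
          moreover have "0 \<le> ln \<kappa>" using \<kappa> by simp
          ultimately show ?thesis unfolding e r(3) by linarith
        next
          case False
          then have "- ln \<rho> < 0" by simp
          then have "n = 0" unfolding n_def by linarith
          then have "real n = 0" by simp
          moreover have "ln \<rho> \<le> ln \<kappa>" "0 \<le> ln \<kappa>" "0 \<le> ln \<rho>" using \<rho> False \<kappa> by auto
          ultimately show ?thesis unfolding e r(3) by linarith
        qed
        then show "\<rho> \<le> k * r" "r \<le> k * \<rho>" using \<rho>(1) r(1) k by auto
      qed
      have T: "0 < xsum q r" using r q by (intro xsum_pos)
      have b: "\<bar>ln (xsum q r) - real n * \<beta>\<bar> \<le> \<epsilon> * real n + D" unfolding r_def by (rule D)
      have "xsum q r = exp (ln (xsum q r))" using T by simp
      also have "\<dots> \<le> exp (D + (\<beta> + \<epsilon>) * real n)" using b by (simp add: algebra_simps)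
      also have "\<dots> = exp D * r powr (- (\<beta> + \<epsilon>))" using r by (simp add: exp_add powr_def) (simp add: algebra_simps)
      also have "\<dots> \<le> exp D * (k powr \<bar>- (\<beta> + \<epsilon>)\<bar> * \<rho> powr (- (\<beta> + \<epsilon>)))"
        by (intro mult_left_mono powr_between r \<rho> k \<rho>r) auto
      also have "\<dots> \<le> exp D * (C2 * \<rho> powr (- (\<beta> + \<epsilon>)))"
        by (intro mult_left_mono mult_right_mono C2) auto
      finally have "C1 * xsum q r \<le> C1 * (exp D * (C2 * \<rho> powr (- (\<beta> + \<epsilon>))))"
        using C1 by (intro mult_left_mono) auto
      then have 1: "xsum q \<rho> \<le> C * \<rho> powr (- (\<beta> + \<epsilon>))"
        using C1(2)[OF \<rho>(1) r(1) \<rho>r] by (simp add: C_def ac_simps)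
      have "\<rho> powr (- (\<beta> - \<epsilon>)) \<le> k powr \<bar>- (\<beta> - \<epsilon>)\<bar> * r powr (- (\<beta> - \<epsilon>))"
        by (intro powr_between r \<rho> k \<rho>r)
      also have "\<dots> \<le> C2 * r powr (- (\<beta> - \<epsilon>))" by (intro mult_right_mono C2) auto
      also have "r powr (- (\<beta> - \<epsilon>)) = exp ((\<beta> - \<epsilon>) * real n)"
        using r by (simp add: powr_def) (simp add: algebra_simps)
      also have "\<dots> \<le> exp (D + ln (xsum q r))" using b by (simp add: algebra_simps)
      also have "\<dots> = exp D * xsum q r" using T by (simp add: exp_add)
      also have "\<dots> \<le> exp D * (C1 * xsum q \<rho>)"
        using C1(2)[OF r(1) \<rho>(1) \<rho>r(2,1)] by (intro mult_left_mono) auto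
      finally have "\<rho> powr (- (\<beta> - \<epsilon>)) \<le> C * xsum q \<rho>"
        using C2(3) by (simp add: C_def ac_simps)
      with 1 show ?thesis by blast
    qed
    moreover have "C > 0" unfolding C_def using C1 C2 by simp
    ultimately show "\<exists>C>0. \<forall>\<rho>. 0 < \<rho> \<and> \<rho> \<le> \<kappa> \<longrightarrow>
      xsum q \<rho> \<le> C * \<rho> powr (- (\<beta> + \<epsilon>)) \<and> \<rho> powr (- (\<beta> - \<epsilon>)) \<le> C * xsum q \<rho>" by blast
  qed
qed

lemma proj_lq_sum: "\<delta> > 0 \<Longrightarrow> lq_sum (distr \<mu> borel (\<lambda>x. x $ 1)) q \<delta> = xsum q \<delta>"
  by (intro lq_sum_distr_eq_pullback_sum prob_\<mu> sets_\<mu> \<mu>_square compact_cbox)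
    (auto intro!: continuous_intros borel_measurable_continuous_onI)

text \<open>Power bounds with arbitrarily small loss force the upper and lower spectrum of the
  projection to equal the exponent found above. So the description in \<open>proj_spectrum\<close>
  denotes that exponent, and the bounds hold for \<open>proj_spectrum\<close> itself.\<close>

lemma xsum_proj_spectrum:
  assumes q: "0 \<le> q" and "\<epsilon> > 0" "1 \<le> \<kappa>"
  obtains C where "C > 0" "\<And>\<rho>. 0 < \<rho> \<Longrightarrow> \<rho> \<le> \<kappa> \<Longrightarrow> xsum q \<rho> \<le> C * \<rho> powr (- (proj_spectrum \<mu> q + \<epsilon>))"
    "\<And>\<rho>. 0 < \<rho> \<Longrightarrow> \<rho> \<le> \<kappa> \<Longrightarrow> \<rho> powr (- (proj_spectrum \<mu> q - \<epsilon>)) \<le> C * xsum q \<rho>"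
proof -
  obtain \<beta> where \<beta>: "\<And>\<epsilon> \<kappa>. \<epsilon> > 0 \<Longrightarrow> \<kappa> \<ge> 1 \<Longrightarrow> \<exists>C>0. \<forall>\<rho>. 0 < \<rho> \<and> \<rho> \<le> \<kappa> \<longrightarrow>
    xsum q \<rho> \<le> C * \<rho> powr (- (\<beta> + \<epsilon>)) \<and> \<rho> powr (- (\<beta> - \<epsilon>)) \<le> C * xsum q \<rho>"
    using xsum_growth[OF q] by meson
  let ?\<nu> = "distr \<mu> borel (\<lambda>x. x $ 1)"
  have "upper_lq_spectrum ?\<nu> q \<le> ereal \<beta>" unfolding upper_lq_spectrum_def
  proof (rule Limsup_log_ratio_le)
    fix \<epsilon> :: real assume "\<epsilon> > 0"
    from \<beta>[OF this order_refl] show "\<exists>C>0. \<forall>\<delta>. 0 < \<delta> \<and> \<delta> < 1 \<longrightarrow>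
        0 < lq_sum ?\<nu> q \<delta> \<and> lq_sum ?\<nu> q \<delta> \<le> C * \<delta> powr (- (\<beta> + \<epsilon>))"
      using xsum_pos[OF q] by (auto simp: proj_lq_sum)
  qed
  moreover have "ereal \<beta> \<le> lower_lq_spectrum ?\<nu> q" unfolding lower_lq_spectrum_def
  proof (rule Liminf_log_ratio_ge)
    fix \<epsilon> :: real assume "\<epsilon> > 0"
    from \<beta>[OF this order_refl] obtain C where C: "C > 0"
      "\<And>\<rho>. 0 < \<rho> \<Longrightarrow> \<rho> \<le> 1 \<Longrightarrow> \<rho> powr (- (\<beta> - \<epsilon>)) \<le> C * xsum q \<rho>" by blast
    then have "1 / C > 0" "\<And>\<delta>. 0 < \<delta> \<Longrightarrow> \<delta> < 1 \<Longrightarrow> 1 / C * \<delta> powr (- (\<beta> - \<epsilon>)) \<le> lq_sum ?\<nu> q \<delta>"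
      by (auto simp: proj_lq_sum field_simps)
    then show "\<exists>C>0. \<forall>\<delta>. 0 < \<delta> \<and> \<delta> < 1 \<longrightarrow> C * \<delta> powr (- (\<beta> - \<epsilon>)) \<le> lq_sum ?\<nu> q \<delta>" by blast
  qed
  moreover have "lower_lq_spectrum ?\<nu> q \<le> upper_lq_spectrum ?\<nu> q"
    unfolding lower_lq_spectrum_def upper_lq_spectrum_def by (rule Liminf_le_Limsup_at_right)
  ultimately have "has_lq_spectrum ?\<nu> q \<beta>" unfolding has_lq_spectrum_def by (auto intro: antisym order_trans)
  then have "proj_spectrum \<mu> q = \<beta>" unfolding proj_spectrum_def by (rule has_lq_spectrum_unique)
  then show ?thesis using \<beta>[OF assms(2,3)] that by metis
qed

section \<open>Sums of the potential and moment sums of stopping words\<close>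

definition potential :: "real \<Rightarrow> real \<Rightarrow> 'i list \<Rightarrow> real" where
  "potential q s w = word_weight p w powr q * F w powr proj_spectrum \<mu> q * G w powr (s - proj_spectrum \<mu> q)"

lemma potential_qm:
  "\<exists>B\<ge>1. quasi_multiplicative I B (potential q s)"
proof -
  have "quasi_multiplicative I (1 powr \<bar>q\<bar> * K powr \<bar>proj_spectrum \<mu> q\<bar> * K powr \<bar>s - proj_spectrum \<mu> q\<bar>) (potential q s)"
    unfolding potential_def
    by (intro quasi_multiplicative_mult quasi_multiplicative_powr quasi_multiplicative_weight F_qm G_qm p_pos)
  then show ?thesis using quasi_multiplicativeD(1) by blast
qed

text \<open>The moment sum that the measure would have if the images of different stopping words
  never shared a cell.\<close>

definition word_sum :: "real \<Rightarrow> real \<Rightarrow> real" where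
  "word_sum q \<delta> = (\<Sum>w\<in>stopping_words I G \<delta>. word_weight p w powr q * pullback_sum \<mu> unit_square q (word_map S w) \<delta>)"

text \<open>With \<open>\<rho> = \<delta> / F w\<close>, the power
  \<open>\<rho> powr (- \<beta>)\<close> equals \<open>F w powr \<beta> * \<delta> powr (\<gamma> -
  \<beta>) * \<delta> powr (- \<gamma>)\<close>, and on the stopping set
  \<open>\<delta> powr (\<gamma> - \<beta>)\<close> is comparable with
  \<open>G w powr (\<gamma> - \<beta>)\<close>. This produces the potential, whose sum over the
  stopping set is bounded from both sides.\<close>

lemma word_sum_bounds:
  assumes q: "0 \<le> q" and B: "\<And>n. 1 / B \<le> (\<Sum>w\<in>words I n. potential q \<gamma> w)"
    "\<And>n. (\<Sum>w\<in>words I n. potential q \<gamma> w) \<le> B" and \<epsilon>: "\<epsilon> > 0"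
  obtains C where "C > 0" "\<And>\<delta>. 0 < \<delta> \<Longrightarrow> \<delta> < 1 \<Longrightarrow> word_sum q \<delta> \<le> C * \<delta> powr (- (\<gamma> + \<epsilon>))"
    "\<And>\<delta>. 0 < \<delta> \<Longrightarrow> \<delta> < 1 \<Longrightarrow> \<delta> powr (- (\<gamma> - \<epsilon>)) \<le> C * word_sum q \<delta>"
proof -
  let ?\<beta> = "proj_spectrum \<mu> q"
  obtain B' where B': "B' \<ge> 1" "quasi_multiplicative I B' (potential q \<gamma>)" using potential_qm by blast
  define A where "A = max B B'"
  have A1: "1 \<le> A" "B \<le> A" "B' \<le> A" using B' by (auto simp: A_def)
  have "0 < B"
  proof (rule ccontr)
    assume "\<not> 0 < B"
    moreover have "0 < (\<Sum>w\<in>words I 0. potential q \<gamma> w)"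
      using quasi_multiplicativeD(2)[OF B'(2), of "[]"] by simp
    ultimately show False using B(2)[of 0] by linarith
  qed
  then have "1 / A \<le> 1 / B" using A1 by (simp add: frac_le)
  then have A2: "1 / A \<le> (\<Sum>w\<in>words I n. potential q \<gamma> w) \<and> (\<Sum>w\<in>words I n. potential q \<gamma> w) \<le> A" for n
    using B[of n] A1 by linarith
  have A3: "quasi_multiplicative I A (potential q \<gamma>)" using B'(2) A1(3) by (rule quasi_multiplicative_mono)
  obtain \<kappa> where \<kappa>: "\<kappa> \<ge> 1" "\<And>\<delta> w. \<delta> \<le> 1 \<Longrightarrow> w \<in> stopping_words I G \<delta> \<Longrightarrow> \<delta> \<le> \<kappa> * G w"
    using stopping_words_comparable[OF G_qm finite_I] by blast
  obtain C1 where C1: "C1 > 0" "\<And>\<rho>. 0 < \<rho> \<Longrightarrow> \<rho> \<le> \<kappa> \<Longrightarrow> xsum q \<rho> \<le> C1 * \<rho> powr (- (?\<beta> + \<epsilon>))"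
    "\<And>\<rho>. 0 < \<rho> \<Longrightarrow> \<rho> \<le> \<kappa> \<Longrightarrow> \<rho> powr (- (?\<beta> - \<epsilon>)) \<le> C1 * xsum q \<rho>"
    using xsum_proj_spectrum[OF q \<epsilon> \<kappa>(1)] by blast
  obtain C2 where C2: "C2 > 0" and cmp: "\<And>w \<delta> \<rho>. set w \<subseteq> I \<Longrightarrow> 0 < \<delta> \<Longrightarrow> 0 < \<rho> \<Longrightarrow>
      \<delta> \<le> \<kappa> * (\<rho> * F w) \<Longrightarrow> \<rho> * F w \<le> \<kappa> * \<delta> \<Longrightarrow> G w \<le> \<kappa> * \<delta> \<Longrightarrow>
      pullback_sum \<mu> unit_square q (word_map S w) \<delta> \<le> C2 * xsum q \<rho> \<and>
      xsum q \<rho> \<le> C2 * pullback_sum \<mu> unit_square q (word_map S w) \<delta>"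
    using word_sum_compare[OF q \<kappa>(1)] by blast
  define D where "D = \<kappa> powr \<bar>\<gamma> - ?\<beta>\<bar>"
  have D: "D > 0" using \<kappa> by (simp add: D_def)
  define C where "C = C1 * C2 * K powr \<epsilon> * D"
  have C: "C > 0" unfolding C_def using C1 C2 D K_ge_1 by simp
  have word: "pullback_sum \<mu> unit_square q (word_map S w) \<delta> * word_weight p w powr q
      \<le> C * \<delta> powr (- (\<gamma> + \<epsilon>)) * potential q \<gamma> w"
    "\<delta> powr (- (\<gamma> - \<epsilon>)) * potential q \<gamma> w
      \<le> C * (pullback_sum \<mu> unit_square q (word_map S w) \<delta> * word_weight p w powr q)"
    if \<delta>: "0 < \<delta>" "\<delta> < 1" and w: "w \<in> stopping_words I G \<delta>" for \<delta> w
  proof -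
    let ?Z = "pullback_sum \<mu> unit_square q (word_map S w) \<delta>"
    have wI: "set w \<subseteq> I" using w by (rule stopping_subset)
    have FG: "0 < F w" "0 < G w" "G w \<le> F w" using F_pos G_pos G_le_F wI by auto
    have Gw: "G w \<le> \<delta>" "\<delta> \<le> \<kappa> * G w" using w \<kappa>(2) \<delta> by (auto simp: stopping_words_def)
    define \<rho> where "\<rho> = \<delta> / F w"
    \<comment> \<open>Domination is used here: as the height is at most the width, the rescaled mesh
      size \<rho> is at most \<kappa>.\<close>
    have "\<kappa> * G w \<le> \<kappa> * F w" using FG \<kappa>(1) by (intro mult_left_mono) auto
    then have \<rho>: "0 < \<rho>" "\<rho> \<le> \<kappa>" "\<rho> * F w = \<delta>" using Gw FG \<delta> by (auto simp: \<rho>_def field_simps)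
    have "1 * \<delta> \<le> \<kappa> * \<delta>" using \<kappa>(1) \<delta> by (intro mult_right_mono) auto
    then have cmp': "?Z \<le> C2 * xsum q \<rho>" "xsum q \<rho> \<le> C2 * ?Z"
      using cmp[OF wI \<delta>(1) \<rho>(1)] Gw unfolding \<rho>(3) by auto
    have pw: "0 \<le> word_weight p w powr q" by simp
    have "K * c ^ length w \<le> K * 1" using c K_ge_1 by (intro mult_left_mono power_le_one) auto
    then have FK: "F w \<le> K" using F_le[OF wI] by simp
    have "G w \<le> \<kappa> * \<delta>" using Gw \<open>1 * \<delta> \<le> \<kappa> * \<delta>\<close> by linarith
    then have \<delta>G: "\<delta> powr (\<gamma> - ?\<beta>) \<le> D * G w powr (\<gamma> - ?\<beta>)" "G w powr (\<gamma> - ?\<beta>) \<le> D * \<delta> powr (\<gamma> - ?\<beta>)"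
      unfolding D_def using Gw FG \<delta> \<kappa>(1) by (auto intro!: powr_between)
    \<comment> \<open>The cost of the error in the exponent, uniform in w.\<close>
    have K\<epsilon>: "F w powr \<epsilon> \<le> K powr \<epsilon>" using FK FG \<epsilon> by (intro powr_mono2) auto
    have \<rho>_powr: "\<rho> powr (- x) = F w powr x * \<delta> powr (- x)" for x
      using powr_divide[of \<delta> "F w" "- x"] FG \<delta> by (simp add: \<rho>_def powr_minus field_simps)
    have F_powr: "F w powr x * F w powr y = F w powr (x + y)" and \<delta>_powr: "\<delta> powr x * \<delta> powr y = \<delta> powr (x + y)" for x y
      by (simp_all add: powr_add)
    have "\<rho> powr (- (?\<beta> + \<epsilon>)) = F w powr ?\<beta> * F w powr \<epsilon> * (\<delta> powr (\<gamma> - ?\<beta>) * \<delta> powr (- (\<gamma> + \<epsilon>)))"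
      unfolding \<rho>_powr F_powr \<delta>_powr by simp
    also have "\<dots> \<le> F w powr ?\<beta> * K powr \<epsilon> * ((D * G w powr (\<gamma> - ?\<beta>)) * \<delta> powr (- (\<gamma> + \<epsilon>)))"
      using \<delta>G K\<epsilon> D by (intro mult_mono mult_nonneg_nonneg) auto
    finally have 1: "\<rho> powr (- (?\<beta> + \<epsilon>)) \<le> K powr \<epsilon> * D * \<delta> powr (- (\<gamma> + \<epsilon>)) * (F w powr ?\<beta> * G w powr (\<gamma> - ?\<beta>))"
      by (simp add: ac_simps)
    have "?Z \<le> C2 * (C1 * \<rho> powr (- (?\<beta> + \<epsilon>)))"
      using cmp'(1) C1(2)[OF \<rho>(1,2)] C2 by (meson mult_left_mono less_imp_le order_trans)
    also have "\<dots> \<le> C2 * (C1 * (K powr \<epsilon> * D * \<delta> powr (- (\<gamma> + \<epsilon>)) * (F w powr ?\<beta> * G w powr (\<gamma> - ?\<beta>))))"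
      using 1 C1(1) C2 by (intro mult_left_mono) auto
    finally have "?Z * word_weight p w powr q \<le>
      C2 * (C1 * (K powr \<epsilon> * D * \<delta> powr (- (\<gamma> + \<epsilon>)) * (F w powr ?\<beta> * G w powr (\<gamma> - ?\<beta>)))) * word_weight p w powr q"
      using pw by (rule mult_right_mono)
    then show "?Z * word_weight p w powr q \<le> C * \<delta> powr (- (\<gamma> + \<epsilon>)) * potential q \<gamma> w"
      by (simp add: C_def potential_def ac_simps)
    have "F w powr ?\<beta> * G w powr (\<gamma> - ?\<beta>) * \<delta> powr (- (\<gamma> - \<epsilon>))
        \<le> F w powr ?\<beta> * (D * \<delta> powr (\<gamma> - ?\<beta>)) * \<delta> powr (- (\<gamma> - \<epsilon>))"
      using \<delta>G by (intro mult_left_mono mult_right_mono) auto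
    also have "\<dots> = D * ((F w powr \<epsilon> * F w powr (?\<beta> - \<epsilon>)) * (\<delta> powr (\<gamma> - ?\<beta>) * \<delta> powr (- (\<gamma> - \<epsilon>))))"
      unfolding F_powr by simp
    also have "\<dots> = D * F w powr \<epsilon> * \<rho> powr (- (?\<beta> - \<epsilon>))"
      unfolding \<rho>_powr \<delta>_powr by simp
    also have "\<dots> \<le> D * K powr \<epsilon> * (C1 * xsum q \<rho>)"
      using C1(3)[OF \<rho>(1,2)] K\<epsilon> D by (intro mult_mono mult_nonneg_nonneg) auto
    also have "\<dots> \<le> D * K powr \<epsilon> * (C1 * (C2 * ?Z))"
      using cmp'(2) C1(1) D by (intro mult_left_mono) auto
    finally have "F w powr ?\<beta> * G w powr (\<gamma> - ?\<beta>) * \<delta> powr (- (\<gamma> - \<epsilon>)) * word_weight p w powr q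
      \<le> D * K powr \<epsilon> * (C1 * (C2 * ?Z)) * word_weight p w powr q" using pw by (rule mult_right_mono)
    then show "\<delta> powr (- (\<gamma> - \<epsilon>)) * potential q \<gamma> w \<le> C * (?Z * word_weight p w powr q)"
      by (simp add: C_def potential_def ac_simps)
  qed
  have "word_sum q \<delta> \<le> (C * A ^ 3) * \<delta> powr (- (\<gamma> + \<epsilon>))"
    "\<delta> powr (- (\<gamma> - \<epsilon>)) \<le> (C * A ^ 3) * word_sum q \<delta>" if \<delta>: "0 < \<delta>" "\<delta> < 1" for \<delta>
  proof -
    let ?P = "\<Sum>w\<in>stopping_words I G \<delta>. potential q \<gamma> w"
    obtain N where N: "\<And>w. w \<in> words I N \<Longrightarrow> G w \<le> \<delta>" using F_small \<delta> by blast
    have P: "1 / A ^ 3 \<le> ?P" "?P \<le> A ^ 3"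
      using quasi_multiplicative_sum_stopping[OF A3 finite_I A2 N] by auto
    have "word_sum q \<delta> \<le> (\<Sum>w\<in>stopping_words I G \<delta>. C * \<delta> powr (- (\<gamma> + \<epsilon>)) * potential q \<gamma> w)"
      unfolding word_sum_def using word(1)[OF \<delta>] by (intro sum_mono) (simp add: mult.commute)
    also have "\<dots> \<le> C * \<delta> powr (- (\<gamma> + \<epsilon>)) * A ^ 3"
      unfolding sum_distrib_left[symmetric] using P C by (intro mult_left_mono) auto
    finally show "word_sum q \<delta> \<le> (C * A ^ 3) * \<delta> powr (- (\<gamma> + \<epsilon>))" by (simp add: ac_simps)
    have "\<delta> powr (- (\<gamma> - \<epsilon>)) * ?P \<le> C * word_sum q \<delta>"
      unfolding word_sum_def sum_distrib_left using word(2)[OF \<delta>] by (intro sum_mono) (simp add: mult.commute)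
    moreover have "\<delta> powr (- (\<gamma> - \<epsilon>)) * (1 / A ^ 3) \<le> \<delta> powr (- (\<gamma> - \<epsilon>)) * ?P"
      using P by (intro mult_left_mono) auto
    ultimately have "\<delta> powr (- (\<gamma> - \<epsilon>)) / A ^ 3 \<le> C * word_sum q \<delta>" by simp
    then show "\<delta> powr (- (\<gamma> - \<epsilon>)) \<le> (C * A ^ 3) * word_sum q \<delta>"
      using A1 by (simp add: field_simps)
  qed
  moreover have "C * A ^ 3 > 0" using C A1 by simp
  ultimately show ?thesis using that by blast
qed

end

section \<open>The pressure and the moment sums of the measure\<close>

lemma exp_growth_le:
  fixes x y :: real
  assumes C: "C > 0" and le: "\<And>n. exp (real n * x) \<le> C * exp (real n * y)"
  shows "x \<le> y"
proof (rule ccontr)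
  assume "\<not> x \<le> y"
  then have d: "0 < x - y" by simp
  obtain n where n: "ln C < real n * (x - y)" using reals_Archimedean3[OF d] by blast
  have "exp (real n * x) \<le> exp (ln C + real n * y)" using le[of n] C by (simp add: exp_add)
  then have "real n * x \<le> ln C + real n * y" by (simp only: exp_le_cancel_iff)
  then show False using n by (simp add: algebra_simps)
qed

lemma root_tendsto_exp:
  fixes M :: "nat \<Rightarrow> real"
  assumes C: "C > 0" and M: "\<And>n. exp (real n * L) / C \<le> M n" "\<And>n. M n \<le> C * exp (real n * L)"
  shows "(\<lambda>n. root n (M n)) \<longlonglongrightarrow> exp L"
proof (rule tendsto_sandwich)
  have r: "root n (c * exp (real n * L)) = root n c * exp L" if "n > 0" for n and c :: real
  proof -
    have "exp (real n * L) = exp L ^ n" by (rule exp_of_nat_mult)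
    then show ?thesis using that by (simp add: real_root_mult real_root_power_cancel)
  qed
  have lim: "(\<lambda>n. root n c * exp L) \<longlonglongrightarrow> exp L" if "c > 0" for c :: real
    using tendsto_mult[OF LIMSEQ_root_const[OF that] tendsto_const[of "exp L"]] by simp
  show "(\<lambda>n. root n (1 / C) * exp L) \<longlonglongrightarrow> exp L" "(\<lambda>n. root n C * exp L) \<longlonglongrightarrow> exp L"
    using C by (intro lim; simp)+
  show "\<forall>\<^sub>F n in sequentially. root n (1 / C) * exp L \<le> root n (M n)"
    using eventually_gt_at_top[of 0]
  proof eventually_elim
    case (elim n)
    have "root n (1 / C * exp (real n * L)) \<le> root n (M n)" using M(1)[of n] elim by simp
    then show ?case using r[OF elim, of "1 / C"] by simp
  qed
  show "\<forall>\<^sub>F n in sequentially. root n (M n) \<le> root n C * exp L"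
    using eventually_gt_at_top[of 0]
  proof eventually_elim
    case (elim n)
    have "root n (M n) \<le> root n (C * exp (real n * L))" using M(2)[of n] elim by simp
    then show ?case using r[OF elim, of C] by simp
  qed
qed

context ifs_geometry
begin

lemma potential_pos: "set w \<subseteq> I \<Longrightarrow> 0 < potential q s w"
  using weight_pos[of w] F_pos[of w] G_pos[of w] by (simp add: potential_def)

lemma potential_shift:
  assumes "set w \<subseteq> I"
  shows "potential q (s + t) w = potential q s w * G w powr t"
proof -
  have "s + t - proj_spectrum \<mu> q = (s - proj_spectrum \<mu> q) + t" by simp
  then show ?thesis unfolding potential_def by (simp only: powr_add mult.assoc)
qed

text \<open>An exponential lower bound on heights keeps the pressure from falling arbitrarily fast
  in s, which gives the continuity used to find its zero.\<close>

lemma G_lower: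
  obtains \<eta> where "0 < \<eta>" "\<And>w. set w \<subseteq> I \<Longrightarrow> \<eta> ^ length w / K \<le> G w"
proof -
  define m where "m = Min ((\<lambda>i. G [i]) ` I)"
  have "m \<in> (\<lambda>i. G [i]) ` I" unfolding m_def using finite_I I_nonempty by (intro Min_in) auto
  then have m: "0 < m" using G_pos by auto
  have m_le: "m \<le> G [i]" if "i \<in> I" for i unfolding m_def using that finite_I by (intro Min_le) auto
  have "(m / K) ^ length w / K \<le> G w" if "set w \<subseteq> I" for w
    using that
  proof (induction w)
    case Nil
    then show ?case using quasi_multiplicative_Nil(1)[OF G_qm] by simp
  next
    case (Cons i w)
    have "(m / K) ^ length (i # w) / K = m / K * ((m / K) ^ length w / K)" by simp
    also have "\<dots> \<le> G [i] / K * G w"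
      using Cons m m_le[of i] K_ge_1 by (intro mult_mono divide_right_mono) auto
    also have "\<dots> \<le> G ([i] @ w)"
      using quasi_multiplicativeD(4)[OF G_qm, of "[i]" w] Cons K_ge_1 by (simp add: field_simps)
    finally show ?case by simp
  qed
  moreover have "0 < m / K" using m K_ge_1 by simp
  ultimately show ?thesis using that by blast
qed

text \<open>The pressure is \<open>exp (L s)\<close>, where L is the growth rate of the potential
  sums. Upper and lower exponential bounds on \<open>G\<close> make L strictly decreasing and
  Lipschitz, so it has exactly one zero, which is the moment scaling. There the exponential factor
  is 1 and only the constants of quasi-multiplicativity remain.\<close>

lemma moment_scaling_potential_sum:
  assumes sing: "\<And>w a. set w \<subseteq> I \<Longrightarrow> a \<in> unit_square \<Longrightarrow>
      0 < \<alpha>\<^sub>1 (jacobian (word_map S w) (at a within unit_square)) \<and>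
      \<alpha>\<^sub>1 (jacobian (word_map S w) (at a within unit_square)) \<le> K1 * F w \<and>
      F w \<le> K1 * \<alpha>\<^sub>1 (jacobian (word_map S w) (at a within unit_square)) \<and>
      0 < \<alpha>\<^sub>2 (jacobian (word_map S w) (at a within unit_square)) \<and>
      \<alpha>\<^sub>2 (jacobian (word_map S w) (at a within unit_square)) \<le> K1 * G w \<and>
      G w \<le> K1 * \<alpha>\<^sub>2 (jacobian (word_map S w) (at a within unit_square))"
    and K1: "1 \<le> K1"
  obtains B where "\<And>n. 1 / B \<le> (\<Sum>w\<in>words I n. potential q (moment_scaling I S p \<mu> q) w)"
    "\<And>n. (\<Sum>w\<in>words I n. potential q (moment_scaling I S p \<mu> q) w) \<le> B"
proof -
  define M where "M s n = (\<Sum>w\<in>words I n. potential q s w)" for s n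
  have "\<exists>L B. 1 \<le> B \<and> (\<forall>n. exp (real n * L) / B \<le> M s n \<and> M s n \<le> B * exp (real n * L))" for s
  proof -
    obtain B where B: "1 \<le> B" "quasi_multiplicative I B (potential q s)" using potential_qm by blast
    then show ?thesis unfolding M_def
      using quasi_multiplicative_sum_words[OF B(2) finite_I I_nonempty] by blast
  qed
  then obtain L B where B: "\<And>s. 1 \<le> B s" and
    L: "\<And>s n. exp (real n * L s) / B s \<le> M s n" "\<And>s n. M s n \<le> B s * exp (real n * L s)" by metis
  have pressure: "pressure I S p \<mu> s q = exp (L s)" for s
  proof -
    let ?\<beta> = "proj_spectrum \<mu> q"
    define C where "C = K1 powr \<bar>?\<beta>\<bar> * K1 powr \<bar>s - ?\<beta>\<bar>"
    have C: "C > 0" unfolding C_def using K1 by simp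
    have lim: "(\<lambda>n. root n (\<Sum>w\<in>words I n. word_potential S p \<mu> s q a w)) \<longlonglongrightarrow> exp (L s)"
      if a: "a \<in> unit_square" for a
    proof (rule root_tendsto_exp)
      have w: "word_potential S p \<mu> s q a w \<le> C * potential q s w"
        "potential q s w \<le> C * word_potential S p \<mu> s q a w" if "w \<in> words I n" for w n
      proof -
        define D where "D = jacobian (word_map S w) (at a within unit_square)"
        have wI: "set w \<subseteq> I" using that by (simp add: words_def)
        note b = sing[OF wI a, folded D_def]
        have FG: "0 < F w" "0 < G w" using F_pos G_pos wI by auto
        have 1: "\<alpha>\<^sub>1 D powr ?\<beta> \<le> K1 powr \<bar>?\<beta>\<bar> * F w powr ?\<beta>" "F w powr ?\<beta> \<le> K1 powr \<bar>?\<beta>\<bar> * \<alpha>\<^sub>1 D powr ?\<beta>"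
          "\<alpha>\<^sub>2 D powr (s - ?\<beta>) \<le> K1 powr \<bar>s - ?\<beta>\<bar> * G w powr (s - ?\<beta>)"
          "G w powr (s - ?\<beta>) \<le> K1 powr \<bar>s - ?\<beta>\<bar> * \<alpha>\<^sub>2 D powr (s - ?\<beta>)"
          using b FG K1 by (auto intro!: powr_between)
        have wp: "word_potential S p \<mu> s q a w = word_weight p w powr q * \<alpha>\<^sub>1 D powr ?\<beta> * \<alpha>\<^sub>2 D powr (s - ?\<beta>)"
          by (simp add: word_potential_def Let_def D_def)
        have "word_weight p w powr q * \<alpha>\<^sub>1 D powr ?\<beta> * \<alpha>\<^sub>2 D powr (s - ?\<beta>)
          \<le> word_weight p w powr q * (K1 powr \<bar>?\<beta>\<bar> * F w powr ?\<beta>) * (K1 powr \<bar>s - ?\<beta>\<bar> * G w powr (s - ?\<beta>))"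
          using 1 by (intro mult_mono mult_nonneg_nonneg) auto
        then show "word_potential S p \<mu> s q a w \<le> C * potential q s w"
          unfolding wp by (simp add: potential_def C_def ac_simps)
        have "word_weight p w powr q * F w powr ?\<beta> * G w powr (s - ?\<beta>)
          \<le> word_weight p w powr q * (K1 powr \<bar>?\<beta>\<bar> * \<alpha>\<^sub>1 D powr ?\<beta>) * (K1 powr \<bar>s - ?\<beta>\<bar> * \<alpha>\<^sub>2 D powr (s - ?\<beta>))"
          using 1 by (intro mult_mono mult_nonneg_nonneg) auto
        then show "potential q s w \<le> C * word_potential S p \<mu> s q a w"
          unfolding wp by (simp add: potential_def C_def ac_simps)
      qed
      show "C * B s > 0" using C B[of s] by simp
      fix n
      have "M s n \<le> C * (\<Sum>w\<in>words I n. word_potential S p \<mu> s q a w)"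
        unfolding M_def sum_distrib_left by (intro sum_mono w)
      then have "exp (real n * L s) / B s \<le> C * (\<Sum>w\<in>words I n. word_potential S p \<mu> s q a w)"
        using L(1)[of n s] by linarith
      then show "exp (real n * L s) / (C * B s) \<le> (\<Sum>w\<in>words I n. word_potential S p \<mu> s q a w)"
        using C B[of s] by (simp add: field_simps)
      have "(\<Sum>w\<in>words I n. word_potential S p \<mu> s q a w) \<le> C * M s n"
        unfolding M_def sum_distrib_left by (intro sum_mono w)
      also have "\<dots> \<le> C * (B s * exp (real n * L s))" using L(2)[of s n] C by (intro mult_left_mono) auto
      finally show "(\<Sum>w\<in>words I n. word_potential S p \<mu> s q a w) \<le> C * B s * exp (real n * L s)"
        by (simp add: mult.assoc)
    qed
    \<comment> \<open>The description quantifies over base points in the square; one such point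
      makes the limit unique.\<close>
    have "(0 :: real ^ 2) \<in> unit_square" by (simp add: mem_box_cart)
    then show ?thesis unfolding pressure_def using lim by (intro the_equality) (auto intro: LIMSEQ_unique)
  qed
  obtain \<eta> where \<eta>: "0 < \<eta>" "\<And>w. set w \<subseteq> I \<Longrightarrow> \<eta> ^ length w / K \<le> G w" using G_lower by blast
  have upper: "L (s + t) \<le> L s + t * ln c" if t: "0 \<le> t" for s t
  proof (rule exp_growth_le)
    show "B (s + t) * (K powr t * B s) > 0" using B[of s] B[of "s + t"] K_ge_1 by simp
    fix n
    have "M (s + t) n \<le> (K * c ^ n) powr t * M s n"
      unfolding M_def sum_distrib_left
    proof (rule sum_mono)
      fix w assume "w \<in> words I n"
      then have w: "set w \<subseteq> I" "length w = n" by (auto simp: words_def)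
      have "G w powr t \<le> (K * c ^ n) powr t"
        using F_le[OF w(1)] G_le_F[OF w(1)] G_pos[OF w(1)] w(2) t by (intro powr_mono2) auto
      then show "potential q (s + t) w \<le> (K * c ^ n) powr t * potential q s w"
        unfolding potential_shift[OF w(1)] using potential_pos[OF w(1), of q s]
        by (simp add: mult.commute[of "potential q s w"] mult_right_mono less_imp_le)
    qed
    also have "(K * c ^ n) powr t = K powr t * exp (real n * (t * ln c))"
      using K_ge_1 c by (simp add: powr_def ln_mult ln_realpow distrib_left exp_add ac_simps)
    finally have "M (s + t) n \<le> K powr t * exp (real n * (t * ln c)) * M s n" .
    also have "\<dots> \<le> K powr t * exp (real n * (t * ln c)) * (B s * exp (real n * L s))"
      using L(2) by (intro mult_left_mono) auto
    finally have "exp (real n * L (s + t)) / B (s + t) \<le> K powr t * exp (real n * (t * ln c)) * (B s * exp (real n * L s))"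
      using L(1)[of n "s + t"] by linarith
    then have "exp (real n * L (s + t)) \<le> B (s + t) * (K powr t * exp (real n * (t * ln c)) * (B s * exp (real n * L s)))"
      using B[of "s + t"] by (simp add: field_simps)
    also have "\<dots> = B (s + t) * (K powr t * B s) * (exp (real n * (t * ln c)) * exp (real n * L s))" by (simp add: ac_simps)
    finally show "exp (real n * L (s + t)) \<le> B (s + t) * (K powr t * B s) * exp (real n * (L s + t * ln c))"
      by (simp add: algebra_simps flip: exp_add)
  qed
  have lower: "L s + t * ln \<eta> \<le> L (s + t)" if t: "0 \<le> t" for s t
  proof (rule exp_growth_le)
    show "B s * (K powr t * B (s + t)) > 0" using B[of s] B[of "s + t"] K_ge_1 by simp
    fix n
    have "(\<eta> ^ n / K) powr t * M s n \<le> M (s + t) n"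
      unfolding M_def sum_distrib_left
    proof (rule sum_mono)
      fix w assume "w \<in> words I n"
      then have w: "set w \<subseteq> I" "length w = n" by (auto simp: words_def)
      have "(\<eta> ^ n / K) powr t \<le> G w powr t"
        using \<eta>(1) \<eta>(2)[OF w(1)] K_ge_1 w(2) t by (intro powr_mono2) auto
      then show "(\<eta> ^ n / K) powr t * potential q s w \<le> potential q (s + t) w"
        unfolding potential_shift[OF w(1)] using potential_pos[OF w(1), of q s]
        by (simp add: mult.commute[of "potential q s w"] mult_right_mono less_imp_le)
    qed
    moreover have "(\<eta> ^ n / K) powr t = exp (real n * (t * ln \<eta>)) / K powr t"
      using K_ge_1 \<eta>(1) by (simp add: powr_def ln_div ln_realpow right_diff_distrib exp_diff ac_simps)
    ultimately have "exp (real n * (t * ln \<eta>)) * M s n \<le> K powr t * M (s + t) n"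
      using K_ge_1 by (simp add: field_simps)
    also have "\<dots> \<le> K powr t * (B (s + t) * exp (real n * L (s + t)))"
      using L(2) by (intro mult_left_mono) auto
    finally have 1: "exp (real n * (t * ln \<eta>)) * M s n \<le> K powr t * (B (s + t) * exp (real n * L (s + t)))" .
    have "exp (real n * (t * ln \<eta>)) * (exp (real n * L s) / B s) \<le> exp (real n * (t * ln \<eta>)) * M s n"
      using L(1) by (intro mult_left_mono) auto
    with 1 have "exp (real n * (t * ln \<eta>)) * (exp (real n * L s) / B s) \<le> K powr t * (B (s + t) * exp (real n * L (s + t)))"
      by linarith
    then have "exp (real n * (t * ln \<eta>)) * exp (real n * L s) \<le> B s * (K powr t * (B (s + t) * exp (real n * L (s + t))))"
      using B[of s] by (simp add: field_simps)
    then show "exp (real n * (L s + t * ln \<eta>)) \<le> B s * (K powr t * B (s + t)) * exp (real n * L (s + t))"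
      by (simp add: algebra_simps flip: exp_add)
  qed
  have lnc: "ln c < 0" using c by simp
  have dec: "L s' < L s" if "s < s'" for s s'
  proof -
    have "L s' \<le> L s + (s' - s) * ln c" using upper[of "s' - s" s] that by simp
    moreover have "(s' - s) * ln c < 0" using that lnc by (simp add: mult_pos_neg)
    ultimately show ?thesis by linarith
  qed
  have cont: "continuous_on UNIV L"
  proof (rule lipschitz_on_continuous_on[of "\<bar>ln \<eta>\<bar>"], rule lipschitz_onI)
    have *: "\<bar>L s' - L s\<bar> \<le> \<bar>ln \<eta>\<bar> * (s' - s)" if "s \<le> s'" for s s'
    proof -
      have "L s + (s' - s) * ln \<eta> \<le> L s'" using lower[of "s' - s" s] that by simp
      moreover have "L s' \<le> L s" using dec[of s s'] that by (cases "s = s'") auto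
      moreover have "(s' - s) * (- ln \<eta>) \<le> (s' - s) * \<bar>ln \<eta>\<bar>" using that by (intro mult_left_mono) auto
      ultimately show ?thesis by (simp add: mult.commute)
    qed
    show "dist (L s) (L s') \<le> \<bar>ln \<eta>\<bar> * dist s s'" for s s'
      using *[of s s'] *[of s' s] by (cases "s \<le> s'") (auto simp: dist_real_def abs_minus_commute)
  qed simp
  \<comment> \<open>Over a distance r, L falls by at least \<open>\<bar>L 0\<bar>\<close>, since its
    slope is at most \<open>ln c\<close>. This gives the two signs for the intermediate value
    theorem.\<close>
  define r where "r = \<bar>L 0\<bar> / (- ln c)"
  have r: "0 \<le> r" "r * ln c = - \<bar>L 0\<bar>" using lnc by (auto simp: r_def divide_nonneg_neg)
  have "L r \<le> 0" using upper[of r 0] r by simp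
  moreover have "0 \<le> L (- r)" using upper[of r "- r"] r by simp
  ultimately obtain \<gamma> where \<gamma>: "L \<gamma> = 0"
    using IVT2'[of L r 0 "- r"] r cont by (auto intro: continuous_on_subset)
  have "moment_scaling I S p \<mu> q = \<gamma>"
    unfolding moment_scaling_def pressure
  proof (rule the_equality)
    show "s = \<gamma>" if "exp (L s) = 1" for s
      using that \<gamma> dec[of s \<gamma>] dec[of \<gamma> s] by (cases s \<gamma> rule: linorder_cases) auto
  qed (simp add: \<gamma>)
  then show ?thesis using that[of "B \<gamma>"] L(1)[of _ \<gamma>] L(2)[of \<gamma>] \<gamma> unfolding M_def by simp
qed

section \<open>Moment sums of the measure over the mesh of the plane\<close>

abbreviation cells :: "real \<Rightarrow> (real ^ 2) set set" where
  "cells \<delta> \<equiv> mesh_meeting \<delta> unit_square"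

lemma cells_finite: "\<delta> > 0 \<Longrightarrow> finite (cells \<delta>)"
  by (intro finite_mesh_meeting) auto

lemma cell_borel: "Q \<in> cells \<delta> \<Longrightarrow> Q \<in> sets borel"
  by (auto simp: mesh_meeting_def dest!: mesh_cube_closed)

text \<open>Here and in \<open>lq_sum_cells\<close> the same array of masses, indexed by stopping
  words and cells, is summed. The power is taken here before and there after the summation over
  words; all comparisons of the two sums come from this.\<close>

lemma word_sum_cells:
  assumes \<delta>: "\<delta> > 0" and q: "0 \<le> q"
  shows "word_sum q \<delta> = (\<Sum>Q\<in>cells \<delta>. \<Sum>w\<in>stopping_words I G \<delta>. (word_weight p w * measure \<mu> (hits w Q)) powr q)"
proof -
  have "word_sum q \<delta> = (\<Sum>w\<in>stopping_words I G \<delta>. \<Sum>Q\<in>cells \<delta>. (word_weight p w * measure \<mu> (hits w Q)) powr q)"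
    unfolding word_sum_def
  proof (rule sum.cong[OF refl])
    fix w assume w: "w \<in> stopping_words I G \<delta>"
    have "pullback_sum \<mu> unit_square q (word_map S w) \<delta> = (\<Sum>Q\<in>cells \<delta>. measure \<mu> (hits w Q) powr q)"
    proof (rule pullback_sum_superset)
      show "mesh_meeting \<delta> (word_map S w ` unit_square) \<subseteq> cells \<delta>"
        using word_square[OF stopping_subset[OF w]] unfolding mesh_meeting_def by blast
    qed (use cells_finite \<delta> in \<open>auto simp: mesh_meeting_def\<close>)
    then show "word_weight p w powr q * pullback_sum \<mu> unit_square q (word_map S w) \<delta> =
        (\<Sum>Q\<in>cells \<delta>. (word_weight p w * measure \<mu> (hits w Q)) powr q)"
      using weight_pos[OF stopping_subset[OF w]] by (simp add: sum_distrib_left powr_mult)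
  qed
  then show ?thesis by (simp add: sum.swap[of _ "cells \<delta>"])
qed

lemma lq_sum_cells:
  assumes \<delta>: "\<delta> > 0"
  shows "lq_sum \<mu> q \<delta> =
    (\<Sum>Q\<in>cells \<delta>. (\<Sum>w\<in>stopping_words I G \<delta>. word_weight p w * measure \<mu> (hits w Q)) powr q)"
proof -
  obtain N where N: "\<And>w. w \<in> words I N \<Longrightarrow> G w \<le> \<delta>" using F_small \<delta> by blast
  have "lq_sum \<mu> q \<delta> = lq_sum (distr \<mu> borel (\<lambda>x. x)) q \<delta>"
    using sets_\<mu> by (simp add: distr_id2)
  also have "\<dots> = pullback_sum \<mu> unit_square q (\<lambda>x. x) \<delta>"
    using \<delta> by (intro lq_sum_distr_eq_pullback_sum prob_\<mu> sets_\<mu> \<mu>_square compact_cbox) auto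
  also have "\<dots> = (\<Sum>Q\<in>cells \<delta>. measure \<mu> (hits [] Q) powr q)" by (simp add: pullback_sum_def)
  also have "\<dots> = (\<Sum>Q\<in>cells \<delta>. (\<Sum>w\<in>stopping_words I G \<delta>. word_weight p w * measure \<mu> (hits w Q)) powr q)"
  proof (rule sum.cong[OF refl])
    fix Q assume "Q \<in> cells \<delta>"
    then have Q: "hits [] Q \<in> sets borel" using hits_borel[of "[]" Q] cell_borel by simp
    have "hits w (hits [] Q) = hits w Q" if "w \<in> stopping_words I G \<delta>" for w
      using word_square[OF stopping_subset[OF that]] by (auto simp del: mem_box)
    then have "measure \<mu> (hits [] Q) = (\<Sum>w\<in>stopping_words I G \<delta>. word_weight p w * measure \<mu> (hits w Q))"
      using self_similar_stopping[OF N Q] by simp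
    then show "measure \<mu> (hits [] Q) powr q =
        (\<Sum>w\<in>stopping_words I G \<delta>. word_weight p w * measure \<mu> (hits w Q)) powr q" by simp
  qed
  finally show ?thesis .
qed

lemma lq_sum_le_word_sum:
  assumes "\<delta> > 0" "0 \<le> q" "q \<le> 1"
  shows "lq_sum \<mu> q \<delta> \<le> word_sum q \<delta>"
  unfolding lq_sum_cells[OF assms(1)] word_sum_cells[OF assms(1,2)]
  using assms by (intro sum_mono sum_powr_subadditive weight_measure_nonneg)

lemma word_sum_le_lq_sum:
  assumes "\<delta> > 0" "1 \<le> q"
  shows "word_sum q \<delta> \<le> lq_sum \<mu> q \<delta>"
  using assms lq_sum_cells[of \<delta> q] word_sum_cells[of \<delta> q]
  by (auto intro!: sum_mono sum_powr_superadditive weight_measure_nonneg)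

lemma lq_sum_word_sum_multiplicity:
  assumes \<delta>: "\<delta> > 0" and q: "0 \<le> q"
    and N: "\<And>Q. Q \<in> cells \<delta> \<Longrightarrow> card {w\<in>stopping_words I G \<delta>. hits w Q \<noteq> {}} \<le> N"
  shows "lq_sum \<mu> q \<delta> \<le> real N powr q * word_sum q \<delta>" "word_sum q \<delta> \<le> real N * lq_sum \<mu> q \<delta>"
proof -
  let ?V = "\<lambda>Q. {w\<in>stopping_words I G \<delta>. hits w Q \<noteq> {}}"
  let ?y = "\<lambda>w Q. word_weight p w * measure \<mu> (hits w Q)"
  have fin: "finite (stopping_words I G \<delta>)" using finite_stopping_G \<delta> .
  have zero: "measure \<mu> (hits w Q) = 0" if "w \<in> stopping_words I G \<delta> - ?V Q" for w Q
  proof -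
    have "hits w Q = {}" using that by blast
    then show ?thesis by (simp only: measure_empty)
  qed
  have 1: "(\<Sum>w\<in>stopping_words I G \<delta>. ?y w Q) = (\<Sum>w\<in>?V Q. ?y w Q)" for Q
    using fin zero by (intro sum.mono_neutral_right) auto
  have 2: "(\<Sum>w\<in>stopping_words I G \<delta>. ?y w Q powr q) = (\<Sum>w\<in>?V Q. ?y w Q powr q)" for Q
    using fin zero by (intro sum.mono_neutral_right) auto
  show "lq_sum \<mu> q \<delta> \<le> real N powr q * word_sum q \<delta>"
    unfolding lq_sum_cells[OF \<delta>] word_sum_cells[OF \<delta> q] sum_distrib_left[of _ _ "cells \<delta>"] 1 2
    using fin N q by (intro sum_mono powr_sum_le_card weight_measure_nonneg) auto
  show "word_sum q \<delta> \<le> real N * lq_sum \<mu> q \<delta>"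
    unfolding lq_sum_cells[OF \<delta>] word_sum_cells[OF \<delta> q] sum_distrib_left[of _ _ "cells \<delta>"] 1 2
    using fin N q by (intro sum_mono sum_powr_le_card weight_measure_nonneg) auto
qed

text \<open>Required by the logarithm in the spectrum. The number of all stopping words is a crude
  multiplicity bound for one fixed \<delta>, so positivity passes over from
  \<open>word_sum\<close>.\<close>

lemma lq_sum_pos:
  assumes \<delta>: "\<delta> > 0" and q: "0 \<le> q"
  shows "0 < lq_sum \<mu> q \<delta>"
proof -
  let ?N = "card (stopping_words I G \<delta>)"
  have "word_sum q \<delta> \<le> real ?N * lq_sum \<mu> q \<delta>"
  proof (rule lq_sum_word_sum_multiplicity(2)[OF \<delta> q])
    show "card {w\<in>stopping_words I G \<delta>. hits w Q \<noteq> {}} \<le> ?N" for Q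
      by (rule card_mono[OF finite_stopping_G[OF \<delta>]]) blast
  qed
  moreover have "0 < word_sum q \<delta>"
  proof -
    obtain N where N: "\<And>w. w \<in> words I N \<Longrightarrow> G w \<le> \<delta>" using F_small \<delta> by blast
    have "measure \<mu> unit_square = (\<Sum>w\<in>stopping_words I G \<delta>. word_weight p w * measure \<mu> (hits w unit_square))"
      by (rule self_similar_stopping[OF N borel_closed[OF closed_cbox]])
    then have one: "1 = (\<Sum>w\<in>stopping_words I G \<delta>. word_weight p w * measure \<mu> (hits w unit_square))"
      by (simp only: \<mu>_square)
    have "stopping_words I G \<delta> \<noteq> {}"
    proof
      assume e: "stopping_words I G \<delta> = {}"
      show False using one unfolding e sum.empty by simp
    qed
    then obtain w where w: "w \<in> stopping_words I G \<delta>" by blast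
    show ?thesis unfolding word_sum_def
    proof (rule sum_pos2[OF finite_stopping_G[OF \<delta>] w])
      have wI: "set w \<subseteq> I" using w by (rule stopping_subset)
      have fin: "finite (mesh_meeting \<delta> (word_map S w ` unit_square))"
        by (intro finite_mesh_meeting compact_imp_bounded compact_continuous_image word_cont wI \<delta> compact_cbox)
      \<comment> \<open>If it vanished, the preimages of all cells would be null, but finitely many
        of them cover the square, which has mass 1.\<close>
      have "pullback_sum \<mu> unit_square q (word_map S w) \<delta> \<noteq> 0"
      proof
        assume "pullback_sum \<mu> unit_square q (word_map S w) \<delta> = 0"
        then have "\<forall>Q\<in>mesh_meeting \<delta> (word_map S w ` unit_square). measure \<mu> (hits w Q) powr q = 0"
          unfolding pullback_sum_def by (subst (asm) sum_nonneg_eq_0_iff[OF fin]) simp_all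
        then have "(\<Sum>Q\<in>mesh_meeting \<delta> (word_map S w ` unit_square). measure \<mu> (hits w Q)) = 0"
          by (intro sum.neutral) (simp del: mem_box)
        moreover have "measure \<mu> (\<Union>Q\<in>mesh_meeting \<delta> (word_map S w ` unit_square). hits w Q)
          \<le> (\<Sum>Q\<in>mesh_meeting \<delta> (word_map S w ` unit_square). measure \<mu> (hits w Q))"
        proof (rule finite_measure_subadditive_finite[OF fin], rule image_subsetI)
          fix Q assume "Q \<in> mesh_meeting \<delta> (word_map S w ` unit_square)"
          then have "closed Q" unfolding mesh_meeting_def using mesh_cube_closed by blast
          then show "hits w Q \<in> sets \<mu>" unfolding sets_\<mu> by (intro hits_borel wI borel_closed)
        qed
        moreover have "(\<Union>Q\<in>mesh_meeting \<delta> (word_map S w ` unit_square). hits w Q) = unit_square"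
        proof (intro equalityI subsetI)
          fix a :: "real ^ 2" assume a: "a \<in> unit_square"
          obtain Q where "Q \<in> mesh_cubes \<delta>" "word_map S w a \<in> Q" using mesh_cubes_cover \<delta> by blast
          then show "a \<in> (\<Union>Q\<in>mesh_meeting \<delta> (word_map S w ` unit_square). hits w Q)"
            using a unfolding mesh_meeting_def by blast
        qed blast
        ultimately show False using \<mu>_square by (simp del: mem_box)
      qed
      then have "0 < pullback_sum \<mu> unit_square q (word_map S w) \<delta>"
        using pullback_sum_nonneg[of \<mu> unit_square q "word_map S w" \<delta>] by linarith
      then show "0 < word_weight p w powr q * pullback_sum \<mu> unit_square q (word_map S w) \<delta>"
        using weight_pos[OF wI] by simp
    qed (simp add: pullback_sum_nonneg)
  qed
  ultimately have "0 < real ?N * lq_sum \<mu> q \<delta>" by linarith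
  then show ?thesis by (simp add: zero_less_mult_iff)
qed

lemma upper_lq_spectrum_le:
  assumes q: "0 \<le> q" and B: "\<And>n. 1 / B \<le> (\<Sum>w\<in>words I n. potential q \<gamma> w)"
    "\<And>n. (\<Sum>w\<in>words I n. potential q \<gamma> w) \<le> B"
    and A: "A > 0" "\<And>\<delta>. 0 < \<delta> \<Longrightarrow> \<delta> < 1 \<Longrightarrow> lq_sum \<mu> q \<delta> \<le> A * word_sum q \<delta>"
  shows "upper_lq_spectrum \<mu> q \<le> ereal \<gamma>"
  unfolding upper_lq_spectrum_def
proof (rule Limsup_log_ratio_le)
  fix \<epsilon> :: real assume "\<epsilon> > 0"
  then obtain C where C: "C > 0"
    "\<And>\<delta>. 0 < \<delta> \<Longrightarrow> \<delta> < 1 \<Longrightarrow> word_sum q \<delta> \<le> C * \<delta> powr (- (\<gamma> + \<epsilon>))"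
    "\<And>\<delta>. 0 < \<delta> \<Longrightarrow> \<delta> < 1 \<Longrightarrow> \<delta> powr (- (\<gamma> - \<epsilon>)) \<le> C * word_sum q \<delta>"
    by (rule word_sum_bounds[OF q B]) blast
  have "lq_sum \<mu> q \<delta> \<le> A * C * \<delta> powr (- (\<gamma> + \<epsilon>))" if "0 < \<delta>" "\<delta> < 1" for \<delta>
  proof -
    have "A * word_sum q \<delta> \<le> A * (C * \<delta> powr (- (\<gamma> + \<epsilon>)))" using A(1) C(2) that by (intro mult_left_mono) auto
    then show ?thesis using A(2)[OF that] by (simp add: mult.assoc)
  qed
  moreover have "A * C > 0" using A C by simp
  ultimately show "\<exists>C>0. \<forall>\<delta>. 0 < \<delta> \<and> \<delta> < 1 \<longrightarrow> 0 < lq_sum \<mu> q \<delta> \<and> lq_sum \<mu> q \<delta> \<le> C * \<delta> powr (- (\<gamma> + \<epsilon>))"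
    using lq_sum_pos[OF _ q] by (intro exI[of _ "A * C"]) auto
qed

lemma lower_lq_spectrum_ge:
  assumes q: "0 \<le> q" and B: "\<And>n. 1 / B \<le> (\<Sum>w\<in>words I n. potential q \<gamma> w)"
    "\<And>n. (\<Sum>w\<in>words I n. potential q \<gamma> w) \<le> B"
    and A: "A > 0" "\<And>\<delta>. 0 < \<delta> \<Longrightarrow> \<delta> < 1 \<Longrightarrow> word_sum q \<delta> \<le> A * lq_sum \<mu> q \<delta>"
  shows "ereal \<gamma> \<le> lower_lq_spectrum \<mu> q"
  unfolding lower_lq_spectrum_def
proof (rule Liminf_log_ratio_ge)
  fix \<epsilon> :: real assume "\<epsilon> > 0"
  then obtain C where C: "C > 0"
    "\<And>\<delta>. 0 < \<delta> \<Longrightarrow> \<delta> < 1 \<Longrightarrow> word_sum q \<delta> \<le> C * \<delta> powr (- (\<gamma> + \<epsilon>))"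
    "\<And>\<delta>. 0 < \<delta> \<Longrightarrow> \<delta> < 1 \<Longrightarrow> \<delta> powr (- (\<gamma> - \<epsilon>)) \<le> C * word_sum q \<delta>"
    by (rule word_sum_bounds[OF q B]) blast
  have "1 / (C * A) * \<delta> powr (- (\<gamma> - \<epsilon>)) \<le> lq_sum \<mu> q \<delta>" if "0 < \<delta>" "\<delta> < 1" for \<delta>
  proof -
    have "C * word_sum q \<delta> \<le> C * (A * lq_sum \<mu> q \<delta>)" using C(1) A(2) that by (intro mult_left_mono) auto
    then have "\<delta> powr (- (\<gamma> - \<epsilon>)) \<le> C * A * lq_sum \<mu> q \<delta>" using C(3)[OF that] by (simp add: mult.assoc)
    then show ?thesis using A(1) C(1) by (simp add: field_simps)
  qed
  moreover have "1 / (C * A) > 0" using A C by simp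
  ultimately show "\<exists>C>0. \<forall>\<delta>. 0 < \<delta> \<and> \<delta> < 1 \<longrightarrow> C * \<delta> powr (- (\<gamma> - \<epsilon>)) \<le> lq_sum \<mu> q \<delta>"
    by (intro exI[of _ "1 / (C * A)"]) auto
qed

text \<open>A common first letter is removed by injectivity. At the first letter where the words
  differ the open set condition applies, since the remainders map the open square into itself.
  Incomparability guarantees that such a letter exists.\<close>

lemma rosc_words_disjoint:
  assumes rosc: "rosc I S" and inj: "\<And>i. i \<in> I \<Longrightarrow> inj_on (S i) unit_square"
    and "set u \<subseteq> I" "set v \<subseteq> I" "\<nexists>t. v = u @ t" "\<nexists>t. u = v @ t"
  shows "word_map S u ` open_unit_square \<inter> word_map S v ` open_unit_square = {}"
  using assms(3-6)
proof (induction u arbitrary: v)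
  case (Cons i u)
  then obtain j v' where v: "v = j # v'" by (cases v) auto
  have open_word: "word_map S w ` open_unit_square \<subseteq> open_unit_square" if "set w \<subseteq> I" for w
    using that
  proof (induction w)
    case (Cons i w)
    then show ?case using rosc by (auto simp: rosc_def image_subset_iff simp del: mem_box)
  qed (simp del: mem_box)
  have sub: "open_unit_square \<subseteq> (unit_square :: (real ^ 2) set)" by (rule box_subset_cbox)
  have u: "word_map S u ` open_unit_square \<subseteq> open_unit_square" "word_map S v' ` open_unit_square \<subseteq> open_unit_square"
    using Cons.prems v by (auto intro!: open_word simp del: mem_box)
  show ?case
  proof (cases "i = j")
    case True
    have "word_map S u ` open_unit_square \<inter> word_map S v' ` open_unit_square = {}"
      using Cons.prems v True by (intro Cons.IH) auto
    then have "S i ` (word_map S u ` open_unit_square) \<inter> S i ` (word_map S v' ` open_unit_square) = {}"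
      using inj_on_image_Int[OF inj[of i], of "word_map S u ` open_unit_square" "word_map S v' ` open_unit_square"]
        Cons.prems u sub by auto
    then show ?thesis unfolding v True by (simp add: image_comp)
  next
    case False
    have "S i ` open_unit_square \<inter> S j ` open_unit_square = {}"
      using rosc False Cons.prems v unfolding rosc_def disjoint_family_on_def by auto
    then have "S i ` (word_map S u ` open_unit_square) \<inter> S j ` (word_map S v' ` open_unit_square) = {}"
      using u by blast
    then show ?thesis unfolding v by (simp add: image_comp)
  qed
qed simp

text \<open>Each word meeting a cell contributes a box of side comparable to \<open>\<delta>\<close> near that cell, and
  these boxes have separated centres because the images of the open square are disjoint.\<close>

lemma rosc_multiplicity:
  assumes rosc: "rosc I S" and inj: "\<And>i. i \<in> I \<Longrightarrow> inj_on (S i) unit_square" and K1: "1 \<le> K1"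
    and inner: "\<And>w a r. set w \<subseteq> I \<Longrightarrow> a \<in> unit_square \<Longrightarrow> 0 < r \<Longrightarrow> r \<le> 1 \<Longrightarrow>
      \<exists>b\<in>open_unit_square. \<bar>b $ 1 - a $ 1\<bar> \<le> r \<and>
        (\<forall>y. dist y (word_map S w b) * K1 < min (F w * r) (G w) \<longrightarrow> y \<in> word_map S w ` open_unit_square)"
  shows "\<exists>N. \<forall>\<delta>. 0 < \<delta> \<and> \<delta> < 1 \<longrightarrow> (\<forall>Q\<in>cells \<delta>. card {w\<in>stopping_words I G \<delta>. hits w Q \<noteq> {}} \<le> N)"
proof -
  obtain \<kappa> where \<kappa>: "\<kappa> \<ge> 1" "\<And>\<delta> w. \<delta> \<le> 1 \<Longrightarrow> w \<in> stopping_words I G \<delta> \<Longrightarrow> \<delta> \<le> \<kappa> * G w"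
    using stopping_words_comparable[OF G_qm finite_I] by blast
  \<comment> \<open>Two centres near the same cell are at distance at most
    \<open>(4 * K + 2) * \<delta>\<close>; R expresses this in units of the finer mesh size
    \<open>h\<close> below.\<close>
  define R where "R = (4 * K + 2) * (4 * \<kappa> * K1)"
  have "card {w\<in>stopping_words I G \<delta>. hits w Q \<noteq> {}} \<le> (2 * nat \<lceil>R\<rceil> + 3) ^ DIM(real ^ 2)"
    if \<delta>: "0 < \<delta>" "\<delta> < 1" and Q: "Q \<in> cells \<delta>" for \<delta> Q
  proof -
    let ?V = "{w\<in>stopping_words I G \<delta>. hits w Q \<noteq> {}}"
    \<comment> \<open>With this choice \<open>4 * h * K1 = \<delta> / \<kappa>\<close>, which is at
      most both \<open>F w * r\<close> and \<open>G w\<close>, so the ball of radius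
      \<open>4 * h\<close> about each centre lies in the image of the open square.\<close>
    define h where "h = \<delta> / (4 * \<kappa> * K1)"
    have h: "0 < h" "R * h = (4 * K + 2) * \<delta>" "4 * h * K1 * \<kappa> = \<delta>" using \<delta> \<kappa> K1 by (auto simp: h_def R_def field_simps)
    have "\<exists>b. b \<in> open_unit_square \<and> (\<exists>z\<in>Q. dist (word_map S w b) z \<le> 2 * K * \<delta>) \<and>
        (\<forall>y. dist y (word_map S w b) < 4 * h \<longrightarrow> y \<in> word_map S w ` open_unit_square)"
      if w: "w \<in> ?V" for w
    proof -
      obtain a where a: "a \<in> unit_square" "word_map S w a \<in> Q" using w by blast
      have wI: "set w \<subseteq> I" using w stopping_subset by blast
      have Gw: "G w \<le> \<delta>" "\<delta> \<le> \<kappa> * G w" "G w \<le> F w" "0 < G w" "0 < F w"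
        using w \<kappa>(2) \<delta> G_le_F[OF wI] G_pos[OF wI] F_pos[OF wI] by (auto simp: stopping_words_def)
      \<comment> \<open>The strip of w may be much longer than \<delta>. A horizontal step of at
        most r moves the image by at most the order of \<delta>, so the centre stays near the cell,
        and \<open>F w * r = \<delta> / \<kappa>\<close> is still enough room for the ball.\<close>
      define r where "r = \<delta> / (\<kappa> * F w)"
      have "\<kappa> * G w \<le> \<kappa> * F w" using Gw \<kappa>(1) by (intro mult_left_mono) auto
      then have "\<delta> \<le> \<kappa> * F w" using Gw(2) by linarith
      then have r: "0 < r" "r \<le> 1" "F w * r = \<delta> / \<kappa>" using Gw(5) \<kappa>(1) \<delta> by (auto simp: r_def field_simps)
      have dk: "\<delta> / \<kappa> \<le> G w" "\<delta> / \<kappa> \<le> \<delta>"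
        using Gw(2) \<kappa>(1) \<delta> by (simp_all add: divide_le_eq mult.commute)
      obtain b where b: "b \<in> open_unit_square" "\<bar>b $ 1 - a $ 1\<bar> \<le> r"
        "\<And>y. dist y (word_map S w b) * K1 < min (F w * r) (G w) \<Longrightarrow> y \<in> word_map S w ` open_unit_square"
        using inner[OF wI a(1) r(1,2)] by blast
      have b': "b \<in> unit_square" using b(1) box_subset_cbox by blast
      have "dist (word_map S w b) (word_map S w a) \<le> K * (F w * \<bar>b $ 1 - a $ 1\<bar> + G w)"
        by (rule dist_upper[OF wI b' a(1)])
      also have "\<dots> \<le> K * (F w * r + \<delta>)" using b(2) Gw K_ge_1 by (intro mult_left_mono add_mono) auto
      also have "\<dots> \<le> K * (\<delta> + \<delta>)" using r(3) dk K_ge_1 by (intro mult_left_mono) auto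
      finally have 1: "dist (word_map S w b) (word_map S w a) \<le> 2 * K * \<delta>" by simp
      have "y \<in> word_map S w ` open_unit_square" if y: "dist y (word_map S w b) < 4 * h" for y
      proof (rule b(3))
        have "dist y (word_map S w b) * K1 < 4 * h * K1" using y K1 by (intro mult_strict_right_mono) auto
        also have "\<dots> = \<delta> / \<kappa>" using h(3) \<kappa>(1) by (simp add: field_simps)
        finally show "dist y (word_map S w b) * K1 < min (F w * r) (G w)" using r(3) dk by simp
      qed
      then show ?thesis using b(1) 1 a(2) by blast
    qed
    then have "\<forall>w\<in>?V. \<exists>b. b \<in> open_unit_square \<and> (\<exists>z\<in>Q. dist (word_map S w b) z \<le> 2 * K * \<delta>) \<and>
        (\<forall>y. dist y (word_map S w b) < 4 * h \<longrightarrow> y \<in> word_map S w ` open_unit_square)" by blast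
    then obtain b where b_all: "\<forall>w\<in>?V. b w \<in> open_unit_square \<and> (\<exists>z\<in>Q. dist (word_map S w (b w)) z \<le> 2 * K * \<delta>) \<and>
        (\<forall>y. dist y (word_map S w (b w)) < 4 * h \<longrightarrow> y \<in> word_map S w ` open_unit_square)"
      unfolding bchoice_iff by blast
    have b: "\<And>w. w \<in> ?V \<Longrightarrow> b w \<in> open_unit_square"
      "\<And>w. w \<in> ?V \<Longrightarrow> \<exists>z\<in>Q. dist (word_map S w (b w)) z \<le> 2 * K * \<delta>"
      "\<And>w y. w \<in> ?V \<Longrightarrow> dist y (word_map S w (b w)) < 4 * h \<Longrightarrow> y \<in> word_map S w ` open_unit_square"
      using b_all by blast+
    define X where "X = (\<lambda>w. word_map S w (b w)) ` ?V"
    have d: "dist x y \<le> R * h" if "x \<in> X" "y \<in> X" for x y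
    proof -
      obtain x' y' where "x' \<in> Q" "y' \<in> Q" "dist x x' \<le> 2 * K * \<delta>" "dist y y' \<le> 2 * K * \<delta>"
        using b(2) \<open>x \<in> X\<close> \<open>y \<in> X\<close> unfolding X_def by blast
      moreover have "dist x' y' \<le> 2 * \<delta>" using mesh_cube_dist[of Q \<delta> x' y'] Q calculation by (simp add: mesh_meeting_def)
      ultimately have "dist x y \<le> 2 * K * \<delta> + 2 * \<delta> + 2 * K * \<delta>"
        using dist_triangle[of x y x'] dist_triangle[of x' y y'] by (simp add: dist_commute)
      then show ?thesis unfolding h(2) by (simp add: algebra_simps)
    qed
    have "\<exists>P. P \<in> mesh_cubes h \<and> word_map S w (b w) \<in> P" for w using mesh_cubes_cover h(1) by blast
    then obtain P where P: "\<And>w. P w \<in> mesh_cubes h" "\<And>w. word_map S w (b w) \<in> P w" by metis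
    \<comment> \<open>Two points in one cube of mesh size h are at distance at most
      \<open>2 * h\<close>, less than the radius \<open>4 * h\<close>, so words sharing a cube would
      have intersecting images of the open square.\<close>
    have "inj_on P ?V"
    proof (rule inj_onI, rule ccontr)
      fix u v assume uv: "u \<in> ?V" "v \<in> ?V" "P u = P v" "u \<noteq> v"
      have "dist (word_map S v (b v)) (word_map S u (b u)) \<le> real DIM(real ^ 2) * h"
        using P[of u] P[of v] uv(3) by (intro mesh_cube_dist[of "P u"]) auto
      also have "\<dots> < 4 * h" using h(1) by simp
      finally have "word_map S v (b v) \<in> word_map S u ` open_unit_square" using b(3)[OF uv(1)] by blast
      moreover have "word_map S v (b v) \<in> word_map S v ` open_unit_square" using b(1)[OF uv(2)] by blast
      moreover have "word_map S u ` open_unit_square \<inter> word_map S v ` open_unit_square = {}"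
      proof (rule rosc_words_disjoint[OF rosc inj])
        have st: "u \<in> stopping_words I G \<delta>" "v \<in> stopping_words I G \<delta>" using uv by auto
        show "set u \<subseteq> I" "set v \<subseteq> I" using st stopping_subset by auto
        show "\<nexists>t. v = u @ t" using stopping_words_prefix[OF st(2,1), of "[]"] uv(4) by auto
        show "\<nexists>t. u = v @ t" using stopping_words_prefix[OF st(1,2), of "[]"] uv(4) by auto
      qed
      ultimately show False by blast
    qed
    moreover have "P ` ?V \<subseteq> mesh_meeting h X" using P unfolding X_def mesh_meeting_def by blast
    ultimately have "card ?V \<le> card (mesh_meeting h X)"
      using mesh_meeting_card(1)[OF h(1) d] by (rule card_inj_on_le)
    also have "\<dots> \<le> (2 * nat \<lceil>R\<rceil> + 3) ^ DIM(real ^ 2)" by (rule mesh_meeting_card(2)[OF h(1) d])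
    finally show ?thesis .
  qed
  then show ?thesis by blast
qed

end

section \<open>Singular values and cocycles\<close>

text \<open>The right-hand side is the characteristic polynomial of \<open>transpose M ** M\<close>:
  the trace is the sum of the squared entries of M, the determinant the square of that of M.\<close>

lemma matrix_eigenvalue_triangular:
  fixes M :: "real ^ 2 ^ 2"
  assumes M: "M $ 1 $ 1 = A" "M $ 1 $ 2 = 0" "M $ 2 $ 1 = B" "M $ 2 $ 2 = C" and C: "C \<noteq> 0"
  shows "matrix_eigenvalue (transpose M ** M) l \<longleftrightarrow> l\<^sup>2 - (A\<^sup>2 + B\<^sup>2 + C\<^sup>2) * l + (A * C)\<^sup>2 = 0"
proof -
  have eq: "(transpose M ** M) *v v = l *\<^sub>R v \<longleftrightarrow>
      (A\<^sup>2 + B\<^sup>2 - l) * v $ 1 + B * C * v $ 2 = 0 \<and> B * C * v $ 1 + (C\<^sup>2 - l) * v $ 2 = 0" for v :: "real ^ 2"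
    by (auto simp: vec_eq_iff forall_2 matrix_vector_mult_def matrix_matrix_mult_def transpose_def sum_2 M
        power2_eq_square algebra_simps)
  have det: "l\<^sup>2 - (A\<^sup>2 + B\<^sup>2 + C\<^sup>2) * l + (A * C)\<^sup>2 = (A\<^sup>2 + B\<^sup>2 - l) * (C\<^sup>2 - l) - (B * C) * (B * C)"
    by (simp add: power2_eq_square algebra_simps)
  show ?thesis unfolding matrix_eigenvalue_def eq det
  proof
    assume "\<exists>v :: real ^ 2. v \<noteq> 0 \<and> (A\<^sup>2 + B\<^sup>2 - l) * v $ 1 + B * C * v $ 2 = 0 \<and> B * C * v $ 1 + (C\<^sup>2 - l) * v $ 2 = 0"
    then obtain v :: "real ^ 2" where v: "v \<noteq> 0" "(A\<^sup>2 + B\<^sup>2 - l) * v $ 1 + B * C * v $ 2 = 0"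
      "B * C * v $ 1 + (C\<^sup>2 - l) * v $ 2 = 0" by blast
    let ?a = "A\<^sup>2 + B\<^sup>2 - l" and ?b = "B * C" and ?c = "C\<^sup>2 - l"
    \<comment> \<open>Cramer's rule: the system is multiplied by its adjugate.\<close>
    have "(?a * ?c - ?b * ?b) * v $ 1 = ?c * (?a * v $ 1 + ?b * v $ 2) - ?b * (?b * v $ 1 + ?c * v $ 2)"
      "(?a * ?c - ?b * ?b) * v $ 2 = ?a * (?b * v $ 1 + ?c * v $ 2) - ?b * (?a * v $ 1 + ?b * v $ 2)"
      by (simp_all add: algebra_simps)
    then have "(?a * ?c - ?b * ?b) * v $ 1 = 0" "(?a * ?c - ?b * ?b) * v $ 2 = 0"
      unfolding v(2,3) by simp_all
    moreover have "v $ 1 \<noteq> 0 \<or> v $ 2 \<noteq> 0" using v(1) by (auto simp: vec_eq_iff forall_2)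
    ultimately show "?a * ?c - ?b * ?b = 0" by auto
  next
    assume d: "(A\<^sup>2 + B\<^sup>2 - l) * (C\<^sup>2 - l) - (B * C) * (B * C) = 0"
    show "\<exists>v :: real ^ 2. v \<noteq> 0 \<and> (A\<^sup>2 + B\<^sup>2 - l) * v $ 1 + B * C * v $ 2 = 0 \<and> B * C * v $ 1 + (C\<^sup>2 - l) * v $ 2 = 0"
    proof (cases "B = 0")
      case False
      \<comment> \<open>Orthogonal to the first row of the system, and nonzero because B and C are.
        In the diagonal case below a coordinate vector serves instead.\<close>
      define v :: "real ^ 2" where "v = vector [B * C, l - (A\<^sup>2 + B\<^sup>2)]"
      have v: "v $ 1 = B * C" "v $ 2 = l - (A\<^sup>2 + B\<^sup>2)" by (simp_all add: v_def)
      have "v \<noteq> 0" using v(1) False C by (metis mult_eq_0_iff zero_index)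
      moreover have "B * C * v $ 1 + (C\<^sup>2 - l) * v $ 2 = 0" unfolding v using d by (simp add: algebra_simps)
      moreover have "(A\<^sup>2 + B\<^sup>2 - l) * v $ 1 + B * C * v $ 2 = 0" unfolding v by (simp add: algebra_simps)
      ultimately show ?thesis by blast
    next
      case True
      then have "A\<^sup>2 + B\<^sup>2 - l = 0 \<or> C\<^sup>2 - l = 0" using d by simp
      then show ?thesis
      proof
        assume "A\<^sup>2 + B\<^sup>2 - l = 0"
        then show ?thesis using True by (intro exI[of _ "axis 1 1"]) (simp add: axis_def vec_eq_iff)
      next
        assume "C\<^sup>2 - l = 0"
        then show ?thesis using True by (intro exI[of _ "axis 2 1"]) (simp add: axis_def vec_eq_iff)
      qed
    qed
  qed
qed

text \<open>The squared singular values are the roots of the characteristic polynomial. It takes the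
  value \<open>- (A * B)\<^sup>2\<close> at \<open>A\<^sup>2\<close>, so \<open>A\<^sup>2\<close>
  lies between the roots; the trace bounds the larger root and the determinant gives the
  product.\<close>

lemma singular_values_triangular:
  fixes M :: "real ^ 2 ^ 2"
  assumes M: "M $ 1 $ 1 = A" "M $ 1 $ 2 = 0" "M $ 2 $ 1 = B" "M $ 2 $ 2 = C" and pos: "0 < A" "0 < C"
  shows "A \<le> \<alpha>\<^sub>1 M" "\<alpha>\<^sub>1 M \<le> A + \<bar>B\<bar> + C" "\<alpha>\<^sub>1 M * \<alpha>\<^sub>2 M = A * C"
proof -
  define T where "T = A\<^sup>2 + B\<^sup>2 + C\<^sup>2"
  define s where "s = sqrt (T\<^sup>2 - 4 * (A * C)\<^sup>2)"
  define l1 l2 where "l1 = (T + s) / 2" and "l2 = (T - s) / 2"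
  have T: "2 * (A * C) \<le> T"
    unfolding T_def using sum_squares_bound[of A C] zero_le_power2[of B] by linarith
  have "(2 * (A * C))\<^sup>2 \<le> T\<^sup>2" using T pos by (intro power_mono) auto
  then have s2: "s\<^sup>2 = T\<^sup>2 - 4 * (A * C)\<^sup>2" and s: "0 \<le> s"
    unfolding s_def by (simp_all add: power_mult_distrib)
  have prod: "l1 * l2 = (A * C)\<^sup>2" and sum: "l1 + l2 = T" and le: "l2 \<le> l1"
    using s2 s by (simp_all add: l1_def l2_def power2_eq_square field_simps)
  have factor: "l\<^sup>2 - T * l + (A * C)\<^sup>2 = (l - l1) * (l - l2)" for l
    unfolding prod[symmetric] sum[symmetric] by (simp add: power2_eq_square algebra_simps)
  have "(A\<^sup>2 - l1) * (A\<^sup>2 - l2) = - (A * B)\<^sup>2"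
    unfolding factor[symmetric] by (simp add: T_def power2_eq_square algebra_simps)
  then have A: "A\<^sup>2 \<le> l1"
    using le mult_pos_pos[of "A\<^sup>2 - l1" "A\<^sup>2 - l2"] by (cases "A\<^sup>2 \<le> l1") auto
  have l1: "0 < l1" using A pos by (smt (verit) zero_less_power)
  then have l2: "0 < l2" using prod pos by (metis mult_pos_pos zero_less_mult_pos zero_less_power)
  have "singular_values M = sqrt ` {l. (l - l1) * (l - l2) = 0}"
    unfolding singular_values_def using matrix_eigenvalue_triangular[OF M] pos
    by (auto simp: factor[symmetric] T_def)
  also have "{l. (l - l1) * (l - l2) = 0} = {l1, l2}" by auto
  finally have sv: "singular_values M = {sqrt l1, sqrt l2}" by simp
  have \<alpha>: "\<alpha>\<^sub>1 M = sqrt l1" "\<alpha>\<^sub>2 M = sqrt l2"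
    unfolding \<alpha>\<^sub>1_def \<alpha>\<^sub>2_def sv using le by (simp_all add: max_def min_def)
  show "A \<le> \<alpha>\<^sub>1 M" unfolding \<alpha> using A pos by (simp add: real_le_rsqrt)
  have "l1 \<le> T" using sum l2 by linarith
  also have "T \<le> (A + \<bar>B\<bar> + C)\<^sup>2" using pos by (simp add: T_def power2_eq_square algebra_simps)
  finally show "\<alpha>\<^sub>1 M \<le> A + \<bar>B\<bar> + C" unfolding \<alpha> using pos by (intro real_le_lsqrt) auto
  show "\<alpha>\<^sub>1 M * \<alpha>\<^sub>2 M = A * C" unfolding \<alpha> using prod pos by (simp flip: real_sqrt_mult)
qed

section \<open>Products of derivatives along words and bounded distortion\<close>

primrec cocycle :: "('i \<Rightarrow> 'a \<Rightarrow> real) \<Rightarrow> ('i \<Rightarrow> 'a \<Rightarrow> 'a) \<Rightarrow> 'i list \<Rightarrow> 'a \<Rightarrow> real" where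
  "cocycle h S [] a = 1"
| "cocycle h S (i # w) a = h i (word_map S w a) * cocycle h S w a"

lemma cocycle_append: "cocycle h S (u @ v) a = cocycle h S u (word_map S v a) * cocycle h S v a"
  by (induction u) (auto simp: word_map_append)

lemma word_map_in:
  assumes "\<And>i a. i \<in> I \<Longrightarrow> a \<in> X \<Longrightarrow> S i a \<in> X" "set w \<subseteq> I" "a \<in> X"
  shows "word_map S w a \<in> X"
  using assms(2) by (induction w) (auto intro: assms(1,3))

lemma word_map_dist:
  assumes S: "\<And>i a. i \<in> I \<Longrightarrow> a \<in> X \<Longrightarrow> S i a \<in> X"
    and lip: "\<And>i a b. i \<in> I \<Longrightarrow> a \<in> X \<Longrightarrow> b \<in> X \<Longrightarrow> dist (S i a) (S i b) \<le> c * dist a b"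
    and c: "0 \<le> c" and w: "set w \<subseteq> I" and ab: "a \<in> X" "b \<in> X"
  shows "dist (word_map S w a) (word_map S w b) \<le> c ^ length w * dist a b"
  using w
proof (induction w)
  case (Cons i w)
  then have "dist (word_map S (i # w) a) (word_map S (i # w) b) \<le> c * dist (word_map S w a) (word_map S w b)"
    using lip[of i "word_map S w a" "word_map S w b"] word_map_in[of I X S, OF S] ab by auto
  also have "\<dots> \<le> c * (c ^ length w * dist a b)" using Cons c by (intro mult_left_mono) auto
  finally show ?case by (simp add: mult.assoc)
qed simp

text \<open>The logarithms of the factors at two points differ by a geometric series, since they are
  evaluated at points whose distance decreases geometrically.\<close>

lemma cocycle_distortion:
  fixes S :: "'i \<Rightarrow> 'a::metric_space \<Rightarrow> 'a"
  assumes S: "\<And>i a. i \<in> I \<Longrightarrow> a \<in> X \<Longrightarrow> S i a \<in> X"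
    and lip: "\<And>i a b. i \<in> I \<Longrightarrow> a \<in> X \<Longrightarrow> b \<in> X \<Longrightarrow> dist (S i a) (S i b) \<le> c * dist a b"
    and c: "0 < c" "c < 1"
    and h: "\<And>i a. i \<in> I \<Longrightarrow> a \<in> X \<Longrightarrow> d \<le> h i a" "0 < d"
    and holder: "\<And>i a b. i \<in> I \<Longrightarrow> a \<in> X \<Longrightarrow> b \<in> X \<Longrightarrow> \<bar>h i a - h i b\<bar> \<le> H * dist a b powr \<alpha>"
    and \<alpha>: "0 < \<alpha>" and H: "0 \<le> H" and diam: "\<And>a b. a \<in> X \<Longrightarrow> b \<in> X \<Longrightarrow> dist a b \<le> D"
  shows "\<exists>K\<ge>1. \<forall>w a b. set w \<subseteq> I \<and> a \<in> X \<and> b \<in> X \<longrightarrow> cocycle h S w a \<le> K * cocycle h S w b"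
proof -
  \<comment> \<open>E bounds a Hoelder error over the whole of X relative to the lower bound d of
    the factors; r is the ratio at which these errors shrink with each further letter.\<close>
  define E r where "E = H * D powr \<alpha> / d" and "r = c powr \<alpha>"
  have E: "0 \<le> E" unfolding E_def using H h(2) by simp
  have r: "0 < r" "r < 1" unfolding r_def using c \<alpha> powr_less_mono2[of \<alpha> c 1] by simp_all
  have pos: "0 < cocycle h S w a" if "set w \<subseteq> I" "a \<in> X" for w a
    using that(1)
  proof (induction w)
    case (Cons i w)
    have "0 < h i (word_map S w a)"
      using h(1)[of i "word_map S w a"] h(2) word_map_in[of I X S, OF S _ that(2), of w] Cons.prems by force
    then show ?case using Cons by simp
  qed simp
  have step: "cocycle h S w a \<le> exp (E * (\<Sum>k<length w. r ^ k)) * cocycle h S w b"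
    if w: "set w \<subseteq> I" and ab: "a \<in> X" "b \<in> X" for w a b
    using w
  proof (induction w)
    case (Cons i w)
    let ?a = "word_map S w a" and ?b = "word_map S w b"
    have i: "i \<in> I" and w: "set w \<subseteq> I" using Cons.prems by auto
    have in_X: "?a \<in> X" "?b \<in> X" using word_map_in[of I X S, OF S w] ab by auto
    have "dist ?a ?b \<le> c ^ length w * dist a b"
      by (rule word_map_dist[of I X S, OF S lip less_imp_le[OF c(1)] w ab])
    also have "\<dots> \<le> c ^ length w * D" using diam[OF ab] c by (intro mult_left_mono) auto
    finally have "dist ?a ?b powr \<alpha> \<le> (c ^ length w * D) powr \<alpha>" using \<alpha> by (intro powr_mono2) auto
    also have "\<dots> = r ^ length w * D powr \<alpha>"
    proof -
      have "0 \<le> D" using diam[OF ab] zero_le_dist[of a b] by linarith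
      have "(c ^ length w) powr \<alpha> = (c powr real (length w)) powr \<alpha>" using c by (simp add: powr_realpow)
      also have "\<dots> = r powr real (length w)" unfolding r_def by (simp add: powr_powr mult.commute)
      also have "\<dots> = r ^ length w" using r by (simp add: powr_realpow)
      finally show ?thesis using c \<open>0 \<le> D\<close> by (simp add: powr_mult)
    qed
    finally have "H * dist ?a ?b powr \<alpha> \<le> H * (r ^ length w * D powr \<alpha>)" using H by (rule mult_left_mono)
    then have "h i ?a \<le> h i ?b + d * (E * r ^ length w)"
      using holder[OF i in_X] h(2) by (simp add: E_def ac_simps)
    \<comment> \<open>The lower bound \<open>d \<le> h i ?b\<close> turns the additive error into a
      relative one.\<close>
    also have "\<dots> \<le> h i ?b + h i ?b * (E * r ^ length w)"
      using h(1)[OF i in_X(2)] E r by (intro add_left_mono mult_right_mono) auto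
    also have "\<dots> = h i ?b * (1 + E * r ^ length w)" by (simp add: algebra_simps)
    also have "\<dots> \<le> h i ?b * exp (E * r ^ length w)"
      using h(1)[OF i in_X(2)] h(2) exp_ge_add_one_self[of "E * r ^ length w"] by (intro mult_left_mono) auto
    finally have 1: "h i ?a \<le> h i ?b * exp (E * r ^ length w)" .
    have "cocycle h S (i # w) a \<le> (h i ?b * exp (E * r ^ length w)) *
        (exp (E * (\<Sum>k<length w. r ^ k)) * cocycle h S w b)"
      unfolding cocycle.simps using 1 Cons.IH[OF w] pos[OF w ab(1)] h(1)[OF i in_X(2)] h(2)
      by (intro mult_mono) auto
    also have "\<dots> = exp (E * (\<Sum>k<length (i # w). r ^ k)) * cocycle h S (i # w) b"
      by (simp add: distrib_left exp_add ac_simps)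
    finally show ?case .
  qed simp
  show ?thesis
  proof (rule exI[of _ "exp (E / (1 - r))"], intro conjI allI impI)
    show "1 \<le> exp (E / (1 - r))" using E r by simp
    fix w a b assume w: "set w \<subseteq> I \<and> a \<in> X \<and> b \<in> X"
    have "(\<Sum>k<length w. r ^ k) = (1 - r ^ length w) / (1 - r)"
      using r by (simp add: sum_gp_strict)
    also have "\<dots> \<le> 1 / (1 - r)" using r by (intro divide_right_mono) auto
    finally have "E * (\<Sum>k<length w. r ^ k) \<le> E * (1 / (1 - r))" using E by (rule mult_left_mono)
    then have "exp (E * (\<Sum>k<length w. r ^ k)) * cocycle h S w b \<le> exp (E / (1 - r)) * cocycle h S w b"
      using pos[of w b] w by (intro mult_right_mono) auto
    then show "cocycle h S w a \<le> exp (E / (1 - r)) * cocycle h S w b" using step[of w a b] w by linarith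
  qed
qed

text \<open>The cocycle is exactly multiplicative, but with the first factor based at
  \<open>word_map S v o0\<close>; bounded distortion moves the base point back to
  \<open>o0\<close>.\<close>

lemma cocycle_quasi_multiplicative:
  assumes S: "\<And>i a. i \<in> I \<Longrightarrow> a \<in> X \<Longrightarrow> S i a \<in> X" and o: "o0 \<in> X"
    and pos: "\<And>w a. set w \<subseteq> I \<Longrightarrow> a \<in> X \<Longrightarrow> 0 < cocycle h S w a"
    and K: "1 \<le> K" "\<And>w a b. set w \<subseteq> I \<Longrightarrow> a \<in> X \<Longrightarrow> b \<in> X \<Longrightarrow> cocycle h S w a \<le> K * cocycle h S w b"
  shows "quasi_multiplicative I K (\<lambda>w. cocycle h S w o0)"
  unfolding quasi_multiplicative_def
proof (intro conjI allI impI)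
  fix u v assume uv: "set u \<subseteq> I" "set v \<subseteq> I"
  let ?x = "word_map S v o0"
  have x: "?x \<in> X" using word_map_in[of I X S, OF S uv(2) o] .
  have v: "0 < cocycle h S v o0" using pos uv o by blast
  show "cocycle h S (u @ v) o0 \<le> K * cocycle h S u o0 * cocycle h S v o0"
    unfolding cocycle_append using K(2)[OF uv(1) x o] v by (intro mult_right_mono) auto
  have "cocycle h S u o0 * cocycle h S v o0 \<le> K * cocycle h S u ?x * cocycle h S v o0"
    using K(2)[OF uv(1) o x] v by (intro mult_right_mono) auto
  then show "cocycle h S u o0 * cocycle h S v o0 \<le> K * cocycle h S (u @ v) o0"
    unfolding cocycle_append by (simp add: mult.assoc)
qed (use K(1) pos o in auto)

section \<open>Dominated triangular systems\<close>

lemma unit_square_iff: "a \<in> unit_square \<longleftrightarrow> 0 \<le> a $ 1 \<and> a $ 1 \<le> 1 \<and> 0 \<le> a $ 2 \<and> a $ 2 \<le> 1"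
  by (auto simp: mem_box_cart forall_2)

lemma open_unit_square_iff: "a \<in> open_unit_square \<longleftrightarrow> 0 < a $ 1 \<and> a $ 1 < 1 \<and> 0 < a $ 2 \<and> a $ 2 < 1"
  by (auto simp: mem_box_cart forall_2)

lemma vector_2_axis: "(vector [x, y] :: real ^ 2) = x *\<^sub>R axis 1 1 + y *\<^sub>R axis 2 1"
  by (simp add: vec_eq_iff forall_2 axis_def)

lemma dist_le_components: 
  fixes a b :: "real ^ 2"
  shows "dist a b \<le> \<bar>a $ 1 - b $ 1\<bar> + \<bar>a $ 2 - b $ 2\<bar>"
  unfolding dist_norm using norm_le_l1_cart[of "a - b"] by (simp add: sum_2)

lemma component_le_dist:
  fixes a b :: "real ^ 2"
  shows "\<bar>a $ i - b $ i\<bar> \<le> dist a b"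
  unfolding dist_norm using component_le_norm_cart[of "a - b" i] by simp

lemma unit_square_diameter: "a \<in> unit_square \<Longrightarrow> b \<in> unit_square \<Longrightarrow> dist a b \<le> 2"
  using dist_le_components[of a b] by (auto simp: unit_square_iff)

definition triangular_map :: "real \<Rightarrow> real \<Rightarrow> real \<Rightarrow> real ^ 2 \<Rightarrow> real ^ 2" where
  "triangular_map A B C v = (A * v $ 1) *\<^sub>R axis 1 1 + (B * v $ 1 + C * v $ 2) *\<^sub>R axis 2 1"

lemma triangular_map_nth [simp]:
  "triangular_map A B C v $ 1 = A * v $ 1" "triangular_map A B C v $ 2 = B * v $ 1 + C * v $ 2"
  by (simp_all add: triangular_map_def axis_def)

locale dominated_triangular_ifs =
  fixes \<alpha> :: real and I :: "'i set" and f :: "'i \<Rightarrow> real \<Rightarrow> real" and g :: "'i \<Rightarrow> real ^ 2 \<Rightarrow> real"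
  assumes \<alpha>_pos: "0 < \<alpha>"
    and ifs: "triangular_ifs \<alpha> I f g"
    and dom: "domination I f g"
begin

abbreviation S :: "'i \<Rightarrow> real ^ 2 \<Rightarrow> real ^ 2" where "S \<equiv> ifs_map f g"

abbreviation f_x :: "'i \<Rightarrow> real ^ 2 \<Rightarrow> real" where "f_x i \<equiv> deriv_x (f i)"

abbreviation g_y :: "'i \<Rightarrow> real ^ 2 \<Rightarrow> real" where "g_y i \<equiv> partial_y (g i)"

definition g_x :: "'i \<Rightarrow> real ^ 2 \<Rightarrow> real" where
  "g_x i a = frechet_derivative (g i) (at a within unit_square) (axis 1 1)"

lemma finite_I: "finite I" using ifs by (simp add: triangular_ifs_def)

lemma I_nonempty: "I \<noteq> {}" using ifs by (auto simp: triangular_ifs_def)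

lemma S_nth [simp]: "S i a $ 1 = f i (a $ 1)" "S i a $ 2 = g i a"
  by (simp_all add: ifs_map_def)

lemma S_square: "i \<in> I \<Longrightarrow> a \<in> unit_square \<Longrightarrow> S i a \<in> unit_square"
  using ifs by (auto simp: triangular_ifs_def unit_square_iff Pi_iff)

lemma word_square: "set w \<subseteq> I \<Longrightarrow> a \<in> unit_square \<Longrightarrow> word_map S w a \<in> unit_square"
  using S_square by (rule word_map_in)

lemma contraction_ratio:
  obtains c where "0 < c" "c < 1"
    "\<And>i a b. i \<in> I \<Longrightarrow> a \<in> unit_square \<Longrightarrow> b \<in> unit_square \<Longrightarrow> dist (S i a) (S i b) \<le> c * dist a b"
proof -
  have "\<forall>i\<in>I. \<exists>c<1. c-lipschitz_on unit_square (S i)"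
    using ifs by (auto simp: triangular_ifs_def contraction_on_def)
  then obtain C where C: "\<And>i. i \<in> I \<Longrightarrow> C i < 1" "\<And>i. i \<in> I \<Longrightarrow> (C i)-lipschitz_on unit_square (S i)"
    by (auto simp: bchoice_iff)
  define c where "c = Max (insert (1 / 2) (C ` I))"
  have c: "c < 1" "\<And>i. i \<in> I \<Longrightarrow> C i \<le> c" unfolding c_def using finite_I C(1) by auto
  have c2: "1 / 2 \<le> c" unfolding c_def using finite_I by (intro Max_ge) auto
  show ?thesis
  proof (rule that)
    show "0 < c" "c < 1" using c c2 by auto
    fix i a b assume *: "i \<in> I" "a \<in> unit_square" "b \<in> unit_square"
    have "dist (S i a) (S i b) \<le> C i * dist a b" using lipschitz_onD[OF C(2)] * by blast
    also have "\<dots> \<le> c * dist a b" using c(2) * by (intro mult_right_mono) auto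
    finally show "dist (S i a) (S i b) \<le> c * dist a b" .
  qed
qed

lemma f_deriv:
  assumes "i \<in> I" "a \<in> unit_square"
  shows "(f i has_real_derivative f_x i a) (at (a $ 1) within {0..1})"
proof -
  have "a $ 1 \<in> {0..1}" using assms(2) by (simp add: unit_square_iff)
  then have "f i differentiable (at (a $ 1) within {0..1})"
    using ifs assms(1) unfolding triangular_ifs_def C1_holder_on_def by blast
  then show ?thesis
    by (simp add: vector_derivative_works has_real_derivative_iff_has_vector_derivative deriv_x_def)
qed

lemma g_frechet:
  assumes "i \<in> I" "a \<in> unit_square"
  shows "(g i has_derivative frechet_derivative (g i) (at a within unit_square)) (at a within unit_square)"
proof -
  have "g i differentiable (at a within unit_square)"
    using ifs assms unfolding triangular_ifs_def C1_holder_on_def by blast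
  then show ?thesis by (simp add: frechet_derivative_works)
qed

text \<open>\<open>partial_y\<close> is a derivative along a vertical segment. Expressing it through
  the full derivative makes the Hoelder bound on the latter and the chain rule available.\<close>

lemma g_y_eq:
  assumes i: "i \<in> I" and a: "a \<in> unit_square"
  shows "g_y i a = frechet_derivative (g i) (at a within unit_square) (axis 2 1)"
proof -
  let ?D = "frechet_derivative (g i) (at a within unit_square)"
  let ?l = "\<lambda>t. vector [a $ 1, t] :: real ^ 2"
  have l: "(?l has_derivative (\<lambda>h. h *\<^sub>R axis 2 1)) (at (a $ 2) within {0..1})"
    unfolding vector_2_axis by (auto intro!: derivative_eq_intros)
  have la: "?l (a $ 2) = a" by (simp add: vec_eq_iff forall_2)
  have "?l ` {0..1} \<subseteq> unit_square" using a by (auto simp: unit_square_iff)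
  then have "(g i has_derivative ?D) (at (?l (a $ 2)) within ?l ` {0..1})"
    unfolding la by (rule has_derivative_subset[OF g_frechet[OF i a]])
  from diff_chain_within[OF l this]
  have "((\<lambda>t. g i (?l t)) has_derivative (\<lambda>h. ?D (h *\<^sub>R axis 2 1))) (at (a $ 2) within {0..1})"
    by (simp add: o_def)
  moreover have "(\<lambda>h. ?D (h *\<^sub>R axis 2 1)) = (\<lambda>h. h *\<^sub>R ?D (axis 2 1))"
    using has_derivative_linear[OF g_frechet[OF i a]] by (simp add: linear_cmul)
  ultimately have "((\<lambda>t. g i (?l t)) has_vector_derivative ?D (axis 2 1)) (at (a $ 2) within {0..1})"
    by (simp add: has_vector_derivative_def)
  then show ?thesis unfolding partial_y_def
    using a by (intro vector_derivative_within_closed_interval) (auto simp: unit_square_iff)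
qed

lemma g_deriv:
  assumes i: "i \<in> I" and a: "a \<in> unit_square"
  shows "(g i has_derivative (\<lambda>v. g_x i a * v $ 1 + g_y i a * v $ 2)) (at a within unit_square)"
proof -
  let ?D = "frechet_derivative (g i) (at a within unit_square)"
  have lin: "linear ?D" using g_frechet[OF i a] by (rule has_derivative_linear)
  have "?D v = g_x i a * v $ 1 + g_y i a * v $ 2" for v
  proof -
    have "v = v $ 1 *\<^sub>R axis 1 1 + v $ 2 *\<^sub>R axis 2 1" by (simp add: vec_eq_iff forall_2 axis_def)
    then have "?D v = ?D (v $ 1 *\<^sub>R axis 1 1 + v $ 2 *\<^sub>R axis 2 1)" by simp
    also have "\<dots> = v $ 1 * ?D (axis 1 1) + v $ 2 * ?D (axis 2 1)"
      using lin by (simp add: linear_add linear_cmul)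
    finally show ?thesis by (simp add: g_x_def g_y_eq[OF i a] mult.commute)
  qed
  then have "?D = (\<lambda>v. g_x i a * v $ 1 + g_y i a * v $ 2)" by (rule ext)
  then show ?thesis using g_frechet[OF i a] by simp
qed

lemma S_deriv:
  assumes i: "i \<in> I" and a: "a \<in> unit_square"
  shows "(S i has_derivative triangular_map (f_x i a) (g_x i a) (g_y i a)) (at a within unit_square)"
proof -
  have x: "((\<lambda>a. a $ 1) has_derivative (\<lambda>v. v $ 1)) (at a within unit_square)"
    by (rule bounded_linear_imp_has_derivative) (rule bounded_linear_vec_nth)
  have "(\<lambda>a. a $ 1) ` unit_square \<subseteq> {0..1}" by (auto simp: unit_square_iff)
  moreover have "(f i has_derivative (\<lambda>h. f_x i a * h)) (at (a $ 1) within {0..1})"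
    using f_deriv[OF i a] by (simp add: has_field_derivative_def)
  ultimately have "(f i has_derivative (\<lambda>h. f_x i a * h)) (at (a $ 1) within (\<lambda>a. a $ 1) ` unit_square)"
    by (metis has_derivative_subset)
  from diff_chain_within[OF x this]
  have f: "((\<lambda>a. f i (a $ 1)) has_derivative (\<lambda>v. f_x i a * v $ 1)) (at a within unit_square)"
    by (simp add: o_def)
  have "S i = (\<lambda>a. f i (a $ 1) *\<^sub>R axis 1 1 + g i a *\<^sub>R axis 2 1)"
    unfolding ifs_map_def vector_2_axis ..
  moreover have "((\<lambda>a. f i (a $ 1) *\<^sub>R axis 1 1 + g i a *\<^sub>R axis 2 1 :: real ^ 2) has_derivative
      triangular_map (f_x i a) (g_x i a) (g_y i a)) (at a within unit_square)"
    unfolding triangular_map_def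
    by (intro has_derivative_add has_derivative_scaleR_left f g_deriv i a)
  ultimately show ?thesis by simp
qed

text \<open>The operator norm bounds in \<open>C1_holder_on\<close> are evaluated on unit vectors,
  and one constant is taken for all maps.\<close>

lemma derivative_holder:
  obtains H where "0 \<le> H"
    "\<And>i a b. i \<in> I \<Longrightarrow> a \<in> unit_square \<Longrightarrow> b \<in> unit_square \<Longrightarrow> \<bar>f_x i a - f_x i b\<bar> \<le> H * dist a b powr \<alpha>"
    "\<And>i a b. i \<in> I \<Longrightarrow> a \<in> unit_square \<Longrightarrow> b \<in> unit_square \<Longrightarrow> \<bar>g_x i a - g_x i b\<bar> \<le> H * dist a b powr \<alpha>"
    "\<And>i a b. i \<in> I \<Longrightarrow> a \<in> unit_square \<Longrightarrow> b \<in> unit_square \<Longrightarrow> \<bar>g_y i a - g_y i b\<bar> \<le> H * dist a b powr \<alpha>"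
proof -
  have "\<forall>i\<in>I. \<exists>H. \<forall>x\<in>{0..1}. \<forall>y\<in>{0..1}.
      onorm (\<lambda>v. frechet_derivative (f i) (at x within {0..1}) v - frechet_derivative (f i) (at y within {0..1}) v)
        \<le> H * dist x y powr \<alpha>"
    using ifs by (auto simp: triangular_ifs_def C1_holder_on_def)
  then obtain Hf where Hf: "\<And>i x y. i \<in> I \<Longrightarrow> x \<in> {0..1} \<Longrightarrow> y \<in> {0..1} \<Longrightarrow>
      onorm (\<lambda>v. frechet_derivative (f i) (at x within {0..1}) v - frechet_derivative (f i) (at y within {0..1}) v)
        \<le> Hf i * dist x y powr \<alpha>"
    unfolding bchoice_iff by blast
  have "\<forall>i\<in>I. \<exists>H. \<forall>x\<in>unit_square. \<forall>y\<in>unit_square.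
      onorm (\<lambda>v. frechet_derivative (g i) (at x within unit_square) v - frechet_derivative (g i) (at y within unit_square) v)
        \<le> H * dist x y powr \<alpha>"
    using ifs by (simp add: triangular_ifs_def C1_holder_on_def del: mem_box)
  then obtain Hg where Hg: "\<And>i x y. i \<in> I \<Longrightarrow> x \<in> unit_square \<Longrightarrow> y \<in> unit_square \<Longrightarrow>
      onorm (\<lambda>v. frechet_derivative (g i) (at x within unit_square) v - frechet_derivative (g i) (at y within unit_square) v)
        \<le> Hg i * dist x y powr \<alpha>"
    unfolding bchoice_iff by blast
  define H where "H = (\<Sum>i\<in>I. \<bar>Hf i\<bar> + \<bar>Hg i\<bar>)"
  have le: "Hf i \<le> H" "Hg i \<le> H" if "i \<in> I" for i
  proof -
    have "\<bar>Hf i\<bar> + \<bar>Hg i\<bar> \<le> H" unfolding H_def using that finite_I by (intro member_le_sum) auto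
    then show "Hf i \<le> H" "Hg i \<le> H" by linarith+
  qed
  show ?thesis
  proof (rule that)
    show "0 \<le> H" unfolding H_def by (intro sum_nonneg) auto
    fix i and a b :: "real ^ 2" assume i: "i \<in> I" and ab: "a \<in> unit_square" "b \<in> unit_square"
    have x: "a $ 1 \<in> {0..1}" "b $ 1 \<in> {0..1}" using ab by (auto simp: unit_square_iff)
    let ?Df = "\<lambda>t. frechet_derivative (f i) (at t within {0..1})"
    have fd: "?Df (c $ 1) = (\<lambda>h. f_x i c * h) \<and> bounded_linear (?Df (c $ 1))" if c: "c \<in> unit_square" for c :: "real ^ 2"
    proof -
      have "(f i has_derivative (\<lambda>h. f_x i c * h)) (at (c $ 1) within cbox 0 1)"
        using f_deriv[OF i c] by (simp add: has_field_derivative_def)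
      moreover have "c $ 1 \<in> cbox 0 1" using c by (simp add: unit_square_iff)
      ultimately have "frechet_derivative (f i) (at (c $ 1) within cbox 0 1) = (\<lambda>h. f_x i c * h)"
        by (intro frechet_derivative_within_cbox) auto
      then show ?thesis by (simp add: bounded_linear_mult_right)
    qed
    have "\<bar>f_x i a - f_x i b\<bar> \<le> onorm (\<lambda>v. ?Df (a $ 1) v - ?Df (b $ 1) v) * norm (1::real)"
      using onorm[OF bounded_linear_sub[of "?Df (a $ 1)" "?Df (b $ 1)"], of 1] fd[OF ab(1)] fd[OF ab(2)]
      by (simp add: bounded_linear_mult_right)
    also have "\<dots> \<le> Hf i * dist (a $ 1) (b $ 1) powr \<alpha>" using Hf[OF i x] by simp
    also have "\<dots> \<le> H * dist a b powr \<alpha>"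
    proof (rule mult_mono)
      show "dist (a $ 1) (b $ 1) powr \<alpha> \<le> dist a b powr \<alpha>"
        using component_le_dist[of a 1 b] \<alpha>_pos by (intro powr_mono2) (auto simp: dist_real_def)
    qed (use le[OF i] \<open>0 \<le> H\<close> in auto)
    finally show "\<bar>f_x i a - f_x i b\<bar> \<le> H * dist a b powr \<alpha>" .
    let ?D = "\<lambda>c. frechet_derivative (g i) (at c within unit_square)"
    have bl: "bounded_linear (\<lambda>v. ?D a v - ?D b v)"
      using has_derivative_bounded_linear[OF g_frechet[OF i ab(1)]]
        has_derivative_bounded_linear[OF g_frechet[OF i ab(2)]] by (rule bounded_linear_sub)
    have *: "\<bar>?D a (axis k 1) - ?D b (axis k 1)\<bar> \<le> H * dist a b powr \<alpha>" for k
    proof -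
      have "\<bar>?D a (axis k 1) - ?D b (axis k 1)\<bar> \<le> onorm (\<lambda>v. ?D a v - ?D b v) * norm (axis k (1::real))"
        using onorm[OF bl, of "axis k 1"] by simp
      also have "\<dots> \<le> Hg i * dist a b powr \<alpha>" using Hg[OF i ab] by simp
      also have "\<dots> \<le> H * dist a b powr \<alpha>" using le[OF i] by (intro mult_right_mono) auto
      finally show ?thesis .
    qed
    show "\<bar>g_x i a - g_x i b\<bar> \<le> H * dist a b powr \<alpha>" unfolding g_x_def by (rule *)
    show "\<bar>g_y i a - g_y i b\<bar> \<le> H * dist a b powr \<alpha>"
      unfolding g_y_eq[OF i ab(1)] g_y_eq[OF i ab(2)] by (rule *)
  qed
qed

text \<open>The infima and suprema in \<open>domination\<close> carry information only for bounded
  families. Hoelder continuity on a set of diameter at most 2 provides the boundedness.\<close>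

lemma holder_bounded:
  fixes h :: "real ^ 2 \<Rightarrow> real"
  assumes "\<And>a b. a \<in> unit_square \<Longrightarrow> b \<in> unit_square \<Longrightarrow> \<bar>h a - h b\<bar> \<le> H * dist a b powr \<alpha>" "0 \<le> H"
    and "a \<in> unit_square"
  shows "\<bar>h a\<bar> \<le> \<bar>h 0\<bar> + H * 2 powr \<alpha>"
proof -
  have z: "(0 :: real ^ 2) \<in> unit_square" by (simp add: unit_square_iff)
  have "\<bar>h a - h 0\<bar> \<le> H * dist a 0 powr \<alpha>" using assms z by blast
  also have "\<dots> \<le> H * 2 powr \<alpha>"
    using unit_square_diameter[OF assms(3) z] \<alpha>_pos assms(2) by (intro mult_left_mono powr_mono2) auto
  finally show ?thesis by linarith
qed

text \<open>As I is finite, the strict inequalities combine into one ratio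
  \<open>\<theta> < 1\<close>. The two sides may be taken at different points because domination
  compares a supremum with an infimum.\<close>

lemma domination_bounds:
  obtains d \<theta> B where "0 < d" "0 < \<theta>" "\<theta> < 1" "0 \<le> B"
    "\<And>i a. i \<in> I \<Longrightarrow> a \<in> unit_square \<Longrightarrow> d \<le> g_y i a"
    "\<And>i a b. i \<in> I \<Longrightarrow> a \<in> unit_square \<Longrightarrow> b \<in> unit_square \<Longrightarrow> g_y i a \<le> \<theta> * f_x i b"
    "\<And>i a. i \<in> I \<Longrightarrow> a \<in> unit_square \<Longrightarrow> \<bar>g_x i a\<bar> \<le> B"
proof -
  obtain H where H: "0 \<le> H"
    "\<And>i a b. i \<in> I \<Longrightarrow> a \<in> unit_square \<Longrightarrow> b \<in> unit_square \<Longrightarrow> \<bar>f_x i a - f_x i b\<bar> \<le> H * dist a b powr \<alpha>"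
    "\<And>i a b. i \<in> I \<Longrightarrow> a \<in> unit_square \<Longrightarrow> b \<in> unit_square \<Longrightarrow> \<bar>g_x i a - g_x i b\<bar> \<le> H * dist a b powr \<alpha>"
    "\<And>i a b. i \<in> I \<Longrightarrow> a \<in> unit_square \<Longrightarrow> b \<in> unit_square \<Longrightarrow> \<bar>g_y i a - g_y i b\<bar> \<le> H * dist a b powr \<alpha>"
    using derivative_holder by blast
  have bf: "\<bar>f_x i a\<bar> \<le> \<bar>f_x i 0\<bar> + H * 2 powr \<alpha>"
    and bx: "\<bar>g_x i a\<bar> \<le> \<bar>g_x i 0\<bar> + H * 2 powr \<alpha>"
    and bg: "\<bar>g_y i a\<bar> \<le> \<bar>g_y i 0\<bar> + H * 2 powr \<alpha>" if "i \<in> I" "a \<in> unit_square" for i a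
    using holder_bounded[OF H(2)] holder_bounded[OF H(3)] holder_bounded[OF H(4)] H(1) that by blast+
  define m where "m i = (INF a\<in>unit_square. f_x i a)" for i
  define M where "M i = (SUP a\<in>unit_square. g_y i a)" for i
  obtain d where d: "0 < d" "\<And>i. i \<in> I \<Longrightarrow> M i < m i"
    "\<And>i. i \<in> I \<Longrightarrow> d \<le> (INF a\<in>unit_square. g_y i a)"
    using dom unfolding domination_def m_def M_def by blast
  have inf_f: "m i \<le> f_x i a" and sup_g: "g_y i a \<le> M i" and inf_g: "d \<le> g_y i a"
    if i: "i \<in> I" and a: "a \<in> unit_square" for i a
  proof -
    have "bdd_below (f_x i ` unit_square)"
    proof (rule bdd_belowI2)
      show "- (\<bar>f_x i 0\<bar> + H * 2 powr \<alpha>) \<le> f_x i a" if "a \<in> unit_square" for a using bf[OF i that] by linarith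
    qed
    then show "m i \<le> f_x i a" unfolding m_def using a by (intro cINF_lower)
    have "bdd_above (g_y i ` unit_square)"
    proof (rule bdd_aboveI2)
      show "g_y i a \<le> \<bar>g_y i 0\<bar> + H * 2 powr \<alpha>" if "a \<in> unit_square" for a using bg[OF i that] by linarith
    qed
    then show "g_y i a \<le> M i" unfolding M_def using a by (intro cSUP_upper)
    have "bdd_below (g_y i ` unit_square)"
    proof (rule bdd_belowI2)
      show "- (\<bar>g_y i 0\<bar> + H * 2 powr \<alpha>) \<le> g_y i a" if "a \<in> unit_square" for a using bg[OF i that] by linarith
    qed
    then have "(INF a\<in>unit_square. g_y i a) \<le> g_y i a" using a by (intro cINF_lower)
    then show "d \<le> g_y i a" using d(3)[OF i] by linarith
  qed
  have z: "(0 :: real ^ 2) \<in> unit_square" by (simp add: unit_square_iff)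
  have M: "0 < M i" if "i \<in> I" for i using inf_g[OF that z] sup_g[OF that z] d(1) by linarith
  have m: "0 < m i" if "i \<in> I" for i using M[OF that] d(2)[OF that] by linarith
  define \<theta> where "\<theta> = Max ((\<lambda>i. M i / m i) ` I)"
  have "\<theta> \<in> (\<lambda>i. M i / m i) ` I" unfolding \<theta>_def using finite_I I_nonempty by (intro Max_in) auto
  then obtain j where j: "j \<in> I" "\<theta> = M j / m j" by blast
  have \<theta>: "0 < \<theta>" "\<theta> < 1" unfolding j(2) using M[OF j(1)] m[OF j(1)] d(2)[OF j(1)] by simp_all
  have \<theta>_ge: "M i / m i \<le> \<theta>" if "i \<in> I" for i unfolding \<theta>_def using that finite_I by (intro Max_ge) auto
  define B where "B = (\<Sum>i\<in>I. \<bar>g_x i 0\<bar> + H * 2 powr \<alpha>)"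
  show ?thesis
  proof (rule that[OF d(1) \<theta>])
    show "0 \<le> B" unfolding B_def using H(1) by (intro sum_nonneg) auto
    show "d \<le> g_y i a" if "i \<in> I" "a \<in> unit_square" for i a using inf_g that .
    show "g_y i a \<le> \<theta> * f_x i b" if i: "i \<in> I" and ab: "a \<in> unit_square" "b \<in> unit_square" for i a b
    proof -
      have "g_y i a \<le> M i / m i * m i" using sup_g[OF i ab(1)] m[OF i] by simp
      also have "\<dots> \<le> \<theta> * f_x i b"
        using \<theta>_ge[OF i] inf_f[OF i ab(2)] m[OF i] \<theta> by (intro mult_mono) auto
      finally show ?thesis .
    qed
    show "\<bar>g_x i a\<bar> \<le> B" if i: "i \<in> I" and a: "a \<in> unit_square" for i a
    proof -
      have "\<bar>g_x i 0\<bar> + H * 2 powr \<alpha> \<le> B" unfolding B_def using H(1) i finite_I by (intro member_le_sum) auto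
      then show ?thesis using bx[OF i a] by linarith
    qed
  qed
qed

abbreviation fword :: "'i list \<Rightarrow> real ^ 2 \<Rightarrow> real" where "fword \<equiv> cocycle f_x S"

abbreviation gword :: "'i list \<Rightarrow> real ^ 2 \<Rightarrow> real" where "gword \<equiv> cocycle g_y S"

text \<open>The lower left entry of the product of the triangular derivatives, by the chain
  rule.\<close>

primrec shear :: "'i list \<Rightarrow> real ^ 2 \<Rightarrow> real" where
  "shear [] a = 0"
| "shear (i # w) a = g_x i (word_map S w a) * fword w a + g_y i (word_map S w a) * shear w a"

lemma word_deriv:
  assumes "set w \<subseteq> I" and a: "a \<in> unit_square"
  shows "(word_map S w has_derivative triangular_map (fword w a) (shear w a) (gword w a)) (at a within unit_square)"
  using assms(1)
proof (induction w)
  case Nil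
  have "triangular_map 1 0 1 = (\<lambda>v. v)" by (rule ext) (simp add: vec_eq_iff forall_2)
  then show ?case by (simp add: id_def)
next
  case (Cons i w)
  then have i: "i \<in> I" and w: "set w \<subseteq> I" by auto
  let ?b = "word_map S w a"
  have "word_map S w ` unit_square \<subseteq> unit_square" using word_square[OF w] by blast
  then have "(S i has_derivative triangular_map (f_x i ?b) (g_x i ?b) (g_y i ?b)) (at ?b within word_map S w ` unit_square)"
    by (rule has_derivative_subset[OF S_deriv[OF i word_square[OF w a]]])
  from diff_chain_within[OF Cons.IH[OF w] this]
  have "(word_map S (i # w) has_derivative
      triangular_map (f_x i ?b) (g_x i ?b) (g_y i ?b) \<circ> triangular_map (fword w a) (shear w a) (gword w a))
      (at a within unit_square)" by simp
  moreover have "triangular_map (f_x i ?b) (g_x i ?b) (g_y i ?b) \<circ> triangular_map (fword w a) (shear w a) (gword w a)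
      = triangular_map (fword (i # w) a) (shear (i # w) a) (gword (i # w) a)"
    by (rule ext) (simp add: vec_eq_iff forall_2 algebra_simps)
  ultimately show ?case by (simp only:)
qed

lemma word_jacobian:
  assumes w: "set w \<subseteq> I" and a: "a \<in> unit_square"
  defines "D \<equiv> jacobian (word_map S w) (at a within unit_square)"
  shows "D $ 1 $ 1 = fword w a" "D $ 1 $ 2 = 0" "D $ 2 $ 1 = shear w a" "D $ 2 $ 2 = gword w a"
proof -
  have "frechet_derivative (word_map S w) (at a within unit_square) =
      triangular_map (fword w a) (shear w a) (gword w a)"
    using a word_deriv[OF w a] by (intro frechet_derivative_within_cbox) (auto simp: Basis_vec_def inner_axis)
  then have D: "D = matrix (triangular_map (fword w a) (shear w a) (gword w a))"
    by (simp add: D_def jacobian_def)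
  show "D $ 1 $ 1 = fword w a" "D $ 1 $ 2 = 0" "D $ 2 $ 1 = shear w a" "D $ 2 $ 2 = gword w a"
    unfolding D matrix_def by (simp_all add: axis_def)
qed

text \<open>The mean value theorem along the segment from b to a, separately for each coordinate,
  since the intermediate points differ in general.\<close>

lemma word_mean_value:
  assumes w: "set w \<subseteq> I" and ab: "a \<in> unit_square" "b \<in> unit_square"
  shows "\<exists>\<xi>\<in>unit_square. word_map S w a $ 1 - word_map S w b $ 1 = fword w \<xi> * (a $ 1 - b $ 1)"
    "\<exists>\<xi>\<in>unit_square. word_map S w a $ 2 - word_map S w b $ 2 =
      shear w \<xi> * (a $ 1 - b $ 1) + gword w \<xi> * (a $ 2 - b $ 2)"
proof -
  let ?l = "\<lambda>t. b + t *\<^sub>R (a - b)"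
  have l_in: "?l t \<in> unit_square" if "0 \<le> t" "t \<le> 1" for t
  proof -
    have "?l t = (1 - t) *\<^sub>R b + t *\<^sub>R a" by (simp add: algebra_simps)
    then show ?thesis using convexD_alt[OF convex_box(1) ab(2,1) that] by simp
  qed
  have *: "\<exists>\<xi>\<in>unit_square. word_map S w a $ k - word_map S w b $ k =
      triangular_map (fword w \<xi>) (shear w \<xi>) (gword w \<xi>) (a - b) $ k" for k
  proof -
    let ?T = "\<lambda>t. triangular_map (fword w (?l t)) (shear w (?l t)) (gword w (?l t))"
    have "((\<lambda>t. word_map S w (?l t) $ k) has_derivative (\<lambda>h. ?T t (h *\<^sub>R (a - b)) $ k)) (at t within {0..1})"
      if t: "0 \<le> t" "t \<le> 1" for t
    proof -
      have l: "(?l has_derivative (\<lambda>h. h *\<^sub>R (a - b))) (at t within {0..1})"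
        by (auto intro!: derivative_eq_intros)
      have "?l ` {0..1} \<subseteq> unit_square" using l_in by auto
      then have "(word_map S w has_derivative ?T t) (at (?l t) within ?l ` {0..1})"
        by (rule has_derivative_subset[OF word_deriv[OF w l_in[OF t]]])
      from diff_chain_within[OF l this] show ?thesis
        by (simp add: o_def bounded_linear.has_derivative[OF bounded_linear_vec_nth])
    qed
    then obtain t where t: "t \<in> {0..1}"
      "word_map S w (?l 1) $ k - word_map S w (?l 0) $ k = ?T t ((1 - 0) *\<^sub>R (a - b)) $ k"
      using mvt_very_simple[of 0 1 "\<lambda>t. word_map S w (?l t) $ k" "\<lambda>t h. ?T t (h *\<^sub>R (a - b)) $ k"] by auto
    then show ?thesis using l_in[of t] by auto
  qed
  show "\<exists>\<xi>\<in>unit_square. word_map S w a $ 1 - word_map S w b $ 1 = fword w \<xi> * (a $ 1 - b $ 1)"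
    using *[of 1] by simp
  show "\<exists>\<xi>\<in>unit_square. word_map S w a $ 2 - word_map S w b $ 2 =
      shear w \<xi> * (a $ 1 - b $ 1) + gword w \<xi> * (a $ 2 - b $ 2)"
    using *[of 2] by simp
qed

abbreviation F :: "'i list \<Rightarrow> real" where "F w \<equiv> fword w 0"

abbreviation G :: "'i list \<Rightarrow> real" where "G w \<equiv> gword w 0"

lemma zero_in_square: "(0 :: real ^ 2) \<in> unit_square" by (simp add: unit_square_iff)

lemma cocycle_bounds:
  obtains K where "1 \<le> K"
    "\<And>w a. set w \<subseteq> I \<Longrightarrow> a \<in> unit_square \<Longrightarrow> 0 < fword w a"
    "\<And>w a. set w \<subseteq> I \<Longrightarrow> a \<in> unit_square \<Longrightarrow> 0 < gword w a"
    "\<And>w a. set w \<subseteq> I \<Longrightarrow> a \<in> unit_square \<Longrightarrow> gword w a \<le> fword w a"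
    "\<And>w a. set w \<subseteq> I \<Longrightarrow> a \<in> unit_square \<Longrightarrow> \<bar>shear w a\<bar> \<le> K * fword w a"
    "\<And>w a b. set w \<subseteq> I \<Longrightarrow> a \<in> unit_square \<Longrightarrow> b \<in> unit_square \<Longrightarrow> fword w a \<le> K * fword w b"
    "\<And>w a b. set w \<subseteq> I \<Longrightarrow> a \<in> unit_square \<Longrightarrow> b \<in> unit_square \<Longrightarrow> gword w a \<le> K * gword w b"
proof -
  obtain H where H: "0 \<le> H"
    "\<And>i a b. i \<in> I \<Longrightarrow> a \<in> unit_square \<Longrightarrow> b \<in> unit_square \<Longrightarrow> \<bar>f_x i a - f_x i b\<bar> \<le> H * dist a b powr \<alpha>"
    "\<And>i a b. i \<in> I \<Longrightarrow> a \<in> unit_square \<Longrightarrow> b \<in> unit_square \<Longrightarrow> \<bar>g_x i a - g_x i b\<bar> \<le> H * dist a b powr \<alpha>"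
    "\<And>i a b. i \<in> I \<Longrightarrow> a \<in> unit_square \<Longrightarrow> b \<in> unit_square \<Longrightarrow> \<bar>g_y i a - g_y i b\<bar> \<le> H * dist a b powr \<alpha>"
    using derivative_holder by blast
  obtain d \<theta> B where d: "0 < d" and \<theta>: "0 < \<theta>" "\<theta> < 1" and B: "0 \<le> B"
    and gd: "\<And>i a. i \<in> I \<Longrightarrow> a \<in> unit_square \<Longrightarrow> d \<le> g_y i a"
    and gf: "\<And>i a b. i \<in> I \<Longrightarrow> a \<in> unit_square \<Longrightarrow> b \<in> unit_square \<Longrightarrow> g_y i a \<le> \<theta> * f_x i b"
    and gB: "\<And>i a. i \<in> I \<Longrightarrow> a \<in> unit_square \<Longrightarrow> \<bar>g_x i a\<bar> \<le> B"
    by (rule domination_bounds) blast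
  obtain c where c: "0 < c" "c < 1"
    "\<And>i a b. i \<in> I \<Longrightarrow> a \<in> unit_square \<Longrightarrow> b \<in> unit_square \<Longrightarrow> dist (S i a) (S i b) \<le> c * dist a b"
    using contraction_ratio by blast
  have gf': "g_y i a \<le> f_x i a \<and> d \<le> f_x i a" if ia: "i \<in> I" "a \<in> unit_square" for i a
  proof -
    have "0 < \<theta> * f_x i a" using gf[OF ia ia(2)] gd[OF ia] d by linarith
    then have "0 < f_x i a" using \<theta> by (simp add: zero_less_mult_iff)
    then have "\<theta> * f_x i a \<le> 1 * f_x i a" using \<theta> by (intro mult_right_mono) auto
    then show ?thesis using gf[OF ia ia(2)] gd[OF ia] by linarith
  qed
  have fpos: "0 < fword w a" and gpos: "0 < gword w a" and gle: "gword w a \<le> fword w a"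
    if w: "set w \<subseteq> I" and a: "a \<in> unit_square" for w a
  proof -
    have "0 < fword w a \<and> 0 < gword w a \<and> gword w a \<le> fword w a"
      using w
    proof (induction w)
      case (Cons i w)
      then have *: "i \<in> I" "word_map S w a \<in> unit_square" using word_square[of w a] a by auto
      then show ?case using Cons gf'[OF *] gd[OF *] d by (auto intro!: mult_pos_pos mult_mono)
    qed simp
    then show "0 < fword w a" "0 < gword w a" "gword w a \<le> fword w a" by auto
  qed
  have f_x_lower: "d \<le> f_x i a" if "i \<in> I" "a \<in> unit_square" for i a using gf'[OF that] by blast
  have "\<exists>K\<ge>1. \<forall>w a b. set w \<subseteq> I \<and> a \<in> unit_square \<and> b \<in> unit_square \<longrightarrow> fword w a \<le> K * fword w b"
    by (rule cocycle_distortion[OF S_square c(3) c(1,2) f_x_lower d H(2) \<alpha>_pos H(1) unit_square_diameter])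
  then obtain K1 where K1: "K1 \<ge> 1"
    "\<And>w a b. set w \<subseteq> I \<Longrightarrow> a \<in> unit_square \<Longrightarrow> b \<in> unit_square \<Longrightarrow> fword w a \<le> K1 * fword w b"
    by blast
  have g_y_lower: "d \<le> g_y i a" if "i \<in> I" "a \<in> unit_square" for i a using gd[OF that] by blast
  have "\<exists>K\<ge>1. \<forall>w a b. set w \<subseteq> I \<and> a \<in> unit_square \<and> b \<in> unit_square \<longrightarrow> gword w a \<le> K * gword w b"
    by (rule cocycle_distortion[OF S_square c(3) c(1,2) g_y_lower d H(4) \<alpha>_pos H(1) unit_square_diameter])
  then obtain K2 where K2: "K2 \<ge> 1"
    "\<And>w a b. set w \<subseteq> I \<Longrightarrow> a \<in> unit_square \<Longrightarrow> b \<in> unit_square \<Longrightarrow> gword w a \<le> K2 * gword w b"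
    by blast
  \<comment> \<open>The fixed point of \<open>x = B / d + \<theta> * x\<close>. The ratio of shear
    to width satisfies this recursion as an inequality: \<open>B / d\<close> bounds the shear added
    by a letter relative to the new width, and domination lets only the fraction \<theta> of the old
    ratio survive.\<close>
  define K3 where "K3 = B / (d * (1 - \<theta>))"
  have K3: "0 \<le> K3" unfolding K3_def using B d \<theta> by simp
  have shear: "\<bar>shear w a\<bar> \<le> K3 * fword w a" if w: "set w \<subseteq> I" and a: "a \<in> unit_square" for w a
    using w
  proof (induction w)
    case (Cons i w)
    let ?b = "word_map S w a"
    have i: "i \<in> I" "?b \<in> unit_square" and w: "set w \<subseteq> I" using Cons.prems word_square[of w a] a by auto
    have "\<bar>shear (i # w) a\<bar> \<le> \<bar>g_x i ?b\<bar> * fword w a + g_y i ?b * \<bar>shear w a\<bar>"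
      using abs_triangle_ineq[of "g_x i ?b * fword w a" "g_y i ?b * shear w a"] fpos[OF w a] gd[OF i] d
      by (simp add: abs_mult)
    also have "\<dots> \<le> B * fword w a + (\<theta> * f_x i ?b) * (K3 * fword w a)"
      using gB[OF i] gf[OF i i(2)] Cons.IH[OF w] fpos[OF w a] gf'[OF i] \<theta> d
      by (intro add_mono mult_mono mult_nonneg_nonneg) auto
    also have "B * fword w a \<le> (1 - \<theta>) * K3 * (f_x i ?b * fword w a)"
    proof -
      have "B = (1 - \<theta>) * K3 * d" unfolding K3_def using d \<theta> by simp
      also have "\<dots> \<le> (1 - \<theta>) * K3 * f_x i ?b" using gf'[OF i] K3 \<theta> by (intro mult_left_mono) auto
      finally have "B * fword w a \<le> (1 - \<theta>) * K3 * f_x i ?b * fword w a"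
        using fpos[OF w a] by (intro mult_right_mono) auto
      then show ?thesis by (simp add: mult.assoc)
    qed
    finally show ?case by (simp add: algebra_simps)
  qed (simp add: K3)
  define K where "K = K1 + K2 + K3"
  have K: "K1 \<le> K" "K2 \<le> K" "K3 \<le> K" using K1(1) K2(1) K3 by (auto simp: K_def)
  show ?thesis
  proof (rule that[of K])
    show "1 \<le> K" using K(1) K1(1) by linarith
    fix w a assume w: "set w \<subseteq> I" and a: "a \<in> unit_square"
    show "0 < fword w a" "0 < gword w a" "gword w a \<le> fword w a" using fpos gpos gle w a by blast+
    have "K3 * fword w a \<le> K * fword w a" using K fpos[OF w a] by (intro mult_right_mono) auto
    then show "\<bar>shear w a\<bar> \<le> K * fword w a" using shear[OF w a] by linarith
  next
    fix w a b assume w: "set w \<subseteq> I" and a: "a \<in> unit_square" and b: "b \<in> unit_square"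
    have "K1 * fword w b \<le> K * fword w b" using K fpos[OF w b] by (intro mult_right_mono) auto
    then show "fword w a \<le> K * fword w b" using K1(2)[OF w a b] by linarith
    have "K2 * gword w b \<le> K * gword w b" using K gpos[OF w b] by (intro mult_right_mono) auto
    then show "gword w a \<le> K * gword w b" using K2(2)[OF w a b] by linarith
  qed
qed

text \<open>The horizontal mean value formula gives equal first coordinates. This removes the shear
  from the vertical formula, where only a positive factor is left.\<close>

lemma S_inj:
  assumes "i \<in> I"
  shows "inj_on (S i) unit_square"
proof (rule inj_onI)
  fix a b assume ab: "a \<in> unit_square" "b \<in> unit_square" "S i a = S i b"
  obtain K where pos: "\<And>w a. set w \<subseteq> I \<Longrightarrow> a \<in> unit_square \<Longrightarrow> 0 < fword w a"
    "\<And>w a. set w \<subseteq> I \<Longrightarrow> a \<in> unit_square \<Longrightarrow> 0 < gword w a" by (rule cocycle_bounds) blast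
  have i: "set [i] \<subseteq> I" using assms by simp
  have eq: "word_map S [i] a = word_map S [i] b" using ab(3) by simp
  obtain \<xi> where "\<xi> \<in> unit_square" "word_map S [i] a $ 1 - word_map S [i] b $ 1 = fword [i] \<xi> * (a $ 1 - b $ 1)"
    using word_mean_value(1)[OF i ab(1,2)] by blast
  then have 1: "a $ 1 = b $ 1" using pos(1)[OF i, of \<xi>] unfolding eq by simp
  obtain \<xi> where "\<xi> \<in> unit_square" "word_map S [i] a $ 2 - word_map S [i] b $ 2 =
      shear [i] \<xi> * (a $ 1 - b $ 1) + gword [i] \<xi> * (a $ 2 - b $ 2)"
    using word_mean_value(2)[OF i ab(1,2)] by blast
  then have "a $ 2 = b $ 2" using pos(2)[OF i, of \<xi>] 1 unfolding eq by simp
  with 1 show "a = b" by (simp add: vec_eq_iff forall_2)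
qed

text \<open>The smaller singular value is recovered from the larger one and the determinant. The
  last two bounds are signed, because intermediate value arguments rest on monotone dependence on
  each coordinate.\<close>

lemma word_geometry:
  obtains K where "1 \<le> K"
    "\<And>w. set w \<subseteq> I \<Longrightarrow> G w \<le> F w"
    "quasi_multiplicative I K F" "quasi_multiplicative I K G"
    "\<And>w a b. set w \<subseteq> I \<Longrightarrow> a \<in> unit_square \<Longrightarrow> b \<in> unit_square \<Longrightarrow>
      F w * \<bar>a $ 1 - b $ 1\<bar> \<le> K * \<bar>word_map S w a $ 1 - word_map S w b $ 1\<bar>"
    "\<And>w a b. set w \<subseteq> I \<Longrightarrow> a \<in> unit_square \<Longrightarrow> b \<in> unit_square \<Longrightarrow>
      \<bar>word_map S w a $ 1 - word_map S w b $ 1\<bar> \<le> K * (F w * \<bar>a $ 1 - b $ 1\<bar>)"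
    "\<And>w a b. set w \<subseteq> I \<Longrightarrow> a \<in> unit_square \<Longrightarrow> b \<in> unit_square \<Longrightarrow>
      \<bar>word_map S w a $ 2 - word_map S w b $ 2\<bar> \<le> K * (F w * \<bar>a $ 1 - b $ 1\<bar> + G w * \<bar>a $ 2 - b $ 2\<bar>)"
    "\<And>w a. set w \<subseteq> I \<Longrightarrow> a \<in> unit_square \<Longrightarrow>
      (let D = jacobian (word_map S w) (at a within unit_square) in
        0 < \<alpha>\<^sub>1 D \<and> \<alpha>\<^sub>1 D \<le> K * F w \<and> F w \<le> K * \<alpha>\<^sub>1 D \<and> 0 < \<alpha>\<^sub>2 D \<and> \<alpha>\<^sub>2 D \<le> K * G w \<and> G w \<le> K * \<alpha>\<^sub>2 D)"
    "\<And>w a b. set w \<subseteq> I \<Longrightarrow> a \<in> unit_square \<Longrightarrow> b \<in> unit_square \<Longrightarrow> a $ 1 = b $ 1 \<Longrightarrow> b $ 2 \<le> a $ 2 \<Longrightarrow>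
      G w * (a $ 2 - b $ 2) \<le> K * (word_map S w a $ 2 - word_map S w b $ 2)"
    "\<And>w a b. set w \<subseteq> I \<Longrightarrow> a \<in> unit_square \<Longrightarrow> b \<in> unit_square \<Longrightarrow> b $ 1 \<le> a $ 1 \<Longrightarrow>
      F w * (a $ 1 - b $ 1) \<le> K * (word_map S w a $ 1 - word_map S w b $ 1)"
proof -
  obtain K0 where K0: "1 \<le> K0"
    and fpos: "\<And>w a. set w \<subseteq> I \<Longrightarrow> a \<in> unit_square \<Longrightarrow> 0 < fword w a"
    and gpos: "\<And>w a. set w \<subseteq> I \<Longrightarrow> a \<in> unit_square \<Longrightarrow> 0 < gword w a"
    and gle: "\<And>w a. set w \<subseteq> I \<Longrightarrow> a \<in> unit_square \<Longrightarrow> gword w a \<le> fword w a"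
    and shear: "\<And>w a. set w \<subseteq> I \<Longrightarrow> a \<in> unit_square \<Longrightarrow> \<bar>shear w a\<bar> \<le> K0 * fword w a"
    and fK: "\<And>w a b. set w \<subseteq> I \<Longrightarrow> a \<in> unit_square \<Longrightarrow> b \<in> unit_square \<Longrightarrow> fword w a \<le> K0 * fword w b"
    and gK: "\<And>w a b. set w \<subseteq> I \<Longrightarrow> a \<in> unit_square \<Longrightarrow> b \<in> unit_square \<Longrightarrow> gword w a \<le> K0 * gword w b"
    by (rule cocycle_bounds) blast
  note z = zero_in_square
  \<comment> \<open>\<open>K0 + 2\<close> bounds the sum of the three entries of the Jacobian in
    terms of the width at the same point; the other factor K0 moves the base point to 0.\<close>
  define K where "K = K0 * (K0 + 2)"
  have "K0 * 1 \<le> K0 * (K0 + 2)" "K0 * K0 \<le> K0 * (K0 + 2)" "1 * (K0 + 2) \<le> K0 * (K0 + 2)"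
    using K0 by (intro mult_left_mono mult_right_mono; simp)+
  then have K: "K0 \<le> K" "K0 * K0 \<le> K" "K0 + 2 \<le> K" by (auto simp: K_def)
  have K_mono: "x \<le> K0 * y \<Longrightarrow> 0 \<le> y \<Longrightarrow> x \<le> K * y" for x y
    using mult_right_mono[OF K(1), of y] by linarith
  have fK': "fword w a \<le> K * fword w b" and gK': "gword w a \<le> K * gword w b"
    if "set w \<subseteq> I" "a \<in> unit_square" "b \<in> unit_square" for w a b
    using K_mono[OF fK[OF that]] K_mono[OF gK[OF that]] fpos[OF that(1,3)] gpos[OF that(1,3)] by auto
  have K1: "1 \<le> K" using K(1) K0 by linarith
  have x_lower: "F w * (a $ 1 - b $ 1) \<le> K * (word_map S w a $ 1 - word_map S w b $ 1)"
    if w: "set w \<subseteq> I" and ab: "a \<in> unit_square" "b \<in> unit_square" "b $ 1 \<le> a $ 1" for w a b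
  proof -
    obtain \<xi> where \<xi>: "\<xi> \<in> unit_square" "word_map S w a $ 1 - word_map S w b $ 1 = fword w \<xi> * (a $ 1 - b $ 1)"
      using word_mean_value(1)[OF w ab(1,2)] by blast
    have "F w * (a $ 1 - b $ 1) \<le> K * fword w \<xi> * (a $ 1 - b $ 1)"
      using fK'[OF w z \<xi>(1)] ab(3) by (intro mult_right_mono) auto
    then show ?thesis unfolding \<xi>(2) by (simp add: mult.assoc)
  qed
  show ?thesis
  proof (rule that[of K])
    show "1 \<le> K" by (rule K1)
    show "G w \<le> F w" if "set w \<subseteq> I" for w using gle[OF that z] .
    show "quasi_multiplicative I K F" by (rule cocycle_quasi_multiplicative[OF S_square z fpos K1 fK'])
    show "quasi_multiplicative I K G" by (rule cocycle_quasi_multiplicative[OF S_square z gpos K1 gK'])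
  next
    fix w and a b :: "real ^ 2" assume w: "set w \<subseteq> I" and ab: "a \<in> unit_square" "b \<in> unit_square"
    have K_abs: "K * x \<le> K * \<bar>x\<bar>" for x using K1 by (intro mult_left_mono) auto
    show "F w * \<bar>a $ 1 - b $ 1\<bar> \<le> K * \<bar>word_map S w a $ 1 - word_map S w b $ 1\<bar>"
    proof (cases "b $ 1 \<le> a $ 1")
      case True
      then show ?thesis
        using x_lower[OF w ab True] K_abs[of "word_map S w a $ 1 - word_map S w b $ 1"] by simp
    next
      case False
      then show ?thesis
        using x_lower[OF w ab(2,1)] K_abs[of "word_map S w b $ 1 - word_map S w a $ 1"]
        by (simp add: abs_minus_commute)
    qed
    obtain \<xi> where \<xi>: "\<xi> \<in> unit_square" "word_map S w a $ 1 - word_map S w b $ 1 = fword w \<xi> * (a $ 1 - b $ 1)"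
      using word_mean_value(1)[OF w ab] by blast
    have "fword w \<xi> * \<bar>a $ 1 - b $ 1\<bar> \<le> K * F w * \<bar>a $ 1 - b $ 1\<bar>"
      using fK'[OF w \<xi>(1) z] by (intro mult_right_mono) auto
    then show "\<bar>word_map S w a $ 1 - word_map S w b $ 1\<bar> \<le> K * (F w * \<bar>a $ 1 - b $ 1\<bar>)"
      unfolding \<xi>(2) using fpos[OF w \<xi>(1)] by (simp add: abs_mult mult.assoc)
    obtain \<zeta> where \<zeta>: "\<zeta> \<in> unit_square" "word_map S w a $ 2 - word_map S w b $ 2 =
      shear w \<zeta> * (a $ 1 - b $ 1) + gword w \<zeta> * (a $ 2 - b $ 2)"
      using word_mean_value(2)[OF w ab] by blast
    have "\<bar>shear w \<zeta>\<bar> \<le> K0 * (K0 * F w)"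
      using shear[OF w \<zeta>(1)] mult_left_mono[OF fK[OF w \<zeta>(1) z], of K0] K0 by linarith
    also have "\<dots> \<le> K * F w" using mult_right_mono[OF K(2), of "F w"] fpos[OF w z] by (simp add: mult.assoc)
    finally have s: "\<bar>shear w \<zeta>\<bar> \<le> K * F w" .
    have "\<bar>word_map S w a $ 2 - word_map S w b $ 2\<bar> \<le> \<bar>shear w \<zeta>\<bar> * \<bar>a $ 1 - b $ 1\<bar> + gword w \<zeta> * \<bar>a $ 2 - b $ 2\<bar>"
      unfolding \<zeta>(2) using abs_triangle_ineq[of "shear w \<zeta> * (a $ 1 - b $ 1)" "gword w \<zeta> * (a $ 2 - b $ 2)"]
        gpos[OF w \<zeta>(1)] by (simp add: abs_mult)
    also have "\<dots> \<le> (K * F w) * \<bar>a $ 1 - b $ 1\<bar> + (K * G w) * \<bar>a $ 2 - b $ 2\<bar>"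
      using s gK'[OF w \<zeta>(1) z] by (intro add_mono mult_right_mono) auto
    finally show "\<bar>word_map S w a $ 2 - word_map S w b $ 2\<bar> \<le> K * (F w * \<bar>a $ 1 - b $ 1\<bar> + G w * \<bar>a $ 2 - b $ 2\<bar>)"
      by (simp add: algebra_simps)
  next
    fix w and a :: "real ^ 2" assume w: "set w \<subseteq> I" and a: "a \<in> unit_square"
    define D where "D = jacobian (word_map S w) (at a within unit_square)"
    have fg: "0 < fword w a" "0 < gword w a" using fpos gpos w a by auto
    note sv = singular_values_triangular[OF word_jacobian[OF w a, folded D_def] fg]
    have le: "\<alpha>\<^sub>1 D \<le> (K0 + 2) * fword w a"
      using sv(2) shear[OF w a] gle[OF w a] by (simp add: algebra_simps)
    have pos1: "0 < \<alpha>\<^sub>1 D" using sv(1) fg by linarith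
    have \<alpha>2: "\<alpha>\<^sub>2 D = fword w a * gword w a / \<alpha>\<^sub>1 D" using sv(3) pos1 by (simp add: field_simps)
    have pos2: "0 < \<alpha>\<^sub>2 D" unfolding \<alpha>2 using fg pos1 by simp
    have "(K0 + 2) * fword w a \<le> (K0 + 2) * (K0 * F w)" using fK[OF w a z] K0 by (intro mult_left_mono) auto
    then have 1: "\<alpha>\<^sub>1 D \<le> K * F w" using le by (simp add: K_def ac_simps)
    have "F w \<le> K * fword w a" by (rule fK'[OF w z a])
    also have "\<dots> \<le> K * \<alpha>\<^sub>1 D" using sv(1) K1 by (intro mult_left_mono) auto
    finally have 2: "F w \<le> K * \<alpha>\<^sub>1 D" .
    have "fword w a * gword w a \<le> \<alpha>\<^sub>1 D * gword w a" using sv(1) fg by (intro mult_right_mono) auto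
    then have "\<alpha>\<^sub>2 D \<le> gword w a" unfolding \<alpha>2 using pos1 by (simp add: field_simps)
    then have 3: "\<alpha>\<^sub>2 D \<le> K * G w" using gK'[OF w a z] by linarith
    have "\<alpha>\<^sub>1 D * gword w a \<le> (K0 + 2) * fword w a * gword w a" using le fg by (intro mult_right_mono) auto
    then have "gword w a \<le> (K0 + 2) * \<alpha>\<^sub>2 D" unfolding \<alpha>2 using pos1 by (simp add: field_simps)
    then have "K0 * gword w a \<le> K0 * ((K0 + 2) * \<alpha>\<^sub>2 D)" using K0 by (intro mult_left_mono) auto
    then have 4: "G w \<le> K * \<alpha>\<^sub>2 D" using gK[OF w z a] by (simp add: K_def mult.assoc)
    show "let D = jacobian (word_map S w) (at a within unit_square) in
        0 < \<alpha>\<^sub>1 D \<and> \<alpha>\<^sub>1 D \<le> K * F w \<and> F w \<le> K * \<alpha>\<^sub>1 D \<and> 0 < \<alpha>\<^sub>2 D \<and> \<alpha>\<^sub>2 D \<le> K * G w \<and> G w \<le> K * \<alpha>\<^sub>2 D"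
      unfolding Let_def D_def[symmetric] using pos1 pos2 1 2 3 4 by blast
  next
    fix w and a b :: "real ^ 2"
    assume w: "set w \<subseteq> I" and ab: "a \<in> unit_square" "b \<in> unit_square" "a $ 1 = b $ 1" "b $ 2 \<le> a $ 2"
    obtain \<zeta> where \<zeta>: "\<zeta> \<in> unit_square" "word_map S w a $ 2 - word_map S w b $ 2 =
      shear w \<zeta> * (a $ 1 - b $ 1) + gword w \<zeta> * (a $ 2 - b $ 2)"
      using word_mean_value(2)[OF w ab(1,2)] by blast
    have "G w * (a $ 2 - b $ 2) \<le> K * gword w \<zeta> * (a $ 2 - b $ 2)"
      using gK'[OF w z \<zeta>(1)] ab(4) by (intro mult_right_mono) auto
    then show "G w * (a $ 2 - b $ 2) \<le> K * (word_map S w a $ 2 - word_map S w b $ 2)"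
      unfolding \<zeta>(2) using ab(3) by (simp add: mult.assoc)
  qed (rule x_lower)
qed

lemma word_continuous: "set w \<subseteq> I \<Longrightarrow> continuous_on unit_square (word_map S w)"
  using word_deriv by (rule has_derivative_continuous_on)

text \<open>The preimage of a nearby point is found by solving for its first and then for its second
  coordinate with the intermediate value theorem.\<close>

lemma word_image_contains_ball:
  obtains K1 where "1 \<le> K1"
    "\<And>w a r. set w \<subseteq> I \<Longrightarrow> a \<in> unit_square \<Longrightarrow> 0 < r \<Longrightarrow> r \<le> 1 \<Longrightarrow>
      \<exists>b\<in>open_unit_square. \<bar>b $ 1 - a $ 1\<bar> \<le> r \<and>
        (\<forall>y. dist y (word_map S w b) * K1 < min (F w * r) (G w) \<longrightarrow> y \<in> word_map S w ` open_unit_square)"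
proof -
  obtain K where K: "1 \<le> K"
    and x_lower: "\<And>w a b. set w \<subseteq> I \<Longrightarrow> a \<in> unit_square \<Longrightarrow> b \<in> unit_square \<Longrightarrow>
      F w * \<bar>a $ 1 - b $ 1\<bar> \<le> K * \<bar>word_map S w a $ 1 - word_map S w b $ 1\<bar>"
    and x_upper: "\<And>w a b. set w \<subseteq> I \<Longrightarrow> a \<in> unit_square \<Longrightarrow> b \<in> unit_square \<Longrightarrow>
      \<bar>word_map S w a $ 1 - word_map S w b $ 1\<bar> \<le> K * (F w * \<bar>a $ 1 - b $ 1\<bar>)"
    and y_upper: "\<And>w a b. set w \<subseteq> I \<Longrightarrow> a \<in> unit_square \<Longrightarrow> b \<in> unit_square \<Longrightarrow>
      \<bar>word_map S w a $ 2 - word_map S w b $ 2\<bar> \<le> K * (F w * \<bar>a $ 1 - b $ 1\<bar> + G w * \<bar>a $ 2 - b $ 2\<bar>)"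
    and y_lower: "\<And>w a b. set w \<subseteq> I \<Longrightarrow> a \<in> unit_square \<Longrightarrow> b \<in> unit_square \<Longrightarrow> a $ 1 = b $ 1 \<Longrightarrow>
      b $ 2 \<le> a $ 2 \<Longrightarrow> G w * (a $ 2 - b $ 2) \<le> K * (word_map S w a $ 2 - word_map S w b $ 2)"
    and x_mono: "\<And>w a b. set w \<subseteq> I \<Longrightarrow> a \<in> unit_square \<Longrightarrow> b \<in> unit_square \<Longrightarrow> b $ 1 \<le> a $ 1 \<Longrightarrow>
      F w * (a $ 1 - b $ 1) \<le> K * (word_map S w a $ 1 - word_map S w b $ 1)"
    by (rule word_geometry) blast
  \<comment> \<open>A target within e takes a horizontal correction of at most
    \<open>K * e / F w\<close>, for which \<open>r / 8\<close> is available. Through the shear this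
    moves the second coordinate by at most \<open>K * K * e\<close>, so the vertical error still to
    be corrected is at most \<open>(K * K + 1) * e\<close>, with room \<open>1 / 4\<close>.\<close>
  define K1 where "K1 = 8 * K * (K * K + 1)"
  have "1 * 1 \<le> K * K" using K by (intro mult_mono) auto
  then have KK: "1 \<le> K * K + 1" by linarith
  have "8 * K * 1 \<le> K1" unfolding K1_def using K KK by (intro mult_left_mono) auto
  then have K1: "8 * K \<le> K1" "1 \<le> K1" using K by auto
  show ?thesis
  proof (rule that[OF K1(2)])
    fix w and a :: "real ^ 2" and r :: real
    assume w: "set w \<subseteq> I" and a: "a \<in> unit_square" and r: "0 < r" "r \<le> 1"
    \<comment> \<open>Stepping towards the middle by \<open>r / 4\<close> leaves room for
      \<open>r / 8\<close> on both sides inside the open interval, also when a lies on the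
      boundary.\<close>
    define b1 where "b1 = (if a $ 1 \<le> 1 / 2 then a $ 1 + r / 4 else a $ 1 - r / 4)"
    have b1: "0 < b1 - r / 8" "b1 + r / 8 < 1" "\<bar>b1 - a $ 1\<bar> \<le> r"
      using a r by (auto simp: b1_def unit_square_iff)
    define P where "P t s = (vector [t, s] :: real ^ 2)" for t s
    have P [simp]: "P t s $ 1 = t" "P t s $ 2 = s" for t s by (simp_all add: P_def)
    have P_in: "P t s \<in> unit_square" if "0 \<le> t" "t \<le> 1" "0 \<le> s" "s \<le> 1" for t s
      using that by (simp add: unit_square_iff)
    have cont: "continuous_on T (\<lambda>x. word_map S w (h x) $ k)"
      if "continuous_on T h" "h ` T \<subseteq> unit_square" for T :: "real set" and h k
      using continuous_on_compose2[OF word_continuous[OF w] that] by (intro continuous_intros)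
    have P_cont: "continuous_on T (\<lambda>t. P t s)" "continuous_on T (\<lambda>s. P t s)" for T t s
      unfolding P_def vector_2_axis by (auto intro!: continuous_intros)
    define b where "b = P b1 (1 / 2)"
    have b: "b \<in> open_unit_square" using b1 r by (simp add: b_def open_unit_square_iff)
    have b': "b \<in> unit_square" using b box_subset_cbox by blast
    have "y \<in> word_map S w ` open_unit_square"
      if y: "dist y (word_map S w b) * K1 < min (F w * r) (G w)" for y
    proof -
      define e where "e = dist y (word_map S w b)"
      have e: "0 \<le> e" "e * K1 < F w * r" "e * K1 < G w" using y by (auto simp: e_def)
      have y12: "\<bar>y $ 1 - word_map S w b $ 1\<bar> \<le> e" "\<bar>y $ 2 - word_map S w b $ 2\<bar> \<le> e"
        unfolding e_def by (rule component_le_dist)+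
      have eF: "K * e \<le> F w * (r / 8)" using mult_left_mono[OF K1(1) e(1)] e(2) by (simp add: algebra_simps)
      have eG: "K * ((K * K + 1) * e) \<le> G w * (1 / 4)"
      proof -
        have "K * ((K * K + 1) * e) = e * K1 / 8" by (simp add: K1_def)
        moreover have "0 \<le> e * K1" using e(1) K1(2) by simp
        ultimately show ?thesis using e(3) by linarith
      qed
      let ?u = "\<lambda>t. word_map S w (P t (1 / 2)) $ 1"
      have P_x: "P t (1 / 2) \<in> unit_square" if "t \<in> {b1 - r / 8..b1 + r / 8}" for t
        using that b1 by (intro P_in) auto
      have "K * e \<le> K * (?u (b1 + r / 8) - ?u b1)" "K * e \<le> K * (?u b1 - ?u (b1 - r / 8))"
        using x_mono[OF w P_x[of "b1 + r / 8"] P_x[of b1]] x_mono[OF w P_x[of b1] P_x[of "b1 - r / 8"]] eF r by auto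
      then have "e \<le> ?u (b1 + r / 8) - ?u b1" "e \<le> ?u b1 - ?u (b1 - r / 8)" using K by auto
      then have "?u (b1 - r / 8) \<le> y $ 1" "y $ 1 \<le> ?u (b1 + r / 8)"
        using y12(1) unfolding b_def by linarith+
      moreover have "continuous_on {b1 - r / 8..b1 + r / 8} ?u" using P_x by (intro cont P_cont) auto
      ultimately obtain t where t: "b1 - r / 8 \<le> t" "t \<le> b1 + r / 8" "?u t = y $ 1"
        using IVT'[of ?u "b1 - r / 8" "y $ 1" "b1 + r / 8"] r by auto
      have t01: "0 < t" "t < 1" using t b1 by auto
      have Pt: "P t s \<in> unit_square" if "s \<in> {1 / 4..3 / 4}" for s using that t01 by (intro P_in) auto
      have "F w * \<bar>P t (1 / 2) $ 1 - b $ 1\<bar> \<le> K * \<bar>word_map S w (P t (1 / 2)) $ 1 - word_map S w b $ 1\<bar>"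
        by (intro x_lower w Pt b') auto
      also have "\<dots> \<le> K * e" using y12(1) t(3) K by (intro mult_left_mono) auto
      finally have Ft: "F w * \<bar>t - b1\<bar> \<le> K * e" by (simp add: b_def)
      let ?v = "\<lambda>s. word_map S w (P t s) $ 2"
      have "\<bar>?v (1 / 2) - word_map S w b $ 2\<bar> \<le> K * (F w * \<bar>P t (1 / 2) $ 1 - b $ 1\<bar> + G w * \<bar>P t (1 / 2) $ 2 - b $ 2\<bar>)"
        by (intro y_upper w Pt b') auto
      also have "\<dots> = K * (F w * \<bar>t - b1\<bar>)" by (simp add: b_def)
      also have "\<dots> \<le> K * (K * e)" using Ft K by (intro mult_left_mono) auto
      finally have "\<bar>y $ 2 - ?v (1 / 2)\<bar> \<le> (K * K + 1) * e" using y12(2) by (simp add: algebra_simps)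
      moreover have "K * ((K * K + 1) * e) \<le> K * (?v (3 / 4) - ?v (1 / 2))"
        "K * ((K * K + 1) * e) \<le> K * (?v (1 / 2) - ?v (1 / 4))"
        using y_lower[OF w Pt[of "3 / 4"] Pt[of "1 / 2"]] y_lower[OF w Pt[of "1 / 2"] Pt[of "1 / 4"]] eG by auto
      then have "(K * K + 1) * e \<le> ?v (3 / 4) - ?v (1 / 2)" "(K * K + 1) * e \<le> ?v (1 / 2) - ?v (1 / 4)"
        using K by (auto simp only: mult_le_cancel_left_pos)
      ultimately have "?v (1 / 4) \<le> y $ 2" "y $ 2 \<le> ?v (3 / 4)" by linarith+
      moreover have "continuous_on {1 / 4..3 / 4} ?v" using Pt by (intro cont P_cont) auto
      ultimately obtain s where s: "1 / 4 \<le> s" "s \<le> 3 / 4" "?v s = y $ 2"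
        using IVT'[of ?v "1 / 4" "y $ 2" "3 / 4"] by auto
      \<comment> \<open>The maps are triangular: the case of zero horizontal distance shows that
        changing the second coordinate leaves the first coordinate of the image as already
        solved.\<close>
      have "\<bar>word_map S w (P t s) $ 1 - word_map S w (P t (1 / 2)) $ 1\<bar>
        \<le> K * (F w * \<bar>P t s $ 1 - P t (1 / 2) $ 1\<bar>)" using s by (intro x_upper w Pt) auto
      then have "word_map S w (P t s) $ 1 = y $ 1" using t(3) by simp
      then have "word_map S w (P t s) = y" using s(3) by (simp add: vec_eq_iff forall_2)
      moreover have "P t s \<in> open_unit_square" using t01 s by (simp add: open_unit_square_iff)
      ultimately show ?thesis by blast
    qed
    then show "\<exists>b\<in>open_unit_square. \<bar>b $ 1 - a $ 1\<bar> \<le> r \<and>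
        (\<forall>y. dist y (word_map S w b) * K1 < min (F w * r) (G w) \<longrightarrow> y \<in> word_map S w ` open_unit_square)"
      using b b1(3) by (intro bexI[of _ b]) (auto simp: b_def)
  qed
qed

end

theorem theorem3p8:
  fixes I :: "'i set"
    and f :: "'i \<Rightarrow> real \<Rightarrow> real"
    and g :: "'i \<Rightarrow> real ^ 2 \<Rightarrow> real"
    and p :: "'i \<Rightarrow> real"
    and \<alpha> :: real
    and \<mu> :: "(real ^ 2) measure"
  defines "S \<equiv> ifs_map f g"
  defines "\<gamma> \<equiv> moment_scaling I S p \<mu>"
  assumes "0 < \<alpha>" and "\<alpha> \<le> 1"
    and "triangular_ifs \<alpha> I f g"
    and "\<forall>i\<in>I. 0 < p i \<and> p i < 1" and "(\<Sum>i\<in>I. p i) = 1"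
    and "domination I f g"
    and "nonlinear_measure I S p \<mu>"
  shows "(\<forall>q\<in>{0..1}. upper_lq_spectrum \<mu> q \<le> ereal (\<gamma> q)) \<and>
         (\<forall>q\<ge>1. lower_lq_spectrum \<mu> q \<ge> ereal (\<gamma> q)) \<and>
         (rosc I S \<longrightarrow> (\<forall>q\<ge>0. has_lq_spectrum \<mu> q (\<gamma> q)))"
proof -
  interpret T: dominated_triangular_ifs \<alpha> I f g
    using assms by unfold_locales
  obtain K where K: "1 \<le> K"
    and GF: "\<And>w. set w \<subseteq> I \<Longrightarrow> T.G w \<le> T.F w"
    and qm: "quasi_multiplicative I K T.F" "quasi_multiplicative I K T.G"
    and x_lower: "\<And>w a b. set w \<subseteq> I \<Longrightarrow> a \<in> unit_square \<Longrightarrow> b \<in> unit_square \<Longrightarrow>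
      T.F w * \<bar>a $ 1 - b $ 1\<bar> \<le> K * \<bar>word_map (ifs_map f g) w a $ 1 - word_map (ifs_map f g) w b $ 1\<bar>"
    and x_upper: "\<And>w a b. set w \<subseteq> I \<Longrightarrow> a \<in> unit_square \<Longrightarrow> b \<in> unit_square \<Longrightarrow>
      \<bar>word_map (ifs_map f g) w a $ 1 - word_map (ifs_map f g) w b $ 1\<bar> \<le> K * (T.F w * \<bar>a $ 1 - b $ 1\<bar>)"
    and y_upper: "\<And>w a b. set w \<subseteq> I \<Longrightarrow> a \<in> unit_square \<Longrightarrow> b \<in> unit_square \<Longrightarrow>
      \<bar>word_map (ifs_map f g) w a $ 2 - word_map (ifs_map f g) w b $ 2\<bar>
        \<le> K * (T.F w * \<bar>a $ 1 - b $ 1\<bar> + T.G w * \<bar>a $ 2 - b $ 2\<bar>)"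
    and sv: "\<And>w a. set w \<subseteq> I \<Longrightarrow> a \<in> unit_square \<Longrightarrow>
      (let D = jacobian (word_map (ifs_map f g) w) (at a within unit_square) in
        0 < \<alpha>\<^sub>1 D \<and> \<alpha>\<^sub>1 D \<le> K * T.F w \<and> T.F w \<le> K * \<alpha>\<^sub>1 D \<and> 0 < \<alpha>\<^sub>2 D \<and> \<alpha>\<^sub>2 D \<le> K * T.G w \<and> T.G w \<le> K * \<alpha>\<^sub>2 D)"
    by (rule T.word_geometry) blast
  obtain c where c: "0 < c" "c < 1" "\<And>i a b. i \<in> I \<Longrightarrow> a \<in> unit_square \<Longrightarrow> b \<in> unit_square \<Longrightarrow>
      dist (ifs_map f g i a) (ifs_map f g i b) \<le> c * dist a b"
    using T.contraction_ratio by blast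
  have pos: "0 < T.F w" "0 < T.G w" if "set w \<subseteq> I" for w
    using quasi_multiplicativeD(2)[OF qm(1) that] quasi_multiplicativeD(2)[OF qm(2) that] by auto
  obtain A where A: "compact A" "A \<subseteq> unit_square" "measure \<mu> A = 1"
    using assms(9) by (auto simp: nonlinear_measure_def attractor_def)
  have prob: "prob_space \<mu>" and sets: "sets \<mu> = sets borel" using assms(9) by (auto simp: nonlinear_measure_def)
  \<comment> \<open>The constant is doubled because a distance is bounded by the sum of two
    coordinate estimates, and because the diameter bound 2 enters the decay of the width.\<close>
  interpret G: ifs_geometry I "ifs_map f g" p \<mu> T.F T.G "2 * K" c
  proof (rule ifs_geometry.intro)
    show "finite I" "I \<noteq> {}" by (rule T.finite_I T.I_nonempty)+
    show "0 < p i" if "i \<in> I" for i using assms that by blast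
    show "prob_space \<mu>" "sets \<mu> = sets borel" by (rule prob sets)+
    interpret prob_space \<mu> by (rule prob)
    have "measure \<mu> A \<le> measure \<mu> unit_square" using A(2) by (rule finite_measure_mono) (simp add: sets)
    then show "measure \<mu> unit_square = 1" using A(3) prob_le_1[of unit_square] by linarith
    show "ifs_map f g i a \<in> unit_square" if "i \<in> I" "a \<in> unit_square" for i a using that by (rule T.S_square)
    show "continuous_on unit_square (ifs_map f g i)" if "i \<in> I" for i
      using T.word_continuous[of "[i]"] that by simp
    show "measure \<mu> B = (\<Sum>i\<in>I. p i * measure \<mu> {x\<in>unit_square. ifs_map f g i x \<in> B})" if "B \<in> sets borel" for B
      using assms(9) that unfolding nonlinear_measure_def S_def by blast
    show "quasi_multiplicative I (2 * K) T.F" "quasi_multiplicative I (2 * K) T.G"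
      using qm K by (auto intro: quasi_multiplicative_mono)
    fix w assume w: "set w \<subseteq> I"
    show "T.G w \<le> T.F w" using w by (rule GF)
    show "T.F w \<le> 2 * K * c ^ length w"
    proof -
      \<comment> \<open>A corner at horizontal distance 1 from 0, so the width is bounded by the
        distance of two image points, which contracts at the rate c.\<close>
      let ?a = "axis 1 1 :: real ^ 2"
      have a: "?a \<in> unit_square" by (simp add: unit_square_iff axis_def)
      have "T.F w \<le> K * \<bar>word_map (ifs_map f g) w ?a $ 1 - word_map (ifs_map f g) w 0 $ 1\<bar>"
        using x_lower[OF w a T.zero_in_square] by simp
      also have "\<dots> \<le> K * (c ^ length w * dist ?a 0)"
        using order_trans[OF component_le_dist word_map_dist[OF T.S_square c(3) less_imp_le[OF c(1)] w a T.zero_in_square]] K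
        by (intro mult_left_mono) auto
      also have "\<dots> \<le> K * (c ^ length w * 2)"
        using unit_square_diameter[OF a T.zero_in_square] K c(1) by (intro mult_left_mono) auto
      finally show ?thesis by simp
    qed
    fix a b :: "real ^ 2" assume ab: "a \<in> unit_square" "b \<in> unit_square"
    show "T.F w * \<bar>a $ 1 - b $ 1\<bar> \<le> 2 * K * \<bar>word_map (ifs_map f g) w a $ 1 - word_map (ifs_map f g) w b $ 1\<bar>"
      using x_lower[OF w ab] mult_nonneg_nonneg[of K "\<bar>word_map (ifs_map f g) w a $ 1 - word_map (ifs_map f g) w b $ 1\<bar>"] K
      by linarith
    have nn: "0 \<le> K * (T.F w * \<bar>a $ 1 - b $ 1\<bar>)" using pos[OF w] K by simp
    then show "\<bar>word_map (ifs_map f g) w a $ 1 - word_map (ifs_map f g) w b $ 1\<bar> \<le> 2 * K * (T.F w * \<bar>a $ 1 - b $ 1\<bar>)"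
      using x_upper[OF w ab] by linarith
    have "\<bar>a $ 2 - b $ 2\<bar> \<le> 1" using ab by (auto simp: unit_square_iff)
    then have "K * (T.G w * \<bar>a $ 2 - b $ 2\<bar>) \<le> K * (T.G w * 1)" using pos[OF w] K by (intro mult_left_mono) auto
    moreover have "0 \<le> K * T.G w" using pos[OF w] K by simp
    ultimately show "dist (word_map (ifs_map f g) w a) (word_map (ifs_map f g) w b)
        \<le> 2 * K * (T.F w * \<bar>a $ 1 - b $ 1\<bar> + T.G w)"
      using dist_le_components[of "word_map (ifs_map f g) w a" "word_map (ifs_map f g) w b"]
        x_upper[OF w ab] y_upper[OF w ab] by (simp add: algebra_simps)
  qed (use assms c in auto)
  have \<gamma>: "\<exists>B. (\<forall>n. 1 / B \<le> (\<Sum>w\<in>words I n. G.potential q (\<gamma> q) w)) \<and> (\<forall>n. (\<Sum>w\<in>words I n. G.potential q (\<gamma> q) w) \<le> B)" for q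
    unfolding \<gamma>_def S_def
    by (rule G.moment_scaling_potential_sum[OF sv[unfolded Let_def] K]) blast+
  have upper: "upper_lq_spectrum \<mu> q \<le> ereal (\<gamma> q)"
    if "0 \<le> q" "C > 0" "\<And>\<delta>. 0 < \<delta> \<Longrightarrow> \<delta> < 1 \<Longrightarrow> lq_sum \<mu> q \<delta> \<le> C * G.word_sum q \<delta>" for q C
    using \<gamma>[of q] G.upper_lq_spectrum_le[OF that(1) _ _ that(2,3)] by blast
  have lower: "ereal (\<gamma> q) \<le> lower_lq_spectrum \<mu> q"
    if "0 \<le> q" "C > 0" "\<And>\<delta>. 0 < \<delta> \<Longrightarrow> \<delta> < 1 \<Longrightarrow> G.word_sum q \<delta> \<le> C * lq_sum \<mu> q \<delta>" for q C
    using \<gamma>[of q] G.lower_lq_spectrum_ge[OF that(1) _ _ that(2,3)] by blast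
  have spectrum: "has_lq_spectrum \<mu> q (\<gamma> q)" if rosc: "rosc I S" and q: "0 \<le> q" for q
  proof -
    obtain K1 where K1: "1 \<le> K1" "\<And>w a r. set w \<subseteq> I \<Longrightarrow> a \<in> unit_square \<Longrightarrow> 0 < r \<Longrightarrow> r \<le> 1 \<Longrightarrow>
      \<exists>b\<in>open_unit_square. \<bar>b $ 1 - a $ 1\<bar> \<le> r \<and>
        (\<forall>y. dist y (word_map (ifs_map f g) w b) * K1 < min (T.F w * r) (T.G w) \<longrightarrow>
          y \<in> word_map (ifs_map f g) w ` open_unit_square)"
      by (rule T.word_image_contains_ball) blast
    obtain N where N: "\<And>\<delta> Q. 0 < \<delta> \<Longrightarrow> \<delta> < 1 \<Longrightarrow> Q \<in> G.cells \<delta> \<Longrightarrow>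
        card {w\<in>stopping_words I T.G \<delta>. G.hits w Q \<noteq> {}} \<le> N"
      using G.rosc_multiplicity[OF rosc[unfolded S_def] T.S_inj K1] by blast
    have "upper_lq_spectrum \<mu> q \<le> ereal (\<gamma> q)"
    proof (rule upper[OF q])
      \<comment> \<open>Taking \<open>N + 1\<close> instead of N keeps the constant
        positive.\<close>
      show "0 < real (N + 1) powr q" by simp
      fix \<delta> :: real assume \<delta>: "0 < \<delta>" "\<delta> < 1"
      show "lq_sum \<mu> q \<delta> \<le> real (N + 1) powr q * G.word_sum q \<delta>"
        using N[OF \<delta>] by (intro G.lq_sum_word_sum_multiplicity(1) \<delta> q) (auto intro: le_SucI)
    qed
    moreover have "ereal (\<gamma> q) \<le> lower_lq_spectrum \<mu> q"
    proof (rule lower[OF q])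
      show "0 < real (N + 1)" by simp
      fix \<delta> :: real assume \<delta>: "0 < \<delta>" "\<delta> < 1"
      show "G.word_sum q \<delta> \<le> real (N + 1) * lq_sum \<mu> q \<delta>"
        using N[OF \<delta>] by (intro G.lq_sum_word_sum_multiplicity(2) \<delta> q) (auto intro: le_SucI)
    qed
    moreover have "lower_lq_spectrum \<mu> q \<le> upper_lq_spectrum \<mu> q"
      unfolding lower_lq_spectrum_def upper_lq_spectrum_def by (rule Liminf_le_Limsup_at_right)
    ultimately show ?thesis unfolding has_lq_spectrum_def by (auto intro: antisym order_trans)
  qed
  show ?thesis
  proof (intro conjI ballI allI impI)
    show "upper_lq_spectrum \<mu> q \<le> ereal (\<gamma> q)" if "q \<in> {0..1}" for q
      using that G.lq_sum_le_word_sum by (intro upper[of q 1]) auto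
    show "ereal (\<gamma> q) \<le> lower_lq_spectrum \<mu> q" if "1 \<le> q" for q
      using that G.word_sum_le_lq_sum by (intro lower[of q 1]) auto
  qed (rule spectrum)
qed

end
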